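(* Let $K$ be a field of characteristic zero. Let $2\leq d:=d_1=d_2<d_3$ be integers such that $2d\leq d_3+1$. Let $f_1,f_2,f_3\in S=K[x_1,x_2,x_3]$ be a regular sequence of homogeneous polynomials of degrees $d_1,d_2,d_3$, let $I=(f_1,f_2,f_3)$ and let $J=\operatorname{Gin}(I)$ be the generic initial ideal with respect to the reverse lexicographic order. If $S/I$ has the strong Lefschetz property, then $J$ is the ideal generated by - $x_1^d$, and $x_1^{d-j-1}x_2^{2j+1}$ for $0\leq j\leq d-1$; - $x_2^{2d-2j-2}x_3^{d_3-2d+2j+2}\{x_1,x_2\}^j$ for $0\leq j\leq d-2$; - $x_3^{d_3+2j-2}\{x_1,x_2\}^{d-j}$ for $1\leq j\leq d$.
   Context: $\{x_1,x_2\}^j$ denotes the set of all monomials of degree $j$ in $x_1,x_2$ (with $\{x_1,x_2\}^0=\{1\}$), and $m\{x_1,x_2\}^j$ is the set of products of the monomial $m$ with elements of it. $S/I$ has the strong Lefschetz property (SLP) if there is a linear form $\ell\in S$ such that for all integers $b\geq 1$ and $t\geq 0$ the multiplication map $\ell^b:(S/I)_t\to(S/I)_{t+b}$ is injective or surjective. $\operatorname{Gin}(I)$ is the common initial ideal, with respect to the graded reverse lexicographic order with $x_1>x_2>x_3$, of $\alpha I$ for all $\alpha$ in a nonempty Zariski open subset of $GL_3(K)$ acting by linear changes of coordinates. *)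

theory Defs
  imports "HOL-Analysis.Analysis" "HOL-Library.Poly_Mapping" "HOL-Library.Set_Algebras"
begin

section \<open>Polynomials\<close>

text \<open>
  Polynomials are finitely supported functions from exponent vectors to coefficients, with the
  convolution product of \<^theory>\<open>HOL-Library.Poly_Mapping\<close>. The ring \<open>S = K[x\<^sub>1, x\<^sub>2, x\<^sub>3]\<close> is
  \<open>(3, K) mpol\<close>. Its variables are \<open>Var 1\<close>, \<open>Var 2\<close>, \<open>Var 3\<close>; in the index type \<open>3\<close> the numeral
  \<open>3\<close> equals \<open>0\<close>, so the built-in order of that type is never used here.
\<close>

type_synonym 'v expo = "'v \<Rightarrow>\<^sub>0 nat"
type_synonym ('v, 'a) mpol = "('v \<Rightarrow>\<^sub>0 nat) \<Rightarrow>\<^sub>0 'a"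

definition Monom :: "'v expo \<Rightarrow> ('v, 'a::comm_ring_1) mpol" where
  "Monom m = Poly_Mapping.single m 1"

definition Const :: "'a::comm_ring_1 \<Rightarrow> ('v, 'a) mpol" where
  "Const c = Poly_Mapping.single 0 c"

definition Var :: "'v \<Rightarrow> ('v, 'a::comm_ring_1) mpol" where
  "Var i = Monom (Poly_Mapping.single i 1)"

definition expo_deg :: "'v::finite expo \<Rightarrow> nat" where
  "expo_deg m = (\<Sum>i\<in>UNIV. Poly_Mapping.lookup m i)"

text \<open>As usual, the zero polynomial is homogeneous of every degree.\<close>

definition homogeneous :: "nat \<Rightarrow> ('v::finite, 'a::comm_ring_1) mpol \<Rightarrow> bool" where
  "homogeneous t f \<longleftrightarrow> (\<forall>m\<in>Poly_Mapping.keys f. expo_deg m = t)"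

text \<open>Substitution of \<open>v i\<close> for the variable \<open>i\<close>, with the coefficients mapped by \<open>h\<close>.\<close>

definition subst_mpol ::
    "('a::comm_ring_1 \<Rightarrow> 'b::comm_ring_1) \<Rightarrow> ('v::finite \<Rightarrow> 'b) \<Rightarrow> ('v, 'a) mpol \<Rightarrow> 'b" where
  "subst_mpol h v f =
     (\<Sum>m\<in>Poly_Mapping.keys f.
        h (Poly_Mapping.lookup f m) * (\<Prod>i\<in>UNIV. v i ^ Poly_Mapping.lookup m i))"


section \<open>Ideals and regular sequences\<close>

definition gen_ideal :: "'r::comm_ring_1 set \<Rightarrow> 'r set" where
  "gen_ideal B = module.span (*) B"

definition regular_sequence :: "'r::comm_ring_1 list \<Rightarrow> bool" where
  "regular_sequence fs \<longleftrightarrow>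
     (\<forall>i<length fs. \<forall>g. fs ! i * g \<in> gen_ideal (set (take i fs)) \<longrightarrow> g \<in> gen_ideal (set (take i fs)))
     \<and> gen_ideal (set fs) \<noteq> UNIV"


section \<open>The strong Lefschetz property\<close>

text \<open>
  Elements of \<open>S/I\<close> are the cosets \<open>f +o I\<close>; for a homogeneous ideal \<open>I\<close> the component \<open>(S/I)\<^sub>t\<close>
  consists of the cosets of the homogeneous polynomials of degree \<open>t\<close>. If \<open>I\<close> is an ideal, then
  \<open>quot_mult I g\<close> maps \<open>f +o I\<close> to \<open>(g * f) +o I\<close>.
\<close>

definition quot_comp :: "('v::finite, 'a::comm_ring_1) mpol set \<Rightarrow> nat \<Rightarrow> ('v, 'a) mpol set set" where
  "quot_comp I t = (\<lambda>f. f +o I) ` {f. homogeneous t f}"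

definition quot_mult :: "'r::comm_ring_1 set \<Rightarrow> 'r \<Rightarrow> 'r set \<Rightarrow> 'r set" where
  "quot_mult I g X = g *o X + I"

definition SLP :: "('v::finite, 'a::comm_ring_1) mpol set \<Rightarrow> bool" where
  "SLP I \<longleftrightarrow>
     (\<exists>l. homogeneous 1 l \<and>
       (\<forall>b\<ge>1. \<forall>t. inj_on (quot_mult I (l ^ b)) (quot_comp I t) \<or>
                  quot_mult I (l ^ b) ` quot_comp I t = quot_comp I (t + b)))"


section \<open>Generic initial ideals\<close>

text \<open>
  The graded reverse lexicographic order with \<open>x\<^sub>1 > x\<^sub>2 > x\<^sub>3\<close>: among monomials of the same degree,
  the smaller one has the larger exponent at the last variable where the two differ. If the degrees
  and the exponents of \<open>x\<^sub>3\<close> and \<open>x\<^sub>2\<close> agree, so do the exponents of \<open>x\<^sub>1\<close>.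
\<close>

definition grevlex_less :: "3 expo \<Rightarrow> 3 expo \<Rightarrow> bool" where
  "grevlex_less m n \<longleftrightarrow>
     expo_deg m < expo_deg n \<or>
     expo_deg m = expo_deg n \<and>
       (Poly_Mapping.lookup m 3 > Poly_Mapping.lookup n 3 \<or>
        Poly_Mapping.lookup m 3 = Poly_Mapping.lookup n 3 \<and>
          Poly_Mapping.lookup m 2 > Poly_Mapping.lookup n 2)"

definition is_leading :: "3 expo \<Rightarrow> (3, 'a::comm_ring_1) mpol \<Rightarrow> bool" where
  "is_leading m f \<longleftrightarrow>
     m \<in> Poly_Mapping.keys f \<and> (\<forall>n\<in>Poly_Mapping.keys f. n \<noteq> m \<longrightarrow> grevlex_less n m)"

definition initial_ideal :: "(3, 'a::comm_ring_1) mpol set \<Rightarrow> (3, 'a) mpol set" where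
  "initial_ideal I = gen_ideal {Monom m | m. \<exists>f\<in>I. is_leading m f}"

text \<open>
  A matrix \<open>A\<close> acts by the linear change of coordinates \<open>x\<^sub>j \<mapsto> \<Sum>\<^sub>i A\<^sub>i\<^sub>j x\<^sub>i\<close>, which is a left action.
\<close>

definition coord_change :: "'a::comm_ring_1^3^3 \<Rightarrow> (3, 'a) mpol \<Rightarrow> (3, 'a) mpol" where
  "coord_change A f = subst_mpol Const (\<lambda>j. \<Sum>i\<in>UNIV. Const (A $ i $ j) * Var i) f"

definition GL3 :: "('a::field^3^3) set" where
  "GL3 = {A. invertible A}"

text \<open>
  Since \<open>GL\<^sub>3\<close> is the locus \<open>det \<noteq> 0\<close> in the affine space of matrices, its Zariski open subsets are
  the unions of non-vanishing loci in \<open>GL\<^sub>3\<close> of polynomials in the nine matrix entries.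
\<close>

definition zariski_open_GL3 :: "('a::field^3^3) set \<Rightarrow> bool" where
  "zariski_open_GL3 U \<longleftrightarrow>
     (\<exists>P :: (3 \<times> 3, 'a) mpol set.
        U = {A \<in> GL3. \<exists>p\<in>P. subst_mpol id (\<lambda>(i, j). A $ i $ j) p \<noteq> 0})"

definition gin :: "(3, 'a::field) mpol set \<Rightarrow> (3, 'a) mpol set" where
  "gin I = (THE J. \<exists>U. zariski_open_GL3 U \<and> U \<noteq> {} \<and>
                       (\<forall>A\<in>U. initial_ideal (coord_change A ` I) = J))"


section \<open>Monomials in the first two variables\<close>

definition monomials12 :: "nat \<Rightarrow> (3, 'a::comm_ring_1) mpol set" where
  "monomials12 j = {Var 1 ^ a * Var 2 ^ b | a b. a + b = j}"

end

theory Submission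
  imports Defs "HOL-Computational_Algebra.Polynomial"
begin

text \<open>
  Write \<open>e\<close> for \<open>d\<^sub>3\<close> and \<open>s = 2d + e - 3\<close> for the socle degree of \<open>S/I\<close>. The monomials outside the
  claimed ideal are exactly
    \<open>x\<^sub>1\<^sup>a x\<^sub>2\<^sup>b x\<^sub>3\<^sup>c\<close> with \<open>2a + b \<le> 2d - 2\<close> and \<open>2(a + b) + c \<le> s\<close>
  (\<open>std d e\<close>, \<open>gen_ideal_nonstandard\<close>), so the claim is that these are the standard monomials of
  \<open>\<alpha>I\<close> for general \<open>\<alpha>\<close>.

  Numerical side. Let \<open>g\<^sub>i = max 0 (min (i + 1) (2d - 1 - i))\<close> and \<open>G(k) = g\<^sub>0 + \<dots> + g\<^sub>k\<close>. From the
  regular sequence, \<open>S/I\<close> has the Hilbert function \<open>h\<^sub>t = G(min t (s - t))\<close>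
  (\<open>hilb_complete_intersection\<close>), hence \<open>min h\<^sub>n h\<^sub>n\<^sub>+\<^sub>c = G(min n (s - n - c))\<close>, and this is also the
  number of monomials in \<open>std d e\<close> of degree \<open>n + c\<close> that are divisible by \<open>x\<^sub>3\<^sup>c\<close>
  (\<open>card_std_part\<close>).

  Sufficient condition. Multiplication by \<open>x\<^sub>3\<^sup>c\<close> from degree \<open>n\<close> to degree \<open>n + c\<close> never has rank
  above \<open>min h\<^sub>n h\<^sub>n\<^sub>+\<^sub>c\<close>. So if \<open>std d e\<close> is linearly independent modulo \<open>\<alpha>I\<close>, then its members
  divisible by \<open>x\<^sub>3\<^sup>c\<close> span the image of \<open>x\<^sub>3\<^sup>c\<close> modulo \<open>\<alpha>I\<close> in each degree. Every other monomial of
  the same degree with \<open>x\<^sub>3\<close>-exponent \<open>c\<close> is larger than these, so it is a leading monomial, and the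
  initial ideal is the expected one (\<open>initial_ideal_eq_std\<close>).

  Openness. If \<open>std d e\<close> is independent modulo \<open>\<alpha>I\<close> for one \<open>\<alpha>\<close>, then some polynomial in the matrix
  entries does not vanish there and forces this independence wherever it does not vanish on \<open>GL\<^sub>3\<close>
  (\<open>std_independent_open\<close>), and two nonempty Zariski open subsets of \<open>GL\<^sub>3\<close>
  meet (\<open>zariski_open_GL3_meet\<close>). It remains to find one \<open>\<alpha>\<close> with that independence.

  Existence. Move a strong Lefschetz form to \<open>x\<^sub>3\<close>; then all these ranks equal \<open>min h\<^sub>n h\<^sub>n\<^sub>+\<^sub>c\<close>. The
  forms \<open>f\<close> of degree \<open>n\<close> with \<open>x\<^sub>3\<^sup>c f \<in> I + x\<^sub>3\<^sup>c\<^sup>+\<^sup>1 S\<close>, restricted to \<open>x\<^sub>3 = 0\<close>, make up a space of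
  binary forms of codimension \<open>\<delta> = G(min n (s - n - c)) - G(min (n - 1) (s - n - c))\<close>. In
  characteristic zero no nonzero element of an \<open>r\<close>-dimensional space of univariate polynomials
  vanishes to order \<open>r\<close> at a general point (\<open>finite_high_vanishing\<close>, a Wronskian argument).
  Therefore the multiples of \<open>y\<^sup>n\<^sup>+\<^sup>1\<^sup>-\<^sup>\<delta>\<close> are a complement for a general form \<open>y = x\<^sub>2 - p x\<^sub>1\<close>
  (\<open>generic_complement\<close>). The shear taking \<open>y\<close> to \<open>x\<^sub>2\<close> makes \<open>std d e\<close> span \<open>S\<close> modulo the ideal,
  and counting dimensions makes it independent (\<open>generic_spanning\<close>).
\<close>

section \<open>Dimensions of finite-dimensional subspaces\<close>

text \<open>
  A copy of the locale of vector spaces: facts and definitions added to the original would be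
  inherited by its interpretation for real vector spaces, and take over the short names.
\<close>

locale vec_space = vector_space scale
  for scale :: "'a::field \<Rightarrow> 'b::ab_group_add \<Rightarrow> 'b"
begin

text \<open>
  Contained in the span of a finite set; \<open>V\<close> need not be a subspace.
\<close>

definition fin_dim :: "'b set \<Rightarrow> bool" where
  "fin_dim V \<longleftrightarrow> (\<exists>F. finite F \<and> V \<subseteq> span F)"

lemma fin_dim_subset: "fin_dim W \<Longrightarrow> V \<subseteq> W \<Longrightarrow> fin_dim V"
  unfolding fin_dim_def by blast

lemma fin_dim_span: "finite F \<Longrightarrow> fin_dim (span F)"
  unfolding fin_dim_def by blast

lemma fin_dim_independent:
  assumes "fin_dim V" "independent B" "B \<subseteq> V" shows "finite B" "card B \<le> dim V"
proof -
  from assms(1) obtain F where F: "finite F" "V \<subseteq> span F" unfolding fin_dim_def by blast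
  then show fin: "finite B" using independent_span_bound[of F B] assms by blast
  obtain C where C: "C \<subseteq> V" "independent C" "V \<subseteq> span C" "card C = dim V"
    using basis_exists[of V] by blast
  have "finite C" using independent_span_bound[of F C] C F by blast
  then show "card B \<le> dim V"
    using independent_span_bound[of C B] C assms by auto
qed

lemma fin_dim_basis:
  assumes "fin_dim V"
  obtains B where "finite B" "B \<subseteq> V" "independent B" "V \<subseteq> span B" "card B = dim V"
proof -
  obtain B where B: "B \<subseteq> V" "independent B" "V \<subseteq> span B" "card B = dim V"
    using basis_exists[of V] by blast
  then show thesis using that fin_dim_independent(1)[OF assms B(2,1)] by blast
qed

lemma dim_mono_fin:
  assumes "fin_dim W" "V \<subseteq> W" shows "dim V \<le> dim W"
proof (rule basis_exists[of V])
  fix B assume B: "B \<subseteq> V" "independent B" "card B = dim V"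
  have "card B \<le> dim W" using fin_dim_independent(2)[OF assms(1) B(2)] B(1) assms(2) by blast
  then show "dim V \<le> dim W" using B(3) by simp
qed

lemma dim_eq_subset:
  assumes "fin_dim W" "subspace V" "V \<subseteq> W" "dim W \<le> dim V" shows "V = W"
proof
  show "W \<subseteq> V"
  proof
    fix x assume x: "x \<in> W"
    obtain B where B: "finite B" "B \<subseteq> V" "independent B" "V \<subseteq> span B" "card B = dim V"
      using fin_dim_basis[OF fin_dim_subset[OF assms(1,3)]] by blast
    show "x \<in> V"
    proof (rule ccontr)
      assume "x \<notin> V"
      then have nx: "x \<notin> span B" using span_minimal[OF B(2) assms(2)] by blast
      then have "independent (insert x B)" using B(3) independent_insertI by blast
      then have "card (insert x B) \<le> dim W"
        using fin_dim_independent(2)[OF assms(1)] x B(2) assms(3) by blast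
      moreover have "x \<notin> B" using nx span_base by blast
      ultimately show False using B(1,5) assms(4) by simp
    qed
  qed
qed (use assms in auto)

lemma subspace_plus:
  assumes "subspace V" "subspace W" shows "subspace (V + W)"
proof -
  have "V + W = {x + y |x y. x \<in> V \<and> y \<in> W}" by (auto simp: set_plus_def)
  then show ?thesis using subspace_sums[OF assms] by simp
qed

lemma fin_dim_plus: assumes "fin_dim V" "fin_dim W" shows "fin_dim (V + W)"
proof -
  obtain F G where "finite F" "V \<subseteq> span F" "finite G" "W \<subseteq> span G"
    using assms unfolding fin_dim_def by blast
  then have "finite (F \<union> G)" "V + W \<subseteq> span (F \<union> G)"
    by (force simp: set_plus_def span_Un)+
  then show ?thesis unfolding fin_dim_def by blast
qed

lemma dim_zero_space [simp]: "dim {0} = 0"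
  by (rule dim_unique[of "{}"]) (auto simp: dependent_def)

lemma dim_eq_zero_fin: "fin_dim V \<Longrightarrow> dim V = 0 \<Longrightarrow> V \<subseteq> {0}"
  by (metis card_0_eq fin_dim_basis span_empty)

end

locale vec_space_pair = vs1: vec_space s1 + vs2: vec_space s2
  for s1 :: "'a::field \<Rightarrow> 'b::ab_group_add \<Rightarrow> 'b" and s2 :: "'a \<Rightarrow> 'c::ab_group_add \<Rightarrow> 'c"
begin

text \<open>
  Rank-nullity for the map from \<open>W\<close> into the quotient by \<open>V\<close>; it contains rank-nullity
  (\<open>V = {0}\<close>) and the dimension formula for sums (\<open>f\<close> the identity).
\<close>

lemma dim_add_image:
  assumes lin: "Vector_Spaces.linear s1 s2 f"
    and V: "vs2.subspace V" "vs2.fin_dim V" and W: "vs1.subspace W" "vs1.fin_dim W"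
  shows "vs2.dim (V + f ` W) + vs1.dim {w \<in> W. f w \<in> V} = vs2.dim V + vs1.dim W"
proof -
  interpret f: Vector_Spaces.linear s1 s2 f by (rule lin)
  let ?K = "{w \<in> W. f w \<in> V}"
  have subK: "vs1.subspace ?K"
    using V W by (auto simp: vs1.subspace_def vs2.subspace_def f.zero f.add f.scale)
  obtain B' where B': "finite B'" "B' \<subseteq> ?K" "vs1.independent B'" "?K \<subseteq> vs1.span B'"
      "card B' = vs1.dim ?K"
    using vs1.fin_dim_basis[of ?K] vs1.fin_dim_subset[OF W(2), of ?K] by blast
  have spK: "vs1.span B' = ?K" using vs1.span_subspace B' subK by blast
  obtain B where B: "B' \<subseteq> B" "B \<subseteq> W" "vs1.independent B" "W \<subseteq> vs1.span B"
    using vs1.maximal_independent_subset_extend[of B' W] B' by blast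
  have finB: "finite B" using vs1.fin_dim_independent[OF W(2)] B by blast
  have cardB: "card B = vs1.dim W" using vs1.basis_card_eq_dim B by blast
  have spB: "vs1.span B = W" using vs1.span_subspace B W by blast
  obtain C where C: "finite C" "C \<subseteq> V" "vs2.independent C" "V \<subseteq> vs2.span C" "card C = vs2.dim V"
    using vs2.fin_dim_basis[OF V(2)] by blast
  have spC: "vs2.span C = V" using vs2.span_subspace C V by blast
  have spCD: "vs2.span (C \<union> f ` D) = V + f ` vs1.span D" for D
    by (auto simp: vs2.span_Un spC f.span_image set_plus_def)
  have main: "vs2.independent (C \<union> f ` D) \<and> card (C \<union> f ` D) = card C + card D \<and> finite (C \<union> f ` D)"
    if "finite D" "D \<subseteq> B - B'" for D
    using that
  proof (induction D rule: finite_induct)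
    case empty
    then show ?case using C by simp
  next
    case (insert x D)
    have nx: "f x \<notin> vs2.span (C \<union> f ` D)"
    proof
      assume "f x \<in> vs2.span (C \<union> f ` D)"
      then obtain v y where vy: "v \<in> V" "y \<in> vs1.span D" "f x = v + f y"
        by (auto simp: spCD set_plus_def)
      have yW: "y \<in> W" using vy(2) vs1.span_mono[of D B] insert.prems spB by blast
      have "x - y \<in> ?K"
        using vy yW insert.prems B(2) vs1.subspace_diff[OF W(1)] by (auto simp: f.diff)
      then have "x - y \<in> vs1.span B'" by (simp add: spK)
      then have "(x - y) + y \<in> vs1.span (B' \<union> D)"
        unfolding vs1.span_Un using vy(2) by blast
      moreover have "B' \<union> D \<subseteq> B - {x}" using insert B(1) by auto
      ultimately have "x \<in> vs1.span (B - {x})"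
        using vs1.span_mono[of "B' \<union> D" "B - {x}"] by auto
      then show False using B(3) insert.prems unfolding vs1.dependent_def by blast
    qed
    then have nCD: "f x \<notin> C \<union> f ` D" using vs2.span_base[of "f x" "C \<union> f ` D"] by blast
    have IH: "vs2.independent (C \<union> f ` D)" "card (C \<union> f ` D) = card C + card D"
        "finite (C \<union> f ` D)"
      using insert by auto
    have "C \<union> f ` insert x D = insert (f x) (C \<union> f ` D)" by simp
    then show ?case
      using IH nCD insert.hyps vs2.independent_insertI[OF nx IH(1)] by (simp only: card_insert_disjoint) simp
  qed
  let ?D = "B - B'"
  have "V + f ` W = vs2.span (C \<union> f ` ?D)"
  proof
    show "V + f ` W \<subseteq> vs2.span (C \<union> f ` ?D)"
    proof
      fix z assume "z \<in> V + f ` W"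
      then obtain v w where vw: "v \<in> V" "w \<in> W" "z = v + f w" by (auto simp: set_plus_def)
      have "w \<in> vs1.span (B' \<union> ?D)" using B vw(2) by (auto simp: Un_absorb1)
      then obtain a b where ab: "a \<in> vs1.span B'" "b \<in> vs1.span ?D" "w = a + b"
        unfolding vs1.span_Un by blast
      then have "f a \<in> V" using spK by blast
      then have "v + f a \<in> V" using vw(1) V(1) vs2.subspace_add by blast
      then show "z \<in> vs2.span (C \<union> f ` ?D)"
        unfolding spCD using ab vw by (auto simp: set_plus_def f.add add.assoc[symmetric])
    qed
    show "vs2.span (C \<union> f ` ?D) \<subseteq> V + f ` W"
      unfolding spCD using vs1.span_mono[of ?D B] spB by (intro set_plus_mono2 image_mono) auto
  qed
  then have "vs2.dim (V + f ` W) = card (C \<union> f ` ?D)"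
    using main[of ?D] finB vs2.dim_span_eq_card_independent by simp
  moreover have "card (C \<union> f ` ?D) = card C + card ?D" using main[of ?D] finB by blast
  moreover have "card ?D = card B - card B'" "card B' \<le> card B"
    using B'(1) B(1) finB by (simp_all add: card_Diff_subset card_mono)
  ultimately show ?thesis using C(5) B'(5) cardB by linarith
qed

lemma fin_dim_image:
  assumes "Vector_Spaces.linear s1 s2 f" "vs1.fin_dim W"
  shows "vs2.fin_dim (f ` W)"
proof -
  interpret f: Vector_Spaces.linear s1 s2 f by (rule assms)
  obtain F where "finite F" "W \<subseteq> vs1.span F" using assms(2) unfolding vs1.fin_dim_def by blast
  then show ?thesis unfolding vs2.fin_dim_def by (intro exI[of _ "f ` F"]) (auto simp: f.span_image)
qed

lemma dim_image_kernel:
  assumes "Vector_Spaces.linear s1 s2 f" "vs1.subspace W" "vs1.fin_dim W"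
  shows "vs2.dim (f ` W) + vs1.dim {w \<in> W. f w = 0} = vs1.dim W"
proof -
  have "vs2.fin_dim {0}" using vs2.fin_dim_span[of "{}"] by simp
  then show ?thesis
    using dim_add_image[OF assms(1) vs2.subspace_single_0 _ assms(2,3)]
    by (simp add: set_plus_def)
qed

lemma dim_image_inj:
  assumes "Vector_Spaces.linear s1 s2 f" "vs1.subspace W" "vs1.fin_dim W"
    and "\<And>w. w \<in> W \<Longrightarrow> f w = 0 \<Longrightarrow> w = 0"
  shows "vs2.dim (f ` W) = vs1.dim W"
proof -
  interpret f: Vector_Spaces.linear s1 s2 f by (rule assms)
  have "{w \<in> W. f w = 0} = {0}" using assms(4) vs1.subspace_0[OF assms(2)] by (auto simp: f.zero)
  then show ?thesis using dim_image_kernel[OF assms(1-3)] by simp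
qed

end

section \<open>Ring homomorphisms and substitution\<close>

text \<open>
  Unital homomorphisms of commutative rings.
\<close>

definition rhom :: "('a::comm_ring_1 \<Rightarrow> 'b::comm_ring_1) \<Rightarrow> bool" where
  "rhom h \<longleftrightarrow> h 1 = 1 \<and> (\<forall>x y. h (x + y) = h x + h y) \<and> (\<forall>x y. h (x * y) = h x * h y)"

lemma rhomD:
  assumes "rhom h"
  shows "h 1 = 1" "h (x + y) = h x + h y" "h (x * y) = h x * h y"
  using assms by (auto simp: rhom_def)

lemma rhom_zero: assumes "rhom h" shows "h 0 = 0"
  using rhomD(2)[OF assms, of 0 0] by simp

lemma rhom_uminus: assumes "rhom h" shows "h (- x) = - h x"
  using rhomD(2)[OF assms, of x "- x"] rhom_zero[OF assms] by (simp add: eq_neg_iff_add_eq_0 add.commute)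

lemma rhom_diff: assumes "rhom h" shows "h (x - y) = h x - h y"
  using rhomD(2)[OF assms, of x "- y"] rhom_uminus[OF assms] by simp

lemma rhom_sum: assumes "rhom h" shows "h (sum f X) = (\<Sum>x\<in>X. h (f x))"
  by (induction X rule: infinite_finite_induct) (auto simp: rhomD[OF assms] rhom_zero[OF assms])

lemma rhom_prod: assumes "rhom h" shows "h (prod f X) = (\<Prod>x\<in>X. h (f x))"
  by (induction X rule: infinite_finite_induct) (auto simp: rhomD[OF assms])

lemma rhom_power: assumes "rhom h" shows "h (x ^ n) = h x ^ n"
  by (induction n) (auto simp: rhomD[OF assms])

lemma rhom_comp: "rhom f \<Longrightarrow> rhom g \<Longrightarrow> rhom (\<lambda>x. f (g x))"
  by (simp add: rhom_def)

lemma rhom_id: "rhom id" "rhom (\<lambda>x. x)"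
  by (simp_all add: rhom_def)

lemma Const_0 [simp]: "Const 0 = 0" and Const_1 [simp]: "Const 1 = 1"
  by (simp_all add: Const_def)

lemma Const_add: "Const (a + b) = Const a + Const b"
  by (simp add: Const_def single_add)

lemma Const_mult: "Const (a * b) = Const a * Const b"
  by (simp add: Const_def mult_single)

lemma rhom_Const: "rhom Const"
  by (simp add: rhom_def Const_add Const_mult)

lemma lookup_Const_mult [simp]:
  "Poly_Mapping.lookup (Const c * f) m = c * Poly_Mapping.lookup f m"
proof -
  have "Const c * f = Poly_Mapping.map ((*) c) f"
    by (simp add: Const_def mult_map_scale_conv_mult)
  then show ?thesis by (simp add: Poly_Mapping.map.rep_eq when_def)
qed

lemma Const_mult_Monom: "Const c * Monom m = Poly_Mapping.single m c"
  by (simp add: Const_def Monom_def mult_single)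

lemma Monom_add: "Monom (m + n) = Monom m * Monom n"
  by (simp add: Monom_def mult_single)

lemma Monom_0 [simp]: "Monom 0 = 1"
  by (simp add: Monom_def)

lemma lookup_Monom: "Poly_Mapping.lookup (Monom m) n = (if m = n then 1 else 0)"
  by (simp add: Monom_def lookup_single when_def)

lemma keys_Monom [simp]: "Poly_Mapping.keys (Monom m :: ('v, 'a::comm_ring_1) mpol) = {m}"
  by (simp add: Monom_def)

lemma Monom_inj: "Monom m = (Monom n :: ('v, 'a::comm_ring_1) mpol) \<Longrightarrow> m = n"
  by (metis keys_Monom singleton_inject)

lemma mpol_expand:
  assumes "finite M" "Poly_Mapping.keys f \<subseteq> M"
  shows "f = (\<Sum>m\<in>M. Const (Poly_Mapping.lookup f m) * Monom m)"
proof (rule poly_mapping_eqI)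
  fix k
  have "(\<Sum>m\<in>M. Poly_Mapping.lookup f m * (if m = k then 1 else 0)) = Poly_Mapping.lookup f k"
    using assms by (auto simp: if_distrib sum.delta' not_in_keys_iff_lookup_eq_zero subset_iff cong: if_cong)
  then show "Poly_Mapping.lookup f k =
      Poly_Mapping.lookup (\<Sum>m\<in>M. Const (Poly_Mapping.lookup f m) * Monom m) k"
    by (simp add: lookup_sum lookup_Monom)
qed

text \<open>
  Every polynomial is a sum of terms \<open>c m\<close> with a scalar \<open>c\<close> and a monomial \<open>m\<close>.
\<close>

lemma mpol_induct [case_names monomial add]:
  assumes "\<And>c m. P (Const c * Monom m)" "\<And>f g. P f \<Longrightarrow> P g \<Longrightarrow> P (f + g)"
  shows "P (f :: ('v, 'a::comm_ring_1) mpol)"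
proof -
  have "P (\<Sum>m\<in>M. Const (Poly_Mapping.lookup f m) * Monom m)" if "finite M" for M
    using that
  proof (induction M rule: finite_induct)
    case empty
    show ?case using assms(1)[of 0 0] by simp
  qed (simp add: assms)
  from this[OF finite_keys[of f]] show ?thesis
    by (simp only: mpol_expand[OF finite_keys order_refl, symmetric])
qed

text \<open>
  The monomial with exponent vector \<open>m\<close>, evaluated at \<open>v\<close>.
\<close>

definition mon :: "('v::finite \<Rightarrow> 'b::comm_ring_1) \<Rightarrow> 'v expo \<Rightarrow> 'b" where
  "mon v m = (\<Prod>i\<in>UNIV. v i ^ Poly_Mapping.lookup m i)"

lemma mon_add: "mon v (m + n) = mon v m * mon v n"
  by (simp add: mon_def lookup_add power_add prod.distrib)

lemma mon_0 [simp]: "mon v 0 = 1"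
  by (simp add: mon_def)

lemma mon_single: "mon v (Poly_Mapping.single i k) = v i ^ k"
proof -
  have "mon v (Poly_Mapping.single i k) = (\<Prod>j\<in>UNIV. if j = i then v i ^ k else 1)"
    unfolding mon_def by (rule prod.cong) (auto simp: lookup_single when_def)
  then show ?thesis by simp
qed

lemma rhom_mon: "rhom h \<Longrightarrow> h (mon v m) = mon (\<lambda>i. h (v i)) m"
  by (simp add: mon_def rhom_prod rhom_power)

lemma Var_power: "Var i ^ k = Monom (Poly_Mapping.single i k)"
  by (induction k) (simp_all add: Var_def Monom_add[symmetric] single_add[symmetric])

lemma Monom_eq_mon: "Monom m = mon Var m"
proof -
  have *: "(\<Prod>i\<in>X. Monom (f i)) = Monom (\<Sum>i\<in>X. f i)" for X :: "'a set" and f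
    by (induction X rule: infinite_finite_induct) (auto simp: Monom_add)
  have "m = (\<Sum>i\<in>UNIV. Poly_Mapping.single i (Poly_Mapping.lookup m i))"
    by (rule poly_mapping_eqI) (simp add: lookup_sum lookup_single when_def)
  then show ?thesis by (simp add: mon_def Var_power *)
qed

context
  fixes h :: "'a::comm_ring_1 \<Rightarrow> 'b::comm_ring_1" and v :: "'v::finite \<Rightarrow> 'b"
  assumes h: "rhom h"
begin

lemma subst_mpol_superset:
  assumes "finite M" "Poly_Mapping.keys f \<subseteq> M"
  shows "subst_mpol h v f = (\<Sum>m\<in>M. h (Poly_Mapping.lookup f m) * mon v m)"
  unfolding subst_mpol_def mon_def using assms
  by (intro sum.mono_neutral_left) (auto simp: not_in_keys_iff_lookup_eq_zero rhom_zero[OF h])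

lemma subst_mpol_add: "subst_mpol h v (f + g) = subst_mpol h v f + subst_mpol h v g"
proof -
  let ?M = "Poly_Mapping.keys f \<union> Poly_Mapping.keys g"
  have "Poly_Mapping.keys (f + g) \<subseteq> ?M" by (rule keys_add)
  then show ?thesis
    by (simp add: subst_mpol_superset[of ?M] lookup_add rhomD[OF h] algebra_simps sum.distrib)
qed

lemma subst_mpol_term: "subst_mpol h v (Const c * Monom m) = h c * mon v m"
proof -
  have "Poly_Mapping.keys (Const c * Monom m) \<subseteq> {m}" by (simp add: Const_mult_Monom)
  then show ?thesis by (simp add: subst_mpol_superset[of "{m}"] lookup_Monom)
qed

lemma subst_mpol_Const: "subst_mpol h v (Const c) = h c"
  using subst_mpol_term[of c 0] by simp

lemma subst_mpol_Var: "subst_mpol h v (Var i) = v i"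
  using subst_mpol_term[of 1 "Poly_Mapping.single i 1"] by (simp add: Var_def mon_single rhomD[OF h])

lemma subst_mpol_mult: "subst_mpol h v (f * g) = subst_mpol h v f * subst_mpol h v g"
proof (induction f rule: mpol_induct)
  case (monomial c m)
  show ?case
  proof (induction g rule: mpol_induct)
    case (monomial d n)
    have "(Const c * Monom m) * (Const d * Monom n :: ('v, 'a) mpol) = Const (c * d) * Monom (m + n)"
      by (simp add: Const_mult Monom_add algebra_simps)
    then show ?case
      by (simp only: subst_mpol_term rhomD[OF h] mon_add) (simp add: algebra_simps)
  next
    case (add f g)
    then show ?case by (simp only: subst_mpol_add distrib_left)
  qed
next
  case (add f g)
  then show ?case by (simp only: subst_mpol_add distrib_right)
qed

lemma rhom_subst_mpol: "rhom (subst_mpol h v)"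
  using subst_mpol_Const[of 1] rhomD(1)[OF h]
  by (simp add: rhom_def subst_mpol_add subst_mpol_mult)

end

lemma rhom_mpol_eqI:
  fixes F G :: "('v::finite, 'a::comm_ring_1) mpol \<Rightarrow> 'b::comm_ring_1"
  assumes "rhom F" "rhom G" "\<And>c. F (Const c) = G (Const c)" "\<And>i. F (Var i) = G (Var i)"
  shows "F f = G f"
proof (induction f rule: mpol_induct)
  case (monomial c m)
  show ?case
    by (simp add: rhomD[OF assms(1)] rhomD[OF assms(2)] Monom_eq_mon rhom_mon assms)
next
  case (add f g)
  then show ?case by (simp add: rhomD[OF assms(1)] rhomD[OF assms(2)])
qed

section \<open>Linear changes of coordinates\<close>

lemma rhom_coord_change: "rhom (coord_change A)"
  unfolding coord_change_def[abs_def] by (rule rhom_subst_mpol[OF rhom_Const])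

lemma coord_change_Const [simp]: "coord_change A (Const c) = Const c"
  by (simp add: coord_change_def subst_mpol_Const[OF rhom_Const])

lemma coord_change_Var: "coord_change A (Var j) = (\<Sum>i\<in>UNIV. Const (A $ i $ j) * Var i)"
  by (simp add: coord_change_def subst_mpol_Var[OF rhom_Const])

lemma coord_change_comp: "coord_change A (coord_change B f) = coord_change (A ** B) f"
proof (rule rhom_mpol_eqI[where F = "\<lambda>f. coord_change A (coord_change B f)"])
  fix j
  have "coord_change A (coord_change B (Var j)) =
      (\<Sum>k\<in>UNIV. Const (B $ k $ j) * (\<Sum>i\<in>UNIV. Const (A $ i $ k) * Var i))"
    unfolding coord_change_Var[of B] rhom_sum[OF rhom_coord_change] rhomD(3)[OF rhom_coord_change]
      coord_change_Const coord_change_Var ..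
  also have "\<dots> = (\<Sum>k\<in>UNIV. \<Sum>i\<in>UNIV. Const (A $ i $ k * B $ k $ j) * Var i)"
    by (simp add: sum_distrib_left Const_mult mult.assoc mult.left_commute)
  also have "\<dots> = (\<Sum>i\<in>UNIV. Const ((A ** B) $ i $ j) * Var i)"
    unfolding matrix_matrix_mult_def
    by (subst sum.swap) (simp add: rhom_sum[OF rhom_Const] sum_distrib_right)
  finally show "coord_change A (coord_change B (Var j)) = coord_change (A ** B) (Var j)"
    unfolding coord_change_Var .
qed (simp_all add: rhom_comp rhom_coord_change)

lemma coord_change_id:
  fixes f :: "(3, 'a::comm_ring_1) mpol" shows "coord_change (mat 1) f = f"
proof (rule rhom_mpol_eqI[where G = "\<lambda>f. f"])
  show "coord_change (mat 1) (Var j) = (Var j :: (3, 'a) mpol)" for j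
  proof -
    have "coord_change (mat 1) (Var j :: (3, 'a) mpol) = (\<Sum>i\<in>UNIV. if i = j then Var i else 0)"
      unfolding coord_change_Var by (rule sum.cong) (auto simp: mat_def)
    then show ?thesis by simp
  qed
qed (simp_all add: rhom_coord_change rhom_id)

lemma GL3_inverse:
  assumes "A \<in> GL3"
  obtains B where "B \<in> GL3" "A ** B = mat 1" "B ** A = mat 1"
    "\<And>f. coord_change A (coord_change B f) = f" "\<And>f. coord_change B (coord_change A f) = f"
proof -
  obtain B where "A ** B = mat 1" "B ** A = mat 1"
    using assms by (auto simp: GL3_def invertible_def)
  then show thesis
    using that[of B] by (auto simp: GL3_def invertible_def coord_change_comp coord_change_id)
qed

lemma GL3_mult: "A \<in> GL3 \<Longrightarrow> B \<in> GL3 \<Longrightarrow> A ** B \<in> GL3"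
  by (simp add: GL3_def invertible_mult)

section \<open>Homogeneous components\<close>

lemma expo_deg_add [simp]: "expo_deg (m + n) = expo_deg m + expo_deg n"
  by (simp add: expo_deg_def lookup_add sum.distrib)

lemma expo_deg_0 [simp]: "expo_deg 0 = 0"
  by (simp add: expo_deg_def)

lemma expo_deg_single [simp]: "expo_deg (Poly_Mapping.single i k) = k"
  by (simp add: expo_deg_def lookup_single when_def)

lemma homogeneous_0 [simp]: "homogeneous t 0"
  by (simp add: homogeneous_def)

lemma homogeneous_add: "homogeneous t f \<Longrightarrow> homogeneous t g \<Longrightarrow> homogeneous t (f + g)"
  unfolding homogeneous_def using keys_add[of f g] by blast

lemma homogeneous_uminus: "homogeneous t f \<Longrightarrow> homogeneous t (- f)"
  by (simp add: homogeneous_def in_keys_iff)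

lemma homogeneous_diff: "homogeneous t f \<Longrightarrow> homogeneous t g \<Longrightarrow> homogeneous t (f - g)"
  using homogeneous_add[of t f "- g"] homogeneous_uminus[of t g] by simp

lemma homogeneous_sum: "(\<And>x. x \<in> X \<Longrightarrow> homogeneous t (f x)) \<Longrightarrow> homogeneous t (sum f X)"
  by (induction X rule: infinite_finite_induct) (auto simp: homogeneous_add)

lemma homogeneous_mult: "homogeneous s f \<Longrightarrow> homogeneous t g \<Longrightarrow> homogeneous (s + t) (f * g)"
  unfolding homogeneous_def using keys_mult[of f g] by fastforce

lemma homogeneous_Const [simp]: "homogeneous 0 (Const c)"
  by (simp add: homogeneous_def Const_def)

lemma homogeneous_Monom [simp]: "homogeneous t (Monom m) \<longleftrightarrow> expo_deg m = t"
  by (simp add: homogeneous_def)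

lemma homogeneous_Var [simp]: "homogeneous 1 (Var i)"
  by (simp add: Var_def)

lemma homogeneous_Const_mult: "homogeneous t f \<Longrightarrow> homogeneous t (Const c * f)"
  using homogeneous_mult[of 0 "Const c" t f] by simp

lemma homogeneous_power: "homogeneous d f \<Longrightarrow> homogeneous (d * n) (f ^ n)"
proof (induction n)
  case 0
  then show ?case using homogeneous_Const[of 1] by (simp del: homogeneous_Const)
next
  case (Suc n)
  then show ?case using homogeneous_mult[of d f "d * n" "f ^ n"] by simp
qed

lemma homogeneous_prod:
  "(\<And>i. i \<in> X \<Longrightarrow> homogeneous (e i) (f i)) \<Longrightarrow> homogeneous (sum e X) (prod f X)"
proof (induction X rule: infinite_finite_induct)
  case (insert x X)
  then show ?case using homogeneous_mult[of "e x" "f x" "sum e X" "prod f X"] by simp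
qed (use homogeneous_Const[of 1] in \<open>simp_all del: homogeneous_Const\<close>)

lemma homogeneous_coord_change:
  assumes "homogeneous t f" shows "homogeneous t (coord_change A f)"
proof -
  let ?v = "\<lambda>j. \<Sum>i\<in>UNIV. Const (A $ i $ j) * Var i"
  have v: "homogeneous 1 (?v j)" for j
    by (intro homogeneous_sum homogeneous_Const_mult homogeneous_Var)
  have hm: "homogeneous (expo_deg m) (mon ?v m)" for m
    unfolding mon_def expo_deg_def
    by (intro homogeneous_prod) (use homogeneous_power[OF v] in simp)
  have "homogeneous t (Const (Poly_Mapping.lookup f m) * mon ?v m)" if "m \<in> Poly_Mapping.keys f" for m
  proof -
    have "expo_deg m = t" using assms that by (simp add: homogeneous_def)
    then show ?thesis using homogeneous_Const_mult[OF hm[of m]] by simp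
  qed
  then show ?thesis
    unfolding coord_change_def
    by (subst subst_mpol_superset[OF rhom_Const, of "Poly_Mapping.keys f"]) (auto intro: homogeneous_sum)
qed

text \<open>
  The homogeneous component of degree \<open>t\<close>.
\<close>

definition hcomp :: "nat \<Rightarrow> ('v::finite, 'a::comm_ring_1) mpol \<Rightarrow> ('v, 'a) mpol" where
  "hcomp t f = (\<Sum>m\<in>{m \<in> Poly_Mapping.keys f. expo_deg m = t}. Const (Poly_Mapping.lookup f m) * Monom m)"

lemma lookup_hcomp:
  "Poly_Mapping.lookup (hcomp t f) m = (if expo_deg m = t then Poly_Mapping.lookup f m else 0)"
proof -
  have "Poly_Mapping.lookup (hcomp t f) m =
      (\<Sum>n\<in>{n \<in> Poly_Mapping.keys f. expo_deg n = t}. if n = m then Poly_Mapping.lookup f m else 0)"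
    unfolding hcomp_def lookup_sum by (rule sum.cong) (auto simp: lookup_Monom)
  then show ?thesis by (auto simp: not_in_keys_iff_lookup_eq_zero)
qed

lemma hcomp_add: "hcomp t (f + g) = hcomp t f + hcomp t g"
  by (rule poly_mapping_eqI) (simp add: lookup_hcomp lookup_add)

lemma hcomp_diff: "hcomp t (f - g) = hcomp t f - hcomp t g"
  by (rule poly_mapping_eqI) (simp add: lookup_hcomp lookup_minus)

lemma hcomp_0 [simp]: "hcomp t 0 = 0"
  by (rule poly_mapping_eqI) (simp add: lookup_hcomp)

lemma hcomp_sum: "hcomp t (sum f X) = (\<Sum>x\<in>X. hcomp t (f x))"
  by (induction X rule: infinite_finite_induct) (auto simp: hcomp_add)

lemma homogeneous_hcomp [simp]: "homogeneous t (hcomp t f)"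
  by (auto simp: homogeneous_def in_keys_iff lookup_hcomp split: if_splits)

lemma hcomp_homogeneous: "homogeneous s f \<Longrightarrow> hcomp t f = (if s = t then f else 0)"
  by (rule poly_mapping_eqI) (auto simp: homogeneous_def lookup_hcomp in_keys_iff)

lemma sum_hcomp: "f = (\<Sum>t\<in>expo_deg ` Poly_Mapping.keys f. hcomp t f)"
proof (rule poly_mapping_eqI)
  fix m
  show "Poly_Mapping.lookup f m = Poly_Mapping.lookup (\<Sum>t\<in>expo_deg ` Poly_Mapping.keys f. hcomp t f) m"
    by (auto simp: lookup_sum lookup_hcomp in_keys_iff image_iff)
qed

lemma hcomp_mult_homogeneous:
  assumes "homogeneous d g"
  shows "hcomp t (f * g) = (if d \<le> t then hcomp (t - d) f * g else 0)"
proof -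
  let ?T = "expo_deg ` Poly_Mapping.keys f"
  have "hcomp t (f * g) = hcomp t (\<Sum>i\<in>?T. hcomp i f * g)"
    using sum_hcomp[of f] by (metis sum_distrib_right)
  also have "\<dots> = (\<Sum>i\<in>?T. if i + d = t then hcomp i f * g else 0)"
    unfolding hcomp_sum
    by (rule sum.cong) (simp_all add: hcomp_homogeneous[OF homogeneous_mult[OF homogeneous_hcomp assms]])
  also have "\<dots> = (if d \<le> t then hcomp (t - d) f * g else 0)"
  proof (cases "d \<le> t \<and> t - d \<in> ?T")
    case True
    then have "(\<Sum>i\<in>?T. if i + d = t then hcomp i f * g else 0) =
        (\<Sum>i\<in>?T. if i = t - d then hcomp (t - d) f * g else 0)"
      by (intro sum.cong) auto
    then show ?thesis using True by simp
  next
    case False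
    have "hcomp (t - d) f = 0" if "t - d \<notin> ?T"
      using that by (intro poly_mapping_eqI) (force simp: lookup_hcomp in_keys_iff)
    moreover have "(\<Sum>i\<in>?T. if i + d = t then hcomp i f * g else 0) = 0"
      using False by (intro sum.neutral) auto
    ultimately show ?thesis using False by auto
  qed
  finally show ?thesis .
qed

section \<open>Spaces of polynomials with prescribed monomials\<close>

text \<open>
  Scalar multiplication on polynomials.
\<close>

definition scl :: "'a::field \<Rightarrow> ('v, 'a) mpol \<Rightarrow> ('v, 'a) mpol" where
  "scl c f = Const c * f"

global_interpretation mp: vec_space "scl :: 'a::field \<Rightarrow> ('v, 'a) mpol \<Rightarrow> ('v, 'a) mpol"
  by unfold_locales (simp_all add: scl_def algebra_simps Const_add Const_mult)

global_interpretation up: vec_space "smult :: 'a::field \<Rightarrow> 'a poly \<Rightarrow> 'a poly"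
  by unfold_locales (simp_all add: smult_add_left smult_add_right)

global_interpretation mmp: vec_space_pair
  "scl :: 'a::field \<Rightarrow> ('v, 'a) mpol \<Rightarrow> ('v, 'a) mpol" "scl :: 'a::field \<Rightarrow> ('w, 'a) mpol \<Rightarrow> ('w, 'a) mpol" ..

global_interpretation mup: vec_space_pair
  "scl :: 'a::field \<Rightarrow> ('v, 'a) mpol \<Rightarrow> ('v, 'a) mpol" "smult :: 'a \<Rightarrow> 'a poly \<Rightarrow> 'a poly" ..

global_interpretation uup: vec_space_pair
  "smult :: 'a::field \<Rightarrow> 'a poly \<Rightarrow> 'a poly" "smult :: 'a \<Rightarrow> 'a poly \<Rightarrow> 'a poly" ..

lemma lookup_scl [simp]: "Poly_Mapping.lookup (scl c f) m = c * Poly_Mapping.lookup f m"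
  by (simp add: scl_def)

lemma linear_mult_right: "Vector_Spaces.linear scl scl ((*) (g :: ('v, 'a::field) mpol))"
  by unfold_locales (simp_all add: scl_def algebra_simps)

lemma linear_rhom:
  fixes h :: "('v, 'a::field) mpol \<Rightarrow> ('w, 'a) mpol"
  assumes "rhom h" "\<And>c. h (Const c) = Const c"
  shows "Vector_Spaces.linear scl scl h"
  by unfold_locales (simp_all add: scl_def rhomD[OF assms(1)] assms(2))

lemma linear_ident: "Vector_Spaces.linear scl scl (\<lambda>f :: ('v, 'a::field) mpol. f)"
  by (rule linear_rhom) (simp_all add: rhom_id)

text \<open>
  The polynomials all of whose monomials lie in \<open>M\<close>.
\<close>

definition supp_in :: "'v expo set \<Rightarrow> ('v, 'a::comm_ring_1) mpol set" where
  "supp_in M = {f. Poly_Mapping.keys f \<subseteq> M}"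

text \<open>
  The graded component \<open>S\<^sub>t\<close>.
\<close>

definition forms :: "nat \<Rightarrow> ('v::finite, 'a::comm_ring_1) mpol set" where
  "forms t = {f. homogeneous t f}"

lemma forms_supp: "forms t = supp_in {m. expo_deg m = t}"
  by (auto simp: forms_def supp_in_def homogeneous_def)

lemma supp_in_iff: "f \<in> supp_in M \<longleftrightarrow> (\<forall>m. m \<notin> M \<longrightarrow> Poly_Mapping.lookup f m = 0)"
  by (auto simp: supp_in_def in_keys_iff)

lemma subspace_supp_in: "mp.subspace (supp_in M)"
  by (auto simp: mp.subspace_def supp_in_iff lookup_add)

lemma subspace_forms: "mp.subspace (forms t)"
  by (simp add: forms_supp subspace_supp_in)

lemma span_Monom:
  assumes "finite M" shows "mp.span (Monom ` M) = (supp_in M :: ('v, 'a::field) mpol set)"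
proof
  show "mp.span (Monom ` M) \<subseteq> (supp_in M :: ('v, 'a::field) mpol set)"
    by (rule mp.span_minimal[OF _ subspace_supp_in]) (auto simp: supp_in_def)
  show "(supp_in M :: ('v, 'a::field) mpol set) \<subseteq> mp.span (Monom ` M)"
  proof
    fix f :: "('v, 'a) mpol" assume "f \<in> supp_in M"
    then have "f = (\<Sum>m\<in>M. scl (Poly_Mapping.lookup f m) (Monom m))"
      using mpol_expand[OF assms, of f] by (simp add: supp_in_def scl_def)
    moreover have "(\<Sum>m\<in>M. scl (Poly_Mapping.lookup f m) (Monom m)) \<in> mp.span (Monom ` M)"
      by (intro mp.span_sum mp.span_scale mp.span_base) auto
    ultimately show "f \<in> mp.span (Monom ` M)" by simp
  qed
qed

lemma independent_Monom:
  assumes "finite M" shows "mp.independent (Monom ` M :: ('v, 'a::field) mpol set)"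
proof (rule mp.independent_if_scalars_zero)
  fix c :: "('v, 'a) mpol \<Rightarrow> 'a" and x :: "('v, 'a) mpol"
  assume s: "(\<Sum>x\<in>Monom ` M. scl (c x) x) = 0" and x: "x \<in> Monom ` M"
  have "inj_on (Monom :: 'v expo \<Rightarrow> ('v, 'a) mpol) M" by (auto intro: inj_onI Monom_inj)
  then have "(\<Sum>m\<in>M. scl (c (Monom m)) (Monom m)) = 0" using s by (simp add: sum.reindex)
  moreover obtain n where n: "n \<in> M" "x = Monom n" using x by blast
  ultimately have "Poly_Mapping.lookup (\<Sum>m\<in>M. scl (c (Monom m)) (Monom m)) n = 0" by simp
  then have "(\<Sum>m\<in>M. if m = n then c (Monom n) else 0) = 0"
    unfolding lookup_sum by (simp add: lookup_Monom if_distrib cong: if_cong)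
  then show "c x = 0" using n assms by simp
qed (use assms in auto)

lemma fin_dim_supp_in: "finite M \<Longrightarrow> mp.fin_dim (supp_in M :: ('v, 'a::field) mpol set)"
  unfolding mp.fin_dim_def using span_Monom by (metis finite_imageI order_refl)

lemma dim_supp_in:
  assumes "finite M" shows "mp.dim (supp_in M :: ('v, 'a::field) mpol set) = card M"
proof -
  have "inj_on (Monom :: 'v expo \<Rightarrow> ('v, 'a) mpol) M" by (auto intro: inj_onI Monom_inj)
  then show ?thesis
    using mp.dim_span_eq_card_independent[OF independent_Monom[OF assms, where 'a = 'a]]
      card_image[of "Monom :: 'v expo \<Rightarrow> ('v, 'a) mpol" M]
    by (simp only: span_Monom[OF assms])
qed

section \<open>Monomials in three variables\<close>

text \<open>
  The exponent vector of \<open>x\<^sub>1\<^sup>a x\<^sub>2\<^sup>b x\<^sub>3\<^sup>c\<close>.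
\<close>

definition ex3 :: "nat \<Rightarrow> nat \<Rightarrow> nat \<Rightarrow> 3 expo" where
  "ex3 a b c = Poly_Mapping.single 1 a + Poly_Mapping.single 2 b + Poly_Mapping.single 3 c"

lemma distinct_3: "(1::3) \<noteq> 2" "(1::3) \<noteq> 3" "(2::3) \<noteq> 3" "(2::3) \<noteq> 1" "(3::3) \<noteq> 1" "(3::3) \<noteq> 2"
  by simp_all

lemma lookup_ex3 [simp]:
  "Poly_Mapping.lookup (ex3 a b c) 1 = a" "Poly_Mapping.lookup (ex3 a b c) 2 = b"
  "Poly_Mapping.lookup (ex3 a b c) 3 = c"
  using distinct_3 by (simp_all add: ex3_def lookup_add lookup_single when_def)

lemma ex3_eq: "ex3 (Poly_Mapping.lookup m 1) (Poly_Mapping.lookup m 2) (Poly_Mapping.lookup m 3) = m"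
proof (rule poly_mapping_eqI)
  fix i :: 3
  show "Poly_Mapping.lookup (ex3 (Poly_Mapping.lookup m 1) (Poly_Mapping.lookup m 2) (Poly_Mapping.lookup m 3)) i =
      Poly_Mapping.lookup m i"
    using exhaust_3[of i] by auto
qed

lemma ex3_cases: obtains a b c where "m = ex3 a b c"
  using ex3_eq by metis

lemma ex3_inject [simp]: "ex3 a b c = ex3 a' b' c' \<longleftrightarrow> a = a' \<and> b = b' \<and> c = c'"
  by (metis lookup_ex3)

lemma ex3_add [simp]: "ex3 a b c + ex3 a' b' c' = ex3 (a + a') (b + b') (c + c')"
  by (simp add: ex3_def single_add algebra_simps)

lemma expo_deg_ex3 [simp]: "expo_deg (ex3 a b c) = a + b + c"
  by (simp add: ex3_def)

lemma Monom_ex3: "Monom (ex3 a b c) = Var 1 ^ a * Var 2 ^ b * Var 3 ^ c"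
  by (simp add: ex3_def Monom_add Var_power)

text \<open>
  Monomials of degree \<open>t\<close> are counted by their degree \<open>n\<close> in \<open>x\<^sub>1, x\<^sub>2\<close> and their exponent \<open>a\<close> of \<open>x\<^sub>1\<close>.
\<close>

lemma card_expo_deg:
  assumes "\<And>n a. n \<in> N \<Longrightarrow> a \<in> A n \<Longrightarrow> n \<le> t \<and> a \<le> n" "finite N"
    and "\<And>n. n \<in> N \<Longrightarrow> finite (A n)"
    and "M = {m. expo_deg m = t \<and> (\<exists>n\<in>N. \<exists>a\<in>A n. m = ex3 a (n - a) (t - n))}"
  shows "card M = (\<Sum>n\<in>N. card (A n))" "finite M"
proof -
  let ?f = "\<lambda>(n, a). ex3 a (n - a) (t - n)"
  have M: "M = ?f ` (SIGMA n:N. A n)"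
    using assms(1) unfolding assms(4) by (force simp: image_iff)
  have "inj_on ?f (SIGMA n:N. A n)"
    using assms(1) by (fastforce simp: inj_on_def dest!: diff_diff_cancel)
  then show "card M = (\<Sum>n\<in>N. card (A n))" using assms(2,3) unfolding M by (simp add: card_image)
  show "finite M" unfolding M using assms(2,3) by (intro finite_imageI finite_SigmaI) auto
qed

lemma degree_set_3:
  "finite {m :: 3 expo. expo_deg m = t}" "card {m :: 3 expo. expo_deg m = t} = (\<Sum>n\<le>t. n + 1)"
proof -
  have "{m :: 3 expo. expo_deg m = t} =
      {m. expo_deg m = t \<and> (\<exists>n\<in>{..t}. \<exists>a\<in>{..n}. m = ex3 a (n - a) (t - n))}"
  proof safe
    fix m :: "3 expo" assume "t = expo_deg m"
    obtain a b c where m: "m = ex3 a b c" by (rule ex3_cases)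
    show "\<exists>n\<in>{..expo_deg m}. \<exists>a\<in>{..n}. m = ex3 a (n - a) (expo_deg m - n)"
      unfolding m by (rule bexI[of _ "a + b"], rule bexI[of _ a]) auto
  qed
  from card_expo_deg[OF _ _ _ this] show "finite {m :: 3 expo. expo_deg m = t}"
      "card {m :: 3 expo. expo_deg m = t} = (\<Sum>n\<le>t. n + 1)"
    by simp_all
qed

lemma fin_dim_forms: "mp.fin_dim (forms t :: (3, 'a::field) mpol set)"
  by (simp add: forms_supp fin_dim_supp_in degree_set_3)

lemma dim_forms: "mp.dim (forms t :: (3, 'a::field) mpol set) = (\<Sum>n\<le>t. n + 1)"
  by (simp only: forms_supp dim_supp_in degree_set_3)

lemma fin_dim_le_forms: "V \<subseteq> forms t \<Longrightarrow> mp.fin_dim (V :: (3, 'a::field) mpol set)"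
  using mp.fin_dim_subset[OF fin_dim_forms] .

section \<open>Homogeneous ideals\<close>

lemma module_mult: "module ((*) :: 'r::comm_ring_1 \<Rightarrow> 'r \<Rightarrow> 'r)"
  by unfold_locales (simp_all add: algebra_simps)

text \<open>
  Ideals of a commutative ring as plain sets; the unit ideal is included.
\<close>

definition is_ideal :: "'r::comm_ring_1 set \<Rightarrow> bool" where
  "is_ideal I \<longleftrightarrow> 0 \<in> I \<and> (\<forall>x\<in>I. \<forall>y\<in>I. x + y \<in> I) \<and> (\<forall>r. \<forall>x\<in>I. r * x \<in> I)"

lemma is_idealD:
  assumes "is_ideal I"
  shows "0 \<in> I" "x \<in> I \<Longrightarrow> y \<in> I \<Longrightarrow> x + y \<in> I" "x \<in> I \<Longrightarrow> r * x \<in> I" "x \<in> I \<Longrightarrow> - x \<in> I"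
    "x \<in> I \<Longrightarrow> y \<in> I \<Longrightarrow> x - y \<in> I"
proof -
  show 1: "0 \<in> I" "x \<in> I \<Longrightarrow> y \<in> I \<Longrightarrow> x + y \<in> I" "x \<in> I \<Longrightarrow> r * x \<in> I" for x y r
    using assms by (auto simp: is_ideal_def)
  show 2: "x \<in> I \<Longrightarrow> - x \<in> I" for x using 1(3)[of x "- 1"] by simp
  show "x \<in> I \<Longrightarrow> y \<in> I \<Longrightarrow> x - y \<in> I" using 1(2)[of x "- y"] 2 by simp
qed

lemma is_ideal_gen_ideal: "is_ideal (gen_ideal B)"
  unfolding is_ideal_def gen_ideal_def
  by (auto intro: module.span_zero[OF module_mult] module.span_add[OF module_mult] module.span_scale[OF module_mult])

lemma gen_ideal_base: "x \<in> B \<Longrightarrow> x \<in> gen_ideal B"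
  unfolding gen_ideal_def by (rule module.span_base[OF module_mult])

lemma gen_ideal_minimal:
  assumes "B \<subseteq> I" "is_ideal I" shows "gen_ideal B \<subseteq> I"
  unfolding gen_ideal_def using assms
  by (intro module.span_minimal[OF module_mult]) (auto simp: module.subspace_def[OF module_mult] is_ideal_def)

lemma gen_ideal_insert: "x \<in> gen_ideal (insert a B) \<longleftrightarrow> (\<exists>k. x - k * a \<in> gen_ideal B)"
  unfolding gen_ideal_def by (simp add: module.span_insert[OF module_mult])

lemma gen_ideal_empty: "gen_ideal {} = {0}"
  unfolding gen_ideal_def by (rule module.span_empty[OF module_mult])

text \<open>
  Homogeneous ideals: ideals that contain the homogeneous components of their elements.
\<close>

definition hideal :: "('v::finite, 'a::comm_ring_1) mpol set \<Rightarrow> bool" where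
  "hideal I \<longleftrightarrow> is_ideal I \<and> (\<forall>f\<in>I. \<forall>t. hcomp t f \<in> I)"

lemma is_ideal_subspace: "is_ideal I \<Longrightarrow> mp.subspace I"
  by (auto simp: mp.subspace_def scl_def is_idealD)

lemma subspace_ideal_forms: "is_ideal I \<Longrightarrow> mp.subspace (I \<inter> forms t)"
  by (intro mp.subspace_inter is_ideal_subspace subspace_forms)

lemma fin_dim_ideal_forms: "mp.fin_dim (I \<inter> forms t :: (3, 'a::field) mpol set)"
  by (rule fin_dim_le_forms) blast

lemma hideal_insert:
  assumes "hideal (gen_ideal B)" "homogeneous d f"
  shows "hideal (gen_ideal (insert f B))"
  unfolding hideal_def
proof (intro conjI is_ideal_gen_ideal ballI allI)
  fix x t assume "x \<in> gen_ideal (insert f B)"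
  then obtain k where k: "x - k * f \<in> gen_ideal B" by (auto simp: gen_ideal_insert)
  have "hcomp t (x - k * f) = hcomp t x - hcomp t (k * f)" by (rule hcomp_diff)
  moreover have "hcomp t (x - k * f) \<in> gen_ideal B" using assms(1) k by (simp add: hideal_def)
  ultimately have "hcomp t x - (if d \<le> t then hcomp (t - d) k else 0) * f \<in> gen_ideal B"
    by (auto simp: hcomp_mult_homogeneous[OF assms(2)])
  then show "hcomp t x \<in> gen_ideal (insert f B)" unfolding gen_ideal_insert by blast
qed

lemma hideal_empty: "hideal (gen_ideal {})"
  using is_ideal_gen_ideal[of "{}"] by (simp add: hideal_def gen_ideal_empty)

text \<open>The Hilbert function of \<open>S/I\<close>, as an integer.\<close>

definition hilb :: "(3, 'a::field) mpol set \<Rightarrow> nat \<Rightarrow> int" where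
  "hilb I t = int (mp.dim (forms t :: (3, 'a) mpol set)) - int (mp.dim (I \<inter> forms t))"

text \<open>
  Adding a form \<open>f\<close> of degree \<open>d\<close> that is a nonzerodivisor modulo \<open>B\<close>: this is the exact sequence
  \<open>0 \<rightarrow> (S/B)\<^sub>t\<^sub>-\<^sub>d \<rightarrow> (S/B)\<^sub>t \<rightarrow> (S/(B, f))\<^sub>t \<rightarrow> 0\<close>.
\<close>

lemma hilb_step:
  fixes f :: "(3, 'a::field) mpol"
  assumes hid: "hideal (gen_ideal B)" and f: "homogeneous d f"
    and reg: "\<And>g. f * g \<in> gen_ideal B \<Longrightarrow> g \<in> gen_ideal B"
  shows "hilb (gen_ideal (insert f B)) t =
    hilb (gen_ideal B) t - (if d \<le> t then hilb (gen_ideal B) (t - d) else 0)"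
proof -
  let ?I = "gen_ideal B" and ?J = "gen_ideal (insert f B)"
  have idI: "is_ideal ?I" by (rule is_ideal_gen_ideal)
  have comp: "\<exists>i\<in>?I \<inter> forms t. x = i + (if d \<le> t then hcomp (t - d) k else 0) * f"
    if "x \<in> forms t" "x - k * f \<in> ?I" for x k
  proof -
    have "hcomp t (x - k * f) = x - hcomp t (k * f)"
      using hcomp_homogeneous[of t x t] that(1) by (simp add: forms_def hcomp_diff)
    moreover have "hcomp t (x - k * f) \<in> ?I" using hid that(2) by (simp add: hideal_def)
    moreover have "hcomp t (x - k * f) \<in> forms t" by (simp add: forms_def)
    ultimately have "x = hcomp t (x - k * f) + (if d \<le> t then hcomp (t - d) k else 0) * f"
      by (auto simp: hcomp_mult_homogeneous[OF f])
    then show ?thesis using \<open>hcomp t (x - k * f) \<in> ?I\<close> \<open>hcomp t (x - k * f) \<in> forms t\<close> by blast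
  qed
  have sub: "?I \<subseteq> ?J" by (auto simp: gen_ideal_insert intro!: exI[of _ 0])
  show ?thesis
  proof (cases "d \<le> t")
    case False
    have "?J \<inter> forms t \<subseteq> ?I \<inter> forms t" using comp False by (force simp: gen_ideal_insert)
    then have "?J \<inter> forms t = ?I \<inter> forms t" using sub by blast
    then show ?thesis using False by (simp add: hilb_def)
  next
    case True
    have "?J \<inter> forms t = (?I \<inter> forms t) + (*) f ` forms (t - d)"
    proof
      show "?J \<inter> forms t \<subseteq> (?I \<inter> forms t) + (*) f ` forms (t - d)"
      proof
        fix x assume "x \<in> ?J \<inter> forms t"
        then obtain k i where i: "i \<in> ?I \<inter> forms t" "x = i + hcomp (t - d) k * f"
          using comp True by (fastforce simp: gen_ideal_insert)
        have "f * hcomp (t - d) k \<in> (*) f ` forms (t - d)"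
          by (intro imageI) (simp add: forms_def)
        then show "x \<in> (?I \<inter> forms t) + (*) f ` forms (t - d)"
          using set_plus_intro[OF i(1)] i(2) by (simp add: mult.commute)
      qed
      show "(?I \<inter> forms t) + (*) f ` forms (t - d) \<subseteq> ?J \<inter> forms t"
      proof
        fix x assume "x \<in> (?I \<inter> forms t) + (*) f ` forms (t - d)"
        then obtain i k where ik: "i \<in> ?I" "i \<in> forms t" "k \<in> forms (t - d)" "x = i + f * k"
          by (auto simp: set_plus_def)
        have "x \<in> forms t"
          using ik homogeneous_mult[OF f, of "t - d" k] True by (auto simp: forms_def intro: homogeneous_add)
        moreover have "x - k * f \<in> ?I" using ik by (simp add: mult.commute)
        ultimately show "x \<in> ?J \<inter> forms t" unfolding Int_iff gen_ideal_insert by blast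
      qed
    qed
    moreover have "{w \<in> forms (t - d). f * w \<in> ?I \<inter> forms t} = ?I \<inter> forms (t - d)"
    proof -
      have "f * w \<in> forms t" if "w \<in> forms (t - d)" for w
        using homogeneous_mult[OF f, of "t - d" w] True that by (simp add: forms_def)
      moreover have "f * w \<in> ?I \<longleftrightarrow> w \<in> ?I" for w using reg is_idealD(3)[OF idI] by blast
      ultimately show ?thesis by blast
    qed
    ultimately have "mp.dim (?J \<inter> forms t) + mp.dim (?I \<inter> forms (t - d)) =
        mp.dim (?I \<inter> forms t) + mp.dim (forms (t - d) :: (3, 'a) mpol set)"
      using mmp.dim_add_image[OF linear_mult_right subspace_ideal_forms[OF idI, of t]
          fin_dim_ideal_forms subspace_forms fin_dim_forms, of f "t - d"] by simp
    then show ?thesis using True by (simp add: hilb_def)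
  qed
qed

section \<open>The Hilbert function of a complete intersection\<close>

text \<open>
  \<open>gg d\<close> is the Hilbert function of a complete intersection of two forms of degree \<open>d\<close> in two
  variables, and \<open>GG d\<close> that of the same two forms in three variables. Arguments are integers and both
  functions vanish on the negative ones, so no boundary cases arise in shifts.
\<close>

definition gg :: "int \<Rightarrow> int \<Rightarrow> int" where
  "gg d i = max 0 (min (i + 1) (2 * d - 1 - i))"

definition GG :: "int \<Rightarrow> int \<Rightarrow> int" where
  "GG d k = (\<Sum>i\<in>{0..k}. gg d i)"

lemma sum_int_step: "(0::int) \<le> k \<Longrightarrow> (\<Sum>i\<in>{0..k}. f i) = (\<Sum>i\<in>{0..k - 1}. f i) + f k" for f :: "int \<Rightarrow> int"
proof -
  assume "0 \<le> k"
  then have "{0..k} = insert k {0..k - 1}" by auto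
  then show ?thesis by simp
qed

lemma GG_neg [simp]: "k < 0 \<Longrightarrow> GG d k = 0"
  by (simp add: GG_def)

lemma GG_step: "GG d k = GG d (k - 1) + gg d k"
  by (cases "0 \<le> k") (simp_all add: GG_def sum_int_step gg_def)

lemma GG_mono: assumes "k \<le> l" shows "GG d k \<le> GG d l"
  unfolding GG_def using assms by (intro sum_mono2) (auto simp: gg_def)

lemma int_fun_eqI:
  fixes F H :: "int \<Rightarrow> int"
  assumes "\<And>k. F k - F (k - 1) = H k - H (k - 1)" "F a = H a"
  shows "F k = H k"
proof (induction k rule: int_induct[of _ a])
  case (step1 i)
  then show ?case using assms(1)[of "i + 1"] by simp
next
  case (step2 i)
  then show ?case using assms(1)[of i] by simp
qed (rule assms(2))

lemma GG_reflect: "GG d j + GG d (2 * d - 3 - j) = GG d (2 * d - 2)"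
proof (rule int_fun_eqI[where F = "\<lambda>j. GG d j + GG d (2 * d - 3 - j)"
      and H = "\<lambda>_. GG d (2 * d - 2)" and a = "- 1"])
  fix k
  have "GG d k - GG d (k - 1) = gg d k" using GG_step[of d k] by simp
  moreover have "GG d (2 * d - 3 - (k - 1)) - GG d (2 * d - 3 - k) = gg d (2 * d - 2 - k)"
    using GG_step[of d "2 * d - 2 - k"] by (simp add: algebra_simps)
  moreover have "gg d (2 * d - 2 - k) = gg d k" by (simp add: gg_def min.commute algebra_simps)
  ultimately show "GG d k + GG d (2 * d - 3 - k) - (GG d (k - 1) + GG d (2 * d - 3 - (k - 1))) =
      GG d (2 * d - 2) - GG d (2 * d - 2)"
    by simp
qed simp

lemma GG_const: "2 * d - 2 \<le> k \<Longrightarrow> GG d k = GG d (2 * d - 2)"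
  using GG_reflect[of d "2 * d - 3 - k"] by simp

text \<open>
  \<open>GG d\<close> is constant from \<open>2d - 2\<close> on, and \<open>e - 1 \<ge> 2d - 2\<close>. Below degree \<open>e\<close> the term
  \<open>GG d (t - e)\<close> is zero; from degree \<open>e\<close> on, \<open>GG d t\<close> has reached its constant value and the
  reflection \<open>GG_reflect\<close> applies.
\<close>

lemma GG_symmetric:
  assumes "2 * d \<le> e + 1" "1 \<le> d"
  shows "GG d t - GG d (t - e) = GG d (min t (2 * d + e - 3 - t))"
proof (cases "t \<le> e - 1")
  case True
  show ?thesis
  proof (cases "t \<le> 2 * d + e - 3 - t")
    case False
    then show ?thesis
      using True GG_const[of d t] GG_const[of d "2 * d + e - 3 - t"] by simp
  qed (use True in simp)
next
  case False
  then show ?thesis using assms GG_const[of d t] GG_reflect[of d "t - e"]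
    by (simp add: min_def algebra_simps)
qed

lemma hilb_complete_intersection:
  fixes f1 f2 f3 :: "(3, 'a::field) mpol"
  assumes "homogeneous d f1" "homogeneous d f2" "homogeneous e f3"
    and reg: "regular_sequence [f1, f2, f3]"
    and de: "2 * d \<le> e + 1" "1 \<le> d"
  shows "hilb (gen_ideal {f1, f2, f3}) t = GG (int d) (min (int t) (2 * int d + int e - 3 - int t))"
proof -
  define F where "F I t = (if t < 0 then 0 else hilb I (nat t))" for I :: "(3, 'a) mpol set" and t :: int
  have Fstep: "F (gen_ideal (insert f B)) t = F (gen_ideal B) t - F (gen_ideal B) (t - int k)"
    if "hideal (gen_ideal B)" "homogeneous k f" "\<And>g. f * g \<in> gen_ideal B \<Longrightarrow> g \<in> gen_ideal B"
    for B f k t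
    using hilb_step[OF that, of "nat t"] by (auto simp: F_def nat_diff_distrib' le_nat_iff nat_le_iff)
  have r: "\<And>i g. i < 3 \<Longrightarrow> [f1, f2, f3] ! i * g \<in> gen_ideal (set (take i [f1, f2, f3])) \<Longrightarrow>
      g \<in> gen_ideal (set (take i [f1, f2, f3]))"
    using reg by (auto simp: regular_sequence_def)
  have h1: "hideal (gen_ideal {f1})" by (rule hideal_insert[OF hideal_empty assms(1)])
  have h2: "hideal (gen_ideal {f2, f1})" by (rule hideal_insert[OF h1 assms(2)])
  have r1: "\<And>g. f1 * g \<in> gen_ideal {} \<Longrightarrow> g \<in> gen_ideal {}" using r[of 0] by simp
  have r2: "\<And>g. f2 * g \<in> gen_ideal {f1} \<Longrightarrow> g \<in> gen_ideal {f1}" using r[of 1] by simp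
  have r3: "\<And>g. f3 * g \<in> gen_ideal {f2, f1} \<Longrightarrow> g \<in> gen_ideal {f2, f1}"
    using r[of 2] by (simp add: numeral_2_eq_2 insert_commute)
  have F0: "F (gen_ideal {}) t - F (gen_ideal {}) (t - 1) = max 0 (t + 1)" for t
  proof -
    have z: "{0} \<inter> forms t = ({0} :: (3, 'a) mpol set)" for t by (auto simp: forms_def)
    have d0: "hilb (gen_ideal {} :: (3, 'a) mpol set) t = (\<Sum>n\<le>t. int n + 1)" for t
      by (simp add: hilb_def gen_ideal_empty dim_forms z add.commute)
    consider "t < 0" | "t = 0" | n where "t = int (Suc n)"
      by (metis int_nat_eq linorder_neqE_linordered_idom nat_0_iff not0_implies_Suc not_less of_nat_nat order_less_imp_le)
    then show ?thesis
    proof cases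
      case 3
      then show ?thesis by (simp add: F_def d0 nat_add_distrib)
    qed (simp_all add: F_def d0)
  qed
  have F2: "F (gen_ideal {f2, f1}) t = GG (int d) t" for t
  proof (rule int_fun_eqI[where F = "F (gen_ideal {f2, f1})" and H = "GG (int d)" and a = "- 1"])
    fix k :: int
    have "F (gen_ideal {f2, f1}) t = F (gen_ideal {}) t - 2 * F (gen_ideal {}) (t - int d)
        + F (gen_ideal {}) (t - 2 * int d)" for t
      using Fstep[OF h1 assms(2) r2, of t] Fstep[OF hideal_empty assms(1) r1, of t]
        Fstep[OF hideal_empty assms(1) r1, of "t - int d"] by (simp add: algebra_simps)
    moreover have "F (gen_ideal {}) (k - int d) - F (gen_ideal {}) (k - 1 - int d) = max 0 (k + 1 - int d)"
      using F0[of "k - int d"] by (simp add: algebra_simps)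
    moreover have "F (gen_ideal {}) (k - 2 * int d) - F (gen_ideal {}) (k - 1 - 2 * int d) = max 0 (k + 1 - 2 * int d)"
      using F0[of "k - 2 * int d"] by (simp add: algebra_simps)
    moreover have "max 0 (k + 1) - 2 * max 0 (k + 1 - int d) + max 0 (k + 1 - 2 * int d) = gg (int d) k"
      by (auto simp: gg_def max_def min_def)
    ultimately show "F (gen_ideal {f2, f1}) k - F (gen_ideal {f2, f1}) (k - 1) =
        GG (int d) k - GG (int d) (k - 1)"
      using F0[of k] GG_step[of "int d" k] by smt
  qed (simp add: F_def)
  have "F (gen_ideal {f3, f2, f1}) (int t) = GG (int d) (int t) - GG (int d) (int t - int e)"
    using Fstep[OF h2 assms(3) r3, of "int t"] F2 by simp
  moreover have "{f3, f2, f1} = {f1, f2, f3}" by auto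
  ultimately show ?thesis
    using GG_symmetric[of "int d" "int e" "int t"] de by (simp add: F_def)
qed

lemma hideal_three:
  assumes "homogeneous d f1" "homogeneous d' f2" "homogeneous e f3"
  shows "hideal (gen_ideal {f1, f2, f3})"
  by (rule hideal_insert[OF hideal_insert[OF hideal_insert[OF hideal_empty assms(3)] assms(2)] assms(1)])

section \<open>Lefschetz elements\<close>

text \<open>
  \<open>l\<close> is a linear form all of whose powers act on \<open>S/I\<close> with maximal rank, expressed in terms of
  representatives in \<open>S\<close>.
\<close>

definition lefschetz_elt :: "(3, 'a::field) mpol set \<Rightarrow> (3, 'a) mpol \<Rightarrow> bool" where
  "lefschetz_elt I l \<longleftrightarrow> homogeneous 1 l \<and>
     (\<forall>c n. (\<forall>g\<in>forms n. l ^ c * g \<in> I \<longrightarrow> g \<in> I) \<or>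
            (\<forall>g\<in>forms (n + c). \<exists>f\<in>forms n. g - l ^ c * f \<in> I))"

lemma coset_eq_iff:
  assumes "is_ideal I" shows "f +o I = g +o I \<longleftrightarrow> f - g \<in> I"
proof
  assume "f +o I = g +o I"
  moreover have "f \<in> f +o I" using is_idealD(1)[OF assms] by (force simp: elt_set_plus_def)
  ultimately show "f - g \<in> I" by (auto simp: elt_set_plus_def)
next
  assume fg: "f - g \<in> I"
  have "f + x = g + (x + (f - g))" "g + x = f + (x - (f - g))" for x by simp_all
  then show "f +o I = g +o I"
    unfolding elt_set_plus_def using is_idealD(2,5)[OF assms _ fg] by blast
qed

lemma quot_mult_coset:
  assumes "is_ideal I" shows "quot_mult I g (f +o I) = (g * f) +o I"
proof
  show "quot_mult I g (f +o I) \<subseteq> g * f +o I"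
    using is_idealD(2,3)[OF assms]
    by (auto simp: quot_mult_def elt_set_plus_def elt_set_times_def set_plus_def distrib_left add.assoc)
  show "g * f +o I \<subseteq> quot_mult I g (f +o I)"
  proof
    fix x assume "x \<in> g * f +o I"
    then obtain i where i: "i \<in> I" "x = g * f + i" by (auto simp: elt_set_plus_def)
    have "g * f \<in> g *o (f +o I)"
      using is_idealD(1)[OF assms] by (force simp: elt_set_plus_def elt_set_times_def)
    then show "x \<in> quot_mult I g (f +o I)" unfolding quot_mult_def i using i(1) by (rule set_plus_intro)
  qed
qed

lemma SLP_lefschetz_elt:
  fixes I :: "(3, 'a::field) mpol set"
  assumes "SLP I" "is_ideal I"
  obtains l where "lefschetz_elt I l"
proof -
  obtain l where l: "homogeneous 1 l" and
    slp: "\<forall>b\<ge>1. \<forall>t. inj_on (quot_mult I (l ^ b)) (quot_comp I t) \<or>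
      quot_mult I (l ^ b) ` quot_comp I t = quot_comp I (t + b)"
    using assms(1) unfolding SLP_def by (elim exE conjE) (rule that)
  have "(\<forall>g\<in>forms n. l ^ c * g \<in> I \<longrightarrow> g \<in> I) \<or>
        (\<forall>g\<in>forms (n + c). \<exists>f\<in>forms n. g - l ^ c * f \<in> I)" for c n
  proof (cases "c = 0")
    case False
    then have "c \<ge> 1" by simp
    then have "inj_on (quot_mult I (l ^ c)) (quot_comp I n) \<or>
        quot_mult I (l ^ c) ` quot_comp I n = quot_comp I (n + c)"
      using slp by simp
    then show ?thesis
    proof
      assume inj: "inj_on (quot_mult I (l ^ c)) (quot_comp I n)"
      have "g \<in> I" if g: "g \<in> forms n" "l ^ c * g \<in> I" for g
      proof -
        have "quot_mult I (l ^ c) (g +o I) = quot_mult I (l ^ c) (0 +o I)"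
          using g(2) by (simp add: quot_mult_coset[OF assms(2)] coset_eq_iff[OF assms(2)] del: set_zero_plus)
        moreover have "g +o I \<in> quot_comp I n" "0 +o I \<in> quot_comp I n"
          using g(1) by (auto simp: quot_comp_def forms_def simp del: set_zero_plus intro!: imageI)
        ultimately have "g +o I = 0 +o I" using inj by (meson inj_onD)
        then show ?thesis using coset_eq_iff[OF assms(2), of g 0] by simp
      qed
      then show ?thesis by blast
    next
      assume surj: "quot_mult I (l ^ c) ` quot_comp I n = quot_comp I (n + c)"
      have "\<exists>f\<in>forms n. g - l ^ c * f \<in> I" if g: "g \<in> forms (n + c)" for g
      proof -
        have "g +o I \<in> quot_mult I (l ^ c) ` quot_comp I n"
          unfolding surj using g by (auto simp: quot_comp_def forms_def)
        then obtain f where "f \<in> forms n" "g +o I = l ^ c * f +o I"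
          by (auto simp: quot_comp_def forms_def quot_mult_coset[OF assms(2)])
        then show ?thesis using coset_eq_iff[OF assms(2)] by blast
      qed
      then show ?thesis by blast
    qed
  qed simp
  then show thesis using that l unfolding lefschetz_elt_def by blast
qed

text \<open>
  The forms of degree \<open>n + c\<close> that lie in \<open>I + l\<^sup>c S\<close>. Its dimension exceeds that of \<open>I\<^sub>n\<^sub>+\<^sub>c\<close> by the
  rank of \<open>l\<^sup>c : (S/I)\<^sub>n \<rightarrow> (S/I)\<^sub>n\<^sub>+\<^sub>c\<close>.
\<close>

definition mult_space :: "(3, 'a::field) mpol set \<Rightarrow> (3, 'a) mpol \<Rightarrow> nat \<Rightarrow> nat \<Rightarrow> (3, 'a) mpol set" where
  "mult_space I l c n = (I \<inter> forms (n + c)) + (*) (l ^ c) ` forms n"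

lemma mult_power_forms:
  "homogeneous 1 l \<Longrightarrow> g \<in> forms n \<Longrightarrow> l ^ c * g \<in> forms (n + c)"
  using homogeneous_mult[OF homogeneous_power[of 1 l c], of n g] by (simp add: forms_def add.commute)

lemma mult_space_subset: "homogeneous 1 l \<Longrightarrow> mult_space I l c n \<subseteq> forms (n + c)"
  unfolding mult_space_def
  by (auto simp: set_plus_def mult_power_forms intro!: mp.subspace_add[OF subspace_forms])

lemma dim_mult_space:
  fixes I :: "(3, 'a::field) mpol set"
  assumes "is_ideal I"
  shows "mp.dim (mult_space I l c n) + mp.dim {w \<in> forms n. l ^ c * w \<in> I \<inter> forms (n + c)} =
    mp.dim (I \<inter> forms (n + c)) + mp.dim (forms n :: (3, 'a) mpol set)"
  unfolding mult_space_def
  by (rule mmp.dim_add_image[OF linear_mult_right subspace_ideal_forms[OF assms] fin_dim_ideal_forms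
        subspace_forms fin_dim_forms])

lemma dim_mult_space_le:
  fixes I :: "(3, 'a::field) mpol set"
  assumes "is_ideal I" "homogeneous 1 l"
  shows "int (mp.dim (mult_space I l c n)) \<le>
    int (mp.dim (I \<inter> forms (n + c))) + min (hilb I n) (hilb I (n + c))"
proof -
  have "I \<inter> forms n \<subseteq> {w \<in> forms n. l ^ c * w \<in> I \<inter> forms (n + c)}"
    using is_idealD(3)[OF assms(1)] mult_power_forms[OF assms(2)] by blast
  then have "mp.dim (I \<inter> forms n) \<le> mp.dim {w \<in> forms n. l ^ c * w \<in> I \<inter> forms (n + c)}"
    by (intro mp.dim_mono_fin fin_dim_le_forms[of _ n]) auto
  moreover have "mp.dim (mult_space I l c n) \<le> mp.dim (forms (n + c) :: (3, 'a) mpol set)"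
    by (intro mp.dim_mono_fin fin_dim_forms mult_space_subset assms)
  ultimately show ?thesis using dim_mult_space[OF assms(1), of l c n] by (simp add: hilb_def)
qed

lemma dim_mult_space_lefschetz:
  fixes I :: "(3, 'a::field) mpol set"
  assumes "is_ideal I" "lefschetz_elt I l"
  shows "int (mp.dim (mult_space I l c n)) =
    int (mp.dim (I \<inter> forms (n + c))) + min (hilb I n) (hilb I (n + c))"
proof -
  have l: "homogeneous 1 l" using assms(2) by (simp add: lefschetz_elt_def)
  consider "\<forall>g\<in>forms n. l ^ c * g \<in> I \<longrightarrow> g \<in> I"
    | "\<forall>g\<in>forms (n + c). \<exists>f\<in>forms n. g - l ^ c * f \<in> I"
    using assms(2) unfolding lefschetz_elt_def by blast
  then show ?thesis
  proof cases
    case 1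
    then have "{w \<in> forms n. l ^ c * w \<in> I \<inter> forms (n + c)} = I \<inter> forms n"
      using is_idealD(3)[OF assms(1)] mult_power_forms[OF l] by blast
    then show ?thesis
      using dim_mult_space[OF assms(1), of l c n] dim_mult_space_le[OF assms(1) l, of c n]
      by (simp add: hilb_def)
  next
    case 2
    have "forms (n + c) \<subseteq> mult_space I l c n"
    proof
      fix g :: "(3, 'a) mpol" assume g: "g \<in> forms (n + c)"
      then obtain f where f: "f \<in> forms n" "g - l ^ c * f \<in> I" using 2 by blast
      moreover have "g - l ^ c * f \<in> forms (n + c)"
        using g mult_power_forms[OF l f(1)] mp.subspace_diff[OF subspace_forms] by blast
      ultimately have "(g - l ^ c * f) + l ^ c * f \<in> mult_space I l c n"
        unfolding mult_space_def by (intro set_plus_intro) auto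
      then show "g \<in> mult_space I l c n" by simp
    qed
    then have "mult_space I l c n = forms (n + c)" using mult_space_subset[OF l] by blast
    then show ?thesis
      using dim_mult_space_le[OF assms(1) l, of c n] by (simp add: hilb_def)
  qed
qed

section \<open>Images under changes of coordinates\<close>

lemma coord_change_forms: "f \<in> forms t \<Longrightarrow> coord_change A f \<in> forms t"
  by (simp add: forms_def homogeneous_coord_change)

lemma coord_change_image_iff:
  assumes "A \<in> GL3" shows "coord_change A f \<in> coord_change A ` X \<longleftrightarrow> f \<in> X"
  by (rule GL3_inverse[OF assms]) (metis image_iff)

lemma is_ideal_coord_change:
  fixes I :: "(3, 'a::field) mpol set"
  assumes "A \<in> GL3" "is_ideal I" shows "is_ideal (coord_change A ` I)"
proof -
  obtain B where "B \<in> GL3" "A ** B = mat 1" "B ** A = mat 1"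
    and B: "\<And>f :: (3, 'a) mpol. coord_change A (coord_change B f) = f"
      "\<And>f :: (3, 'a) mpol. coord_change B (coord_change A f) = f"
    by (rule GL3_inverse[OF assms(1)]) (rule that)
  have "r * coord_change A x \<in> coord_change A ` I" if "x \<in> I" for r x
  proof -
    have "r * coord_change A x = coord_change A (coord_change B r * x)"
      by (simp add: rhomD[OF rhom_coord_change] B)
    then show ?thesis using is_idealD(3)[OF assms(2) that] by auto
  qed
  moreover have "coord_change A x + coord_change A y \<in> coord_change A ` I" if "x \<in> I" "y \<in> I" for x y
    using is_idealD(2)[OF assms(2) that] by (simp add: rhomD(2)[OF rhom_coord_change, symmetric])
  moreover have "0 \<in> coord_change A ` I"
    using is_idealD(1)[OF assms(2)] rhom_zero[OF rhom_coord_change] by (metis image_eqI)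
  ultimately show ?thesis unfolding is_ideal_def by blast
qed

lemma hcomp_coord_change: "hcomp t (coord_change A f) = coord_change A (hcomp t f)"
proof -
  have "hcomp t (coord_change A f) =
      hcomp t (coord_change A (\<Sum>i\<in>expo_deg ` Poly_Mapping.keys f. hcomp i f))"
    by (simp only: sum_hcomp[symmetric])
  also have "\<dots> = (\<Sum>i\<in>expo_deg ` Poly_Mapping.keys f. hcomp t (coord_change A (hcomp i f)))"
    by (simp only: rhom_sum[OF rhom_coord_change] hcomp_sum)
  also have "\<dots> = (\<Sum>i\<in>expo_deg ` Poly_Mapping.keys f. if i = t then coord_change A (hcomp t f) else 0)"
    by (rule sum.cong) (auto simp: hcomp_homogeneous[OF homogeneous_coord_change[OF homogeneous_hcomp]])
  finally have "hcomp t (coord_change A f) =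
      (\<Sum>i\<in>expo_deg ` Poly_Mapping.keys f. if i = t then coord_change A (hcomp t f) else 0)" .
  moreover have "hcomp t f = 0" if "t \<notin> expo_deg ` Poly_Mapping.keys f"
    using that by (intro poly_mapping_eqI) (force simp: lookup_hcomp in_keys_iff)
  ultimately show ?thesis by (auto simp: rhom_zero[OF rhom_coord_change])
qed

lemma hideal_coord_change:
  assumes "A \<in> GL3" "hideal I" shows "hideal (coord_change A ` I)"
  using assms is_ideal_coord_change by (auto simp: hideal_def hcomp_coord_change)

lemma coord_change_image_forms:
  fixes I :: "(3, 'a::field) mpol set"
  assumes "A \<in> GL3"
  shows "coord_change A ` I \<inter> forms t = coord_change A ` (I \<inter> forms t)"
proof -
  obtain B where "B \<in> GL3" "A ** B = mat 1" "B ** A = mat 1"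
    and B: "\<And>f :: (3, 'a) mpol. coord_change A (coord_change B f) = f"
      "\<And>f :: (3, 'a) mpol. coord_change B (coord_change A f) = f"
    by (rule GL3_inverse[OF assms]) (rule that)
  show ?thesis
  proof safe
    fix f assume "coord_change A f \<in> forms t" "f \<in> I"
    then have "f \<in> forms t" using coord_change_forms[of "coord_change A f" t B] by (simp add: B)
    then show "coord_change A f \<in> coord_change A ` (I \<inter> forms t)" using \<open>f \<in> I\<close> by blast
  qed (auto simp: coord_change_forms)
qed

lemma coord_change_inj: "A \<in> GL3 \<Longrightarrow> coord_change A f = coord_change A g \<longleftrightarrow> f = g"
  by (rule GL3_inverse[of A]) metis+

lemma linear_coord_change:
  "Vector_Spaces.linear scl scl (coord_change A :: (3, 'a::field) mpol \<Rightarrow> (3, 'a) mpol)"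
  by (rule linear_rhom) (simp_all add: rhom_coord_change)

lemma hilb_coord_change:
  assumes "A \<in> GL3" "is_ideal I" shows "hilb (coord_change A ` I) t = hilb I t"
proof -
  have "mp.dim (coord_change A ` (I \<inter> forms t)) = mp.dim (I \<inter> forms t)"
    by (intro mmp.dim_image_inj linear_coord_change subspace_ideal_forms fin_dim_ideal_forms assms)
      (metis coord_change_inj[OF assms(1)] rhom_zero[OF rhom_coord_change])
  then show ?thesis by (simp add: hilb_def coord_change_image_forms[OF assms(1)])
qed

lemma lefschetz_elt_coord_change:
  fixes I :: "(3, 'a::field) mpol set"
  assumes A: "A \<in> GL3" and "lefschetz_elt I l"
  shows "lefschetz_elt (coord_change A ` I) (coord_change A l)"
proof -
  obtain B where "B \<in> GL3" "A ** B = mat 1" "B ** A = mat 1"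
    and B: "\<And>f :: (3, 'a) mpol. coord_change A (coord_change B f) = f"
      "\<And>f :: (3, 'a) mpol. coord_change B (coord_change A f) = f"
    by (rule GL3_inverse[OF A]) (rule that)
  have im: "f \<in> coord_change A ` I \<longleftrightarrow> coord_change B f \<in> I" for f
    using coord_change_image_iff[OF A, of "coord_change B f" I] by (simp add: B)
  have pull: "coord_change B (coord_change A l ^ c * f) = l ^ c * coord_change B f" for c f
    by (simp add: rhomD[OF rhom_coord_change] rhom_power[OF rhom_coord_change] B)
  have "(\<forall>g\<in>forms n. coord_change A l ^ c * g \<in> coord_change A ` I \<longrightarrow> g \<in> coord_change A ` I) \<or>
        (\<forall>g\<in>forms (n + c). \<exists>f\<in>forms n. g - coord_change A l ^ c * f \<in> coord_change A ` I)" for c n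
  proof (cases "\<forall>g\<in>forms n. l ^ c * g \<in> I \<longrightarrow> g \<in> I")
    case True
    then have "\<forall>g\<in>forms n. coord_change A l ^ c * g \<in> coord_change A ` I \<longrightarrow> g \<in> coord_change A ` I"
      unfolding im pull using coord_change_forms[of _ n B] by blast
    then show ?thesis ..
  next
    case False
    then have *: "\<forall>g\<in>forms (n + c). \<exists>f\<in>forms n. g - l ^ c * f \<in> I"
      using assms(2) unfolding lefschetz_elt_def by blast
    have "\<exists>f\<in>forms n. g - coord_change A l ^ c * f \<in> coord_change A ` I" if g: "g \<in> forms (n + c)" for g
    proof -
      obtain f where "f \<in> forms n" "coord_change B g - l ^ c * f \<in> I"
        using * coord_change_forms[OF g] by blast
      then show ?thesis
        by (intro bexI[of _ "coord_change A f"])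
          (simp_all add: im rhom_diff[OF rhom_coord_change] pull B coord_change_forms)
    qed
    then show ?thesis by blast
  qed
  then show ?thesis using assms(2) homogeneous_coord_change by (auto simp: lefschetz_elt_def)
qed

section \<open>The standard monomials\<close>

text \<open>
  The exponents \<open>(a, b, c)\<close> with \<open>2a + b \<le> 2d - 2\<close> and \<open>2(a + b) + c \<le> 2d + e - 3\<close>, written without
  subtraction of natural numbers.
\<close>

definition std :: "nat \<Rightarrow> nat \<Rightarrow> 3 expo set" where
  "std d e = {m. 2 * Poly_Mapping.lookup m 1 + Poly_Mapping.lookup m 2 + 2 \<le> 2 * d \<and>
     2 * (Poly_Mapping.lookup m 1 + Poly_Mapping.lookup m 2) + Poly_Mapping.lookup m 3 + 3 \<le> 2 * d + e}"

lemma ex3_in_std: "ex3 a b c \<in> std d e \<longleftrightarrow> 2 * a + b + 2 \<le> 2 * d \<and> 2 * (a + b) + c + 3 \<le> 2 * d + e"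
  by (simp add: std_def)

text \<open>
  The standard monomials of degree \<open>n + c\<close> that are divisible by \<open>x\<^sub>3\<^sup>c\<close>.
\<close>

definition std_part :: "nat \<Rightarrow> nat \<Rightarrow> nat \<Rightarrow> nat \<Rightarrow> 3 expo set" where
  "std_part d e c n = {m \<in> std d e. expo_deg m = n + c \<and> c \<le> Poly_Mapping.lookup m 3}"

lemma finite_std_part: "finite (std_part d e c n)"
  by (rule finite_subset[OF _ degree_set_3(1)[of "n + c"]]) (auto simp: std_part_def)

text \<open>
  For a fixed degree \<open>n' \<le> n\<close> in \<open>x\<^sub>1, x\<^sub>2\<close> the two conditions read \<open>a + n' \<le> 2d - 2\<close> and
  \<open>n' \<le> s - (n + c)\<close>, and \<open>gg d n'\<close> is the number of \<open>a \<le> n'\<close> that satisfy the first one.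
\<close>

lemma card_std_part:
  "int (card (std_part d e c n)) = GG (int d) (min (int n) (2 * int d + int e - 3 - int (n + c)))"
proof -
  let ?N = "{n'. n' \<le> n \<and> n' + (n + c) + 3 \<le> 2 * d + e}" and ?A = "\<lambda>n'. {a. a \<le> n' \<and> a + n' + 2 \<le> 2 * d}"
  have "std_part d e c n = {m. expo_deg m = n + c \<and> (\<exists>n'\<in>?N. \<exists>a\<in>?A n'. m = ex3 a (n' - a) (n + c - n'))}"
    (is "_ = ?R")
  proof (intro set_eqI)
    fix m :: "3 expo"
    obtain x y z where m: "m = ex3 x y z" by (rule ex3_cases)
    show "m \<in> std_part d e c n \<longleftrightarrow> m \<in> ?R"
    proof
      assume "m \<in> std_part d e c n"
      then show "m \<in> ?R" unfolding m std_part_def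
        by (auto simp: ex3_in_std intro!: exI[of _ "x + y"])
    next
      assume "m \<in> ?R"
      then show "m \<in> std_part d e c n" unfolding m std_part_def by (auto simp: ex3_in_std)
    qed
  qed
  then have "card (std_part d e c n) = (\<Sum>n'\<in>?N. card (?A n'))"
    by (intro card_expo_deg(1)[where t = "n + c"]) auto
  moreover have "int (card (?A n')) = gg (int d) (int n')" for n'
  proof -
    have "?A n' = {..<min (n' + 1) (2 * d - 1 - n')}" by auto
    then have "card (?A n') = min (n' + 1) (2 * d - 1 - n')" by simp
    then show ?thesis unfolding gg_def by linarith
  qed
  ultimately have "int (card (std_part d e c n)) = (\<Sum>n'\<in>?N. gg (int d) (int n'))" by simp
  also have "\<dots> = (\<Sum>i\<in>int ` ?N. gg (int d) i)" by (simp add: sum.reindex)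
  also have "int ` ?N = {0..min (int n) (2 * int d + int e - 3 - int (n + c))}"
  proof
    show "{0..min (int n) (2 * int d + int e - 3 - int (n + c))} \<subseteq> int ` ?N"
    proof
      fix i assume i: "i \<in> {0..min (int n) (2 * int d + int e - 3 - int (n + c))}"
      then show "i \<in> int ` ?N" by (intro image_eqI[of _ _ "nat i"]) auto
    qed
  qed auto
  finally show ?thesis by (simp add: GG_def)
qed

text \<open>
  The Hilbert function \<open>G(min n (s - n))\<close> is monotone in \<open>min n (s - n)\<close>, and among
  \<open>n, s - n, n + c, s - n - c\<close> only \<open>n\<close> and \<open>s - n - c\<close> can be the minimum.
\<close>

lemma min_GG:
  "min (GG d (min n (s - n))) (GG d (min (n + c) (s - (n + c)))) = GG d (min n (s - (n + c)))"
  if "0 \<le> c"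
proof (cases "n + (n + c) \<le> s")
  case True
  then show ?thesis using that GG_mono[of n "min (n + c) (s - (n + c))" d] by (simp add: min_def)
next
  case False
  have "min (n + c) (s - (n + c)) = s - (n + c)" "min n (s - (n + c)) = s - (n + c)"
      "s - (n + c) \<le> min n (s - n)"
    using False that by auto
  then show ?thesis using GG_mono[of "s - (n + c)" "min n (s - n)" d] by (simp only: min_absorb2)
qed

text \<open>The forms divisible by \<open>x\<^sub>3\<^sup>c\<close>.\<close>

lemma mult_Var3_forms:
  "(*) (Var 3 ^ c) ` forms n =
    (supp_in {m. expo_deg m = n + c \<and> c \<le> Poly_Mapping.lookup m 3} :: (3, 'a::field) mpol set)"
  (is "?L = supp_in ?M")
proof
  have fin: "finite ?M" by (rule finite_subset[OF _ degree_set_3(1)[of "n + c"]]) auto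
  have L: "?L = (*) (Var 3 ^ c) ` mp.span (Monom ` {m. expo_deg m = n})"
    by (simp only: span_Monom[OF degree_set_3(1)] forms_supp)
  interpret f: Vector_Spaces.linear scl scl "(*) (Var 3 ^ c) :: (3, 'a) mpol \<Rightarrow> (3, 'a) mpol"
    by (rule linear_mult_right)
  have V3: "Var 3 ^ c = (Monom (ex3 0 0 c) :: (3, 'a) mpol)" by (simp add: Monom_ex3)
  have V: "Var 3 ^ c * Monom (ex3 x y z) = (Monom (ex3 x y (z + c)) :: (3, 'a) mpol)" for x y z
    by (simp add: V3 Monom_add[symmetric] add.commute)
  have eq: "(*) (Var 3 ^ c) ` Monom ` {m. expo_deg m = n} = (Monom ` ?M :: (3, 'a) mpol set)"
  proof safe
    fix m :: "3 expo" assume "n = expo_deg m"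
    then show "Var 3 ^ c * Monom m \<in> (Monom ` {ma. expo_deg ma = expo_deg m + c \<and> c \<le> Poly_Mapping.lookup ma 3} :: (3, 'a) mpol set)"
      by (cases m rule: ex3_cases) (auto simp: V)
  next
    fix m :: "3 expo" assume m: "expo_deg m = n + c" "c \<le> Poly_Mapping.lookup m 3"
    obtain x y z where xyz: "m = ex3 x y z" by (rule ex3_cases)
    have "Monom m = (Var 3 ^ c * Monom (ex3 x y (z - c)) :: (3, 'a) mpol)" using m by (simp add: xyz V)
    moreover have "expo_deg (ex3 x y (z - c)) = n" using m by (simp add: xyz)
    ultimately show "Monom m \<in> ((*) (Var 3 ^ c) ` Monom ` {m. expo_deg m = n} :: (3, 'a) mpol set)" by blast
  qed
  have "?L = mp.span (Monom ` ?M)" unfolding L f.span_image[symmetric] eq ..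
  then have "?L = supp_in ?M" by (simp only: span_Monom[OF fin])
  then show "?L \<subseteq> supp_in ?M" "supp_in ?M \<subseteq> ?L" by simp_all
qed

lemma grevlex_less_trans: "grevlex_less k m \<Longrightarrow> grevlex_less m n \<Longrightarrow> grevlex_less k n"
  by (auto simp: grevlex_less_def)

lemma grevlex_less_irrefl: "\<not> grevlex_less m m"
  by (auto simp: grevlex_less_def)

lemma grevlex_ex3:
  "grevlex_less (ex3 a b c) (ex3 a' b' c') \<longleftrightarrow> a + b + c < a' + b' + c' \<or>
    a + b + c = a' + b' + c' \<and> (c' < c \<or> c = c' \<and> b' < b)"
  by (auto simp: grevlex_less_def)

section \<open>Recognizing the initial ideal\<close>

text \<open>
  The argument is degreewise: by the rank bound \<open>dim_mult_space_le\<close> and a dimension count, every form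
  divisible by \<open>x\<^sub>3\<^sup>c\<close> is congruent modulo \<open>I\<close> to a combination of standard monomials divisible by
  \<open>x\<^sub>3\<^sup>c\<close>.
\<close>

lemma initial_ideal_eq_std:
  fixes I :: "(3, 'a::field) mpol set"
  assumes hid: "hideal I"
    and hf: "\<And>t. hilb I t = GG (int d) (min (int t) (2 * int d + int e - 3 - int t))"
    and indep: "\<And>f. f \<in> I \<Longrightarrow> Poly_Mapping.keys f \<subseteq> std d e \<Longrightarrow> f = 0"
  shows "initial_ideal I = gen_ideal {Monom m | m. m \<notin> std d e}"
proof -
  have idI: "is_ideal I" using hid by (simp add: hideal_def)
  have span: "mult_space I (Var 3) c n = (I \<inter> forms (n + c)) + supp_in (std_part d e c n)" for c n
  proof -
    let ?V = "supp_in (std_part d e c n) :: (3, 'a) mpol set"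
    have Vf: "?V \<subseteq> (*) (Var 3 ^ c) ` forms n"
      unfolding mult_Var3_forms by (auto simp: supp_in_def std_part_def)
    have "?V \<subseteq> forms (n + c)" by (auto simp: forms_supp supp_in_def std_part_def)
    have z: "{w \<in> ?V. w \<in> I \<inter> forms (n + c)} = {0}"
      using indep mp.subspace_0[OF subspace_supp_in] mp.subspace_0[OF subspace_ideal_forms[OF idI]]
      by (fastforce simp: supp_in_def std_part_def)
    have "mp.dim ((I \<inter> forms (n + c)) + ?V) = mp.dim (I \<inter> forms (n + c)) + card (std_part d e c n)"
      using mmp.dim_add_image[OF linear_ident subspace_ideal_forms[OF idI] fin_dim_ideal_forms
          subspace_supp_in fin_dim_supp_in[OF finite_std_part], of "n + c" d e c n]
      by (simp only: z mp.dim_zero_space image_ident dim_supp_in[OF finite_std_part] add_0_right)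
    moreover have "min (hilb I n) (hilb I (n + c)) = int (card (std_part d e c n))"
      unfolding hf card_std_part using min_GG[of "int c" "int d" "int n"] by simp
    ultimately have "mp.dim (mult_space I (Var 3) c n) \<le> mp.dim ((I \<inter> forms (n + c)) + ?V)"
      using dim_mult_space_le[OF idI homogeneous_Var, of 3 c n] by simp
    moreover have "(I \<inter> forms (n + c)) + ?V \<subseteq> mult_space I (Var 3) c n"
      unfolding mult_space_def by (rule set_plus_mono2[OF order_refl Vf])
    ultimately show ?thesis
      by (intro mp.dim_eq_subset[symmetric] mp.subspace_plus subspace_ideal_forms idI subspace_supp_in
          fin_dim_le_forms[OF mult_space_subset] homogeneous_Var)
  qed
  \<comment> \<open>Non-standard monomials reduce to strictly smaller standard ones: those with the same \<open>x\<^sub>3\<close>-exponent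
    have a smaller exponent of \<open>x\<^sub>1\<close>, hence a larger one of \<open>x\<^sub>2\<close>.\<close>
  have red: "\<exists>v. Monom m - v \<in> I \<and> Poly_Mapping.keys v \<subseteq> {k \<in> std d e. expo_deg k = expo_deg m \<and> grevlex_less k m}"
    if m: "m \<notin> std d e" for m
  proof -
    obtain x y c where xyc: "m = ex3 x y c" by (rule ex3_cases)
    have "(Monom m :: (3, 'a) mpol) = Var 3 ^ c * Monom (ex3 x y 0)"
      unfolding xyc Monom_ex3 by (simp only: power_0 mult_1_right mult_1_left mult.commute)
    moreover have "(Monom (ex3 x y 0) :: (3, 'a) mpol) \<in> forms (x + y)" by (simp add: forms_def)
    ultimately have "0 + Monom m \<in> mult_space I (Var 3) c (x + y)"
      unfolding mult_space_def using mp.subspace_0[OF subspace_ideal_forms[OF idI]]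
      by (intro set_plus_intro) auto
    then obtain i v where iv: "i \<in> I" "v \<in> supp_in (std_part d e c (x + y))" "Monom m = i + v"
      unfolding span by (auto simp: set_plus_def)
    have "k \<in> std d e \<and> expo_deg k = expo_deg m \<and> grevlex_less k m" if "k \<in> Poly_Mapping.keys v" for k
    proof -
      have k: "k \<in> std_part d e c (x + y)" using that iv(2) by (auto simp: supp_in_def)
      obtain x' y' c' where k': "k = ex3 x' y' c'" by (rule ex3_cases)
      show ?thesis using k m unfolding k' xyc std_part_def by (auto simp: ex3_in_std grevlex_ex3)
    qed
    then show ?thesis using iv by (intro exI[of _ v]) auto
  qed
  have "(\<exists>f\<in>I. is_leading m f) \<longleftrightarrow> m \<notin> std d e" for m
  proof
    assume "m \<notin> std d e"
    then obtain v where v: "Monom m - v \<in> I"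
        "Poly_Mapping.keys v \<subseteq> {k \<in> std d e. expo_deg k = expo_deg m \<and> grevlex_less k m}"
      using red by blast
    have "m \<notin> Poly_Mapping.keys v" using v(2) \<open>m \<notin> std d e\<close> by blast
    then have "Poly_Mapping.lookup (Monom m - v) m = 1"
      by (simp add: lookup_minus lookup_Monom not_in_keys_iff_lookup_eq_zero)
    moreover have "grevlex_less n m" if "n \<in> Poly_Mapping.keys (Monom m - v)" "n \<noteq> m" for n
    proof -
      have "n \<in> Poly_Mapping.keys v" using that by (auto simp: in_keys_iff lookup_minus lookup_Monom)
      then show ?thesis using v(2) by blast
    qed
    ultimately have "is_leading m (Monom m - v)" by (auto simp: is_leading_def in_keys_iff)
    then show "\<exists>f\<in>I. is_leading m f" using v(1) by blast
  next
    assume "\<exists>f\<in>I. is_leading m f"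
    then obtain f where f: "f \<in> I" "is_leading m f" by blast
    show "m \<notin> std d e"
    proof
      assume m: "m \<in> std d e"
      have "\<exists>v. Monom k - v \<in> I \<and> Poly_Mapping.keys v \<subseteq> {n \<in> std d e. n = k \<or> grevlex_less n k}" for k
      proof (cases "k \<in> std d e")
        case True
        then show ?thesis using is_idealD(1)[OF idI] by (intro exI[of _ "Monom k"]) simp
      next
        case False
        then show ?thesis using red[OF False] by blast
      qed
      then have "\<forall>k. \<exists>v. Monom k - v \<in> I \<and>
          Poly_Mapping.keys v \<subseteq> {n \<in> std d e. n = k \<or> grevlex_less n k}" ..
      from choice[OF this] obtain v where "\<forall>k. Monom k - v k \<in> I \<and>
          Poly_Mapping.keys (v k) \<subseteq> {n \<in> std d e. n = k \<or> grevlex_less n k}" ..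
      then have v: "Monom k - v k \<in> I"
          "Poly_Mapping.keys (v k) \<subseteq> {n \<in> std d e. n = k \<or> grevlex_less n k}" for k
        by blast+
      let ?K = "Poly_Mapping.keys f - {m}" and ?c = "Poly_Mapping.lookup f"
      \<comment> \<open>Reducing every term of \<open>f\<close> but the leading one keeps the leading coefficient.\<close>
      define f' where "f' = Const (?c m) * Monom m + (\<Sum>k\<in>?K. Const (?c k) * v k)"
      have mf: "m \<in> Poly_Mapping.keys f" and lead: "\<And>k. k \<in> ?K \<Longrightarrow> grevlex_less k m"
        using f(2) by (auto simp: is_leading_def)
      have "f = (\<Sum>k\<in>Poly_Mapping.keys f. Const (?c k) * Monom k)" by (rule mpol_expand) auto
      also have "\<dots> = Const (?c m) * Monom m + (\<Sum>k\<in>?K. Const (?c k) * Monom k)"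
        by (rule sum.remove) (use mf in auto)
      finally have "f - f' = Const (?c m) * Monom m + (\<Sum>k\<in>?K. Const (?c k) * Monom k) - f'"
        by (rule arg_cong)
      also have "\<dots> = (\<Sum>k\<in>?K. Const (?c k) * (Monom k - v k))"
        by (simp add: f'_def right_diff_distrib sum_subtractf)
      finally have "f - f' = (\<Sum>k\<in>?K. Const (?c k) * (Monom k - v k))" .
      moreover have "(\<Sum>k\<in>?K. Const (?c k) * (Monom k - v k)) \<in> I"
        by (rule mp.subspace_sum[OF is_ideal_subspace[OF idI]]) (simp add: is_idealD[OF idI] v(1))
      ultimately have "f - (f - f') \<in> I" using is_idealD(5)[OF idI f(1), of "f - f'"] by simp
      then have f'I: "f' \<in> I" by simp
      have vm: "Poly_Mapping.lookup (v k) n = 0" if "n \<notin> std d e \<or> n = m" "k \<in> ?K" for k n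
      proof -
        have "n \<notin> Poly_Mapping.keys (v k)"
          using v(2)[of k] that lead[OF that(2)] grevlex_less_trans grevlex_less_irrefl by blast
        then show ?thesis by (simp add: not_in_keys_iff_lookup_eq_zero)
      qed
      have "Poly_Mapping.lookup f' n = 0" if "n \<notin> std d e" for n
        using that m vm by (auto simp: f'_def lookup_add lookup_sum lookup_Monom)
      then have "Poly_Mapping.keys f' \<subseteq> std d e" by (auto simp: in_keys_iff)
      then have "f' = 0" using indep f'I by blast
      moreover have "Poly_Mapping.lookup f' m = ?c m"
        using vm by (simp add: f'_def lookup_add lookup_sum lookup_Monom)
      ultimately show False using mf by (simp add: in_keys_iff)
    qed
  qed
  then show ?thesis by (simp add: initial_ideal_def)
qed

section \<open>Generators\<close>

lemma prod_eq_Monom: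
  "Var 2 ^ p * Var 3 ^ q * (Var 1 ^ a * Var 2 ^ b) = Monom (ex3 a (p + b) q)"
  "Var 3 ^ q * (Var 1 ^ a * Var 2 ^ b) = Monom (ex3 a b q)"
  by (simp_all only: Var_power Monom_add[symmetric] ex3_def single_add add_ac)

lemma gen_ideal_nonstandard:
  fixes d e :: nat
  assumes "2 \<le> d" "2 * d \<le> e + 1"
  shows "gen_ideal {Monom m | m. m \<notin> std d e} = (gen_ideal
    ({Var 1 ^ d} \<union> {Var 1 ^ (d - j - 1) * Var 2 ^ (2 * j + 1) | j. j \<le> d - 1}
     \<union> {Var 2 ^ (2 * d - 2 * j - 2) * Var 3 ^ (e + 2 * j + 2 - 2 * d) * u | j u.
          j \<le> d - 2 \<and> u \<in> monomials12 j}
     \<union> {Var 3 ^ (e + 2 * j - 2) * u | j u. 1 \<le> j \<and> j \<le> d \<and> u \<in> monomials12 (d - j)})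
      :: (3, 'a::comm_ring_1) mpol set)" (is "?L = gen_ideal ?G")
proof
  have V: "Monom (ex3 a b c) \<in> ?L" if "ex3 a b c \<notin> std d e" for a b c
    using that by (intro gen_ideal_base) blast
  have "g \<in> ?L" if "g \<in> ?G" for g
    using that
  proof (elim UnE)
    assume "g \<in> {Var 1 ^ d}"
    then have "g = Monom (ex3 d 0 0)" by (simp add: Monom_ex3)
    then show ?thesis using V[of d 0 0] by (simp add: ex3_in_std)
  next
    assume "g \<in> {Var 1 ^ (d - j - 1) * Var 2 ^ (2 * j + 1) | j. j \<le> d - 1}"
    then obtain j where j: "j \<le> d - 1" "g = Monom (ex3 (d - j - 1) (2 * j + 1) 0)"
      by (auto simp: Monom_ex3)
    moreover have "ex3 (d - j - 1) (2 * j + 1) 0 \<notin> std d e"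
      unfolding ex3_in_std using j(1) assms by linarith
    ultimately show ?thesis using V by blast
  next
    assume "g \<in> {Var 2 ^ (2 * d - 2 * j - 2) * Var 3 ^ (e + 2 * j + 2 - 2 * d) * u | j u.
          j \<le> d - 2 \<and> u \<in> monomials12 j}"
    then obtain j a b where j: "j \<le> d - 2" "a + b = j"
        "g = Var 2 ^ (2 * d - 2 * j - 2) * Var 3 ^ (e + 2 * j + 2 - 2 * d) * (Var 1 ^ a * Var 2 ^ b)"
      by (auto simp: monomials12_def)
    then have "g = Monom (ex3 a (2 * d - 2 * j - 2 + b) (e + 2 * j + 2 - 2 * d))"
      by (simp only: prod_eq_Monom)
    moreover have "ex3 a (2 * d - 2 * j - 2 + b) (e + 2 * j + 2 - 2 * d) \<notin> std d e"
      using j(1,2) assms by (auto simp: ex3_in_std)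
    ultimately show ?thesis using V by blast
  next
    assume "g \<in> {Var 3 ^ (e + 2 * j - 2) * u | j u. 1 \<le> j \<and> j \<le> d \<and> u \<in> monomials12 (d - j)}"
    then obtain j a b where j: "1 \<le> j" "j \<le> d" "a + b = d - j"
        "g = Var 3 ^ (e + 2 * j - 2) * (Var 1 ^ a * Var 2 ^ b)"
      by (auto simp: monomials12_def)
    then have "g = Monom (ex3 a b (e + 2 * j - 2))" by (simp only: prod_eq_Monom)
    moreover have "ex3 a b (e + 2 * j - 2) \<notin> std d e"
      using j(1-3) assms by (auto simp: ex3_in_std)
    ultimately show ?thesis using V by blast
  qed
  then show "gen_ideal ?G \<subseteq> ?L" by (intro gen_ideal_minimal is_ideal_gen_ideal) blast
next
  have div: "Monom (ex3 a b c) \<in> gen_ideal ?G"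
    if "g \<in> ?G" "g = Monom (ex3 a' b' c')" "a' \<le> a" "b' \<le> b" "c' \<le> c" for g a b c a' b' c'
  proof -
    have "Monom (ex3 a b c) = Monom (ex3 (a - a') (b - b') (c - c')) * g"
      using that(3-5) by (simp add: that(2) Monom_add[symmetric])
    then show ?thesis
      using is_idealD(3)[OF is_ideal_gen_ideal gen_ideal_base[OF that(1)],
          of "Monom (ex3 (a - a') (b - b') (c - c'))"] by simp
  qed
  have "Monom m \<in> gen_ideal ?G" if ns: "m \<notin> std d e" for m
  proof -
    obtain a b c where m: "m = ex3 a b c" by (rule ex3_cases)
    consider "d \<le> a" | "a < d" "2 * d < 2 * a + b + 2"
      | "2 * a + b + 2 \<le> 2 * d" "2 * d + e < 2 * (a + b) + c + 3" "d \<le> a + b"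
      | "2 * a + b + 2 \<le> 2 * d" "2 * d + e < 2 * (a + b) + c + 3" "a + b < d"
      using ns unfolding m ex3_in_std by linarith
    then show ?thesis
    proof cases
      case 1
      then show ?thesis unfolding m by (intro div[of "Var 1 ^ d" d 0 0]) (auto simp: Monom_ex3)
    next
      case 2
      define j where "j = d - 1 - a"
      have "j \<le> d - 1" by (simp add: j_def)
      then have "Var 1 ^ (d - j - 1) * Var 2 ^ (2 * j + 1) \<in> ?G" by blast
      then show ?thesis unfolding m using 2
        by (intro div[of _ "d - j - 1" "2 * j + 1" 0]) (auto simp: Monom_ex3 j_def)
    next
      case 3
      define j where "j = 2 * d - 2 - (a + b)"
      have "Var 1 ^ a * Var 2 ^ (j - a) \<in> (monomials12 j :: (3, 'a) mpol set)"
      proof -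
        have "a + (j - a) = j" using 3 by (simp add: j_def)
        then show ?thesis unfolding monomials12_def by blast
      qed
      moreover have "j \<le> d - 2" using 3 by (simp add: j_def)
      ultimately have "Var 2 ^ (2 * d - 2 * j - 2) * Var 3 ^ (e + 2 * j + 2 - 2 * d) *
          (Var 1 ^ a * Var 2 ^ (j - a)) \<in> ?G" by blast
      then show ?thesis unfolding m using 3 assms
        by (intro div[OF _ prod_eq_Monom(1)]) (auto simp: j_def)
    next
      case 4
      define j where "j = d - (a + b)"
      have "Var 1 ^ a * Var 2 ^ b \<in> (monomials12 (d - j) :: (3, 'a) mpol set)"
        using 4 by (auto simp: monomials12_def j_def)
      moreover have "1 \<le> j \<and> j \<le> d" using 4 by (simp add: j_def)
      ultimately have "Var 3 ^ (e + 2 * j - 2) * (Var 1 ^ a * Var 2 ^ b) \<in> ?G" by blast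
      then show ?thesis unfolding m using 4
        by (intro div[OF _ prod_eq_Monom(2)]) (auto simp: j_def)
    qed
  qed
  then show "?L \<subseteq> gen_ideal ?G" by (intro gen_ideal_minimal is_ideal_gen_ideal) blast
qed

section \<open>Subspaces of univariate polynomials\<close>

lemma wronskian_degree:
  fixes f g :: "'a::field_char_0 poly"
  assumes "f \<noteq> 0" "g \<noteq> 0" "f * pderiv g = g * pderiv f"
  shows "degree f = degree g"
proof (cases "degree f = 0 \<or> degree g = 0")
  case True
  then have "pderiv f = 0 \<or> pderiv g = 0" by (auto simp: pderiv_eq_0_iff)
  then have "pderiv f = 0 \<and> pderiv g = 0" using assms by auto
  then show ?thesis by (simp add: pderiv_eq_0_iff)
next
  case False
  have lead: "lead_coeff (pderiv h) = of_nat (degree h) * lead_coeff h" if "degree h \<noteq> 0" for h :: "'a poly"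
    using that by (simp add: degree_pderiv coeff_pderiv)
  have "lead_coeff (f * pderiv g) = lead_coeff (g * pderiv f)" using assms(3) by simp
  then have "lead_coeff f * (of_nat (degree g) * lead_coeff g) =
      lead_coeff g * (of_nat (degree f) * lead_coeff f)"
    using False lead[of f] lead[of g] by (simp only: lead_coeff_mult) simp
  then show ?thesis using assms(1,2) by simp
qed

text \<open>
  In characteristic zero the Wronskian of two polynomials vanishes only if they are proportional: all
  solutions \<open>g\<close> of the linear equation \<open>f g' = g f'\<close> have the degree of \<open>f\<close>, so cancelling the leading
  term of \<open>g\<close> gives zero.
\<close>

lemma wronskian_zero:
  fixes f g :: "'a::field_char_0 poly"
  assumes "f \<noteq> 0" "f * pderiv g = g * pderiv f"
  obtains c where "g = smult c f"
proof (cases "g = 0")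
  case True
  then show thesis using that[of 0] by simp
next
  case False
  have deg: "degree f = degree g" by (rule wronskian_degree[OF assms(1) False assms(2)])
  define c where "c = lead_coeff g / lead_coeff f"
  let ?r = "g - smult c f"
  have "f * pderiv ?r = ?r * pderiv f"
    by (simp add: pderiv_diff pderiv_smult assms(2) algebra_simps)
  then have "?r \<noteq> 0 \<Longrightarrow> degree ?r = degree f" using wronskian_degree[OF assms(1), of ?r] by simp
  moreover have "coeff ?r (degree f) = 0" using assms(1) by (simp add: c_def deg[symmetric])
  ultimately have "?r = 0" using leading_coeff_0_iff[of ?r] by fastforce
  then show thesis using that[of c] by simp
qed

lemma power_dvd_pderiv:
  fixes q g :: "'a::field poly"
  assumes "q ^ Suc r dvd g" shows "q ^ r dvd pderiv g"
proof -
  obtain h where "g = q ^ Suc r * h" using assms by (elim dvdE)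
  then have "pderiv g = q ^ Suc r * pderiv h + h * (smult (of_nat (Suc r)) (q ^ r) * pderiv q)"
    by (simp only: pderiv_mult pderiv_power_Suc)
  also have "\<dots> = q ^ r * (q * pderiv h + h * smult (of_nat (Suc r)) (pderiv q))"
    by (simp only: power_Suc distrib_left mult_smult_left mult_smult_right mult_ac)
  finally show ?thesis by (rule dvdI)
qed

text \<open>
  At all but finitely many points \<open>p\<close>, no nonzero element of an \<open>r\<close>-dimensional space \<open>U\<close> vanishes to
  order \<open>r\<close>. The map \<open>g \<mapsto> f g' - g f'\<close> for a fixed nonzero \<open>f \<in> U\<close> has kernel spanned by \<open>f\<close>, so its
  image has smaller dimension, and it lowers the order of vanishing by at most one.
\<close>

lemma finite_high_vanishing:
  fixes U :: "'a::field_char_0 poly set"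
  assumes "up.subspace U" "up.fin_dim U" "up.dim U \<le> r"
  shows "finite {p. \<exists>g\<in>U. g \<noteq> 0 \<and> [:- p, 1:] ^ r dvd g}"
  using assms
proof (induction r arbitrary: U)
  case 0
  then have "U \<subseteq> {0}" using up.dim_eq_zero_fin by simp
  then have "{p. \<exists>g\<in>U. g \<noteq> 0 \<and> [:- p, 1:] ^ 0 dvd g} = {}" by blast
  then show ?case by (simp only: finite.emptyI)
next
  case (Suc r)
  show ?case
  proof (cases "U \<subseteq> {0}")
    case True
    then have "{p. \<exists>g\<in>U. g \<noteq> 0 \<and> [:- p, 1:] ^ Suc r dvd g} = {}" by blast
    then show ?thesis by (simp only: finite.emptyI)
  next
    case False
    then obtain f where f: "f \<in> U" "f \<noteq> 0" by blast
    define W where "W g = f * pderiv g - g * pderiv f" for g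
    have lin: "Vector_Spaces.linear smult smult W"
      by unfold_locales (simp_all add: W_def pderiv_add pderiv_smult algebra_simps smult_diff_right)
    interpret W: Vector_Spaces.linear smult smult W by (rule lin)
    have "up.dim {w \<in> U. W w = 0} \<noteq> 0"
      using up.dim_eq_zero_fin[OF up.fin_dim_subset[OF Suc.prems(2), of "{w \<in> U. W w = 0}"]] f
      by (auto simp: W_def)
    then have "up.dim (W ` U) \<le> r"
      using uup.dim_image_kernel[OF lin Suc.prems(1,2)] Suc.prems(3) by linarith
    then have fin: "finite {p. \<exists>g\<in>W ` U. g \<noteq> 0 \<and> [:- p, 1:] ^ r dvd g}"
      by (intro Suc.IH W.subspace_image uup.fin_dim_image[OF lin] Suc.prems(1,2))
    have "{p. \<exists>g\<in>U. g \<noteq> 0 \<and> [:- p, 1:] ^ Suc r dvd g} \<subseteq>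
        {p. \<exists>g\<in>W ` U. g \<noteq> 0 \<and> [:- p, 1:] ^ r dvd g} \<union> {p. poly f p = 0}"
    proof
      fix p assume "p \<in> {p. \<exists>g\<in>U. g \<noteq> 0 \<and> [:- p, 1:] ^ Suc r dvd g}"
      then obtain g where g: "g \<in> U" "g \<noteq> 0" "[:- p, 1:] ^ Suc r dvd g" by blast
      have "[:- p, 1:] ^ r dvd g" using g(3) by (rule power_le_dvd) simp
      then have dvd: "[:- p, 1:] ^ r dvd W g"
        unfolding W_def using power_dvd_pderiv[OF g(3)] by (simp add: dvd_diff)
      show "p \<in> {p. \<exists>g\<in>W ` U. g \<noteq> 0 \<and> [:- p, 1:] ^ r dvd g} \<union> {p. poly f p = 0}"
      proof (cases "W g = 0")
        case True
        then have "f * pderiv g = g * pderiv f" by (simp add: W_def)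
        then obtain c where c: "g = smult c f" using wronskian_zero[OF f(2)] by blast
        have "[:- p, 1:] dvd [:- p, 1:] ^ Suc r" by (simp only: power_Suc dvd_triv_left)
        then have "[:- p, 1:] dvd g" using g(3) by (rule dvd_trans)
        then have "poly g p = 0" by (simp only: poly_eq_0_iff_dvd)
        moreover have "c \<noteq> 0" using c g(2) by auto
        ultimately show ?thesis by (simp add: c)
      qed (use dvd g(1) in blast)
    qed
    then show ?thesis using fin poly_roots_finite[OF f(2)] finite_subset by blast
  qed
qed

section \<open>Binary forms as univariate polynomials\<close>

text \<open>Restriction to the line \<open>x\<^sub>3 = 0\<close>, dehomogenized by \<open>x\<^sub>1 = 1\<close>.\<close>

definition dehom :: "(3, 'a::field) mpol \<Rightarrow> 'a poly" where
  "dehom = subst_mpol (\<lambda>c. [:c:]) (\<lambda>i. if i = 1 then 1 else if i = 2 then [:0, 1:] else 0)"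

lemma rhom_const_poly: "rhom (\<lambda>c :: 'a::field. [:c:])"
  by (simp add: rhom_def)

lemma rhom_dehom: "rhom dehom"
  unfolding dehom_def by (rule rhom_subst_mpol[OF rhom_const_poly])

lemma dehom_simps [simp]:
  "dehom (Const c) = [:c:]" "dehom (Var 1) = 1" "dehom (Var 2) = [:0, 1:]" "dehom (Var 3) = 0"
  using distinct_3
  by (simp_all add: dehom_def subst_mpol_Const[OF rhom_const_poly] subst_mpol_Var[OF rhom_const_poly])

lemma linear_dehom: "Vector_Spaces.linear scl smult (dehom :: (3, 'a::field) mpol \<Rightarrow> 'a poly)"
  by unfold_locales (simp_all add: scl_def rhomD[OF rhom_dehom])

lemma dehom_Monom: "dehom (Monom (ex3 a b c)) = (if c = 0 then monom 1 b else 0)"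
  by (simp add: Monom_ex3 rhomD[OF rhom_dehom] rhom_power[OF rhom_dehom] zero_power_eq monom_altdef)

lemma coeff_dehom:
  assumes "f \<in> forms n" "b \<le> n"
  shows "coeff (dehom f) b = Poly_Mapping.lookup f (ex3 (n - b) b 0)"
proof -
  let ?M = "{m :: 3 expo. expo_deg m = n}"
  have 1: "coeff (dehom (Monom m)) b = (if m = ex3 (n - b) b 0 then 1 else 0)" if "m \<in> ?M" for m
    using that assms(2) by (cases m rule: ex3_cases) (auto simp: dehom_Monom)
  have "coeff (dehom f) b = coeff (dehom (\<Sum>m\<in>?M. Const (Poly_Mapping.lookup f m) * Monom m)) b"
    using mpol_expand[of ?M f] degree_set_3(1) assms(1) by (simp add: forms_supp supp_in_def)
  also have "\<dots> = (\<Sum>m\<in>?M. Poly_Mapping.lookup f m * coeff (dehom (Monom m)) b)"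
    by (simp add: rhom_sum[OF rhom_dehom] rhomD[OF rhom_dehom] coeff_sum)
  also have "\<dots> = (\<Sum>m\<in>?M. if m = ex3 (n - b) b 0 then Poly_Mapping.lookup f m else 0)"
    by (rule sum.cong) (simp_all add: 1)
  also have "\<dots> = Poly_Mapping.lookup f (ex3 (n - b) b 0)"
    using assms(2) degree_set_3(1)[of n] by simp
  finally show ?thesis .
qed

text \<open>
  The monomials of degree \<open>t\<close> divisible by \<open>x\<^sub>3\<^sup>c\<close>; the polynomials supported on them are \<open>x\<^sub>3\<^sup>c S\<^sub>t\<^sub>-\<^sub>c\<close>.
\<close>

definition div3 :: "nat \<Rightarrow> nat \<Rightarrow> 3 expo set" where
  "div3 c t = {m. expo_deg m = t \<and> c \<le> Poly_Mapping.lookup m 3}"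

lemma finite_div3: "finite (div3 c t)"
  by (rule finite_subset[OF _ degree_set_3(1)[of t]]) (auto simp: div3_def)

lemma supp_div3_subset: "supp_in (div3 c t) \<subseteq> forms t"
  by (auto simp: forms_supp supp_in_def div3_def)

lemma Var3_power_image: "(*) (Var 3 ^ c) ` forms n = (supp_in (div3 c (n + c)) :: (3, 'a::field) mpol set)"
  unfolding mult_Var3_forms div3_def ..

lemma dim_div3:
  "mp.dim (supp_in (div3 1 n) :: (3, 'a::field) mpol set) + (n + 1) = mp.dim (forms n :: (3, 'a) mpol set)"
proof -
  have eq: "div3 1 n = {m. expo_deg m = n \<and> (\<exists>n'\<in>{..<n}. \<exists>a\<in>{..n'}. m = ex3 a (n' - a) (n - n'))}"
    (is "_ = ?R")
  proof (intro set_eqI)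
    fix m :: "3 expo"
    obtain x y z where m: "m = ex3 x y z" by (rule ex3_cases)
    show "m \<in> div3 1 n \<longleftrightarrow> m \<in> ?R"
    proof
      assume "m \<in> div3 1 n"
      then show "m \<in> ?R" unfolding m div3_def
        by (intro CollectI conjI, simp, intro bexI[of _ "x + y"] bexI[of _ x]) auto
    qed (auto simp: m div3_def)
  qed
  have "card (div3 1 n) = (\<Sum>n'<n. n' + 1)"
    using card_expo_deg(1)[OF _ _ _ eq] by simp
  then show ?thesis
    by (simp only: dim_supp_in[OF finite_div3] dim_forms) (simp add: lessThan_Suc_atMost[symmetric])
qed

lemma dehom_kernel:
  "{f \<in> forms n. dehom f = 0} = (supp_in (div3 1 n) :: (3, 'a::field) mpol set)"
proof
  show "{f \<in> forms n. dehom f = 0} \<subseteq> (supp_in (div3 1 n) :: (3, 'a) mpol set)"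
  proof
    fix f :: "(3, 'a) mpol" assume "f \<in> {f \<in> forms n. dehom f = 0}"
    then have f: "f \<in> forms n" "dehom f = 0" by auto
    have "m \<in> div3 1 n" if m: "m \<in> Poly_Mapping.keys f" for m
    proof -
      obtain a b c where abc: "m = ex3 a b c" by (rule ex3_cases)
      have deg: "expo_deg m = n" using f(1) m by (auto simp: forms_def homogeneous_def)
      have "c \<noteq> 0"
      proof
        assume "c = 0"
        then have "Poly_Mapping.lookup f m = 0"
          using coeff_dehom[OF f(1), of b] deg by (auto simp: abc f(2))
        then show False using m by (simp add: in_keys_iff)
      qed
      then show ?thesis using deg by (simp add: div3_def abc)
    qed
    then show "f \<in> supp_in (div3 1 n)" by (auto simp: supp_in_def)
  qed
  show "(supp_in (div3 1 n) :: (3, 'a) mpol set) \<subseteq> {f \<in> forms n. dehom f = 0}"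
  proof
    fix f :: "(3, 'a) mpol" assume f: "f \<in> supp_in (div3 1 n)"
    have "dehom (Monom m :: (3, 'a) mpol) = 0" if "m \<in> div3 1 n" for m
      using that by (cases m rule: ex3_cases) (auto simp: div3_def dehom_Monom)
    moreover have "dehom f = (\<Sum>m\<in>div3 1 n. smult (Poly_Mapping.lookup f m) (dehom (Monom m)))"
      using arg_cong[OF mpol_expand[OF finite_div3, of f 1 n], of dehom] f
      by (simp add: rhom_sum[OF rhom_dehom] rhomD[OF rhom_dehom] supp_in_def)
    ultimately show "f \<in> {f \<in> forms n. dehom f = 0}" using f supp_div3_subset by auto
  qed
qed

section \<open>Generic coordinates\<close>

text \<open>
  The standard monomials \<open>x\<^sub>1\<^sup>a x\<^sub>2\<^sup>b x\<^sub>3\<^sup>c\<close> with \<open>a + b = n\<close> are those with \<open>a < std_width d e n c\<close>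
  (and \<open>a \<le> n\<close>); only one direction is needed.
\<close>

definition std_width :: "nat \<Rightarrow> nat \<Rightarrow> nat \<Rightarrow> nat \<Rightarrow> nat" where
  "std_width d e n c = (if 2 * n + c + 3 \<le> 2 * d + e then nat (gg (int d) (int n)) else 0)"

lemma std_width:
  "int (std_width d e n c) = GG (int d) (min (int n) (2 * int d + int e - 3 - int (n + c)))
     - GG (int d) (min (int n - 1) (2 * int d + int e - 3 - int (n + c)))"
proof (cases "2 * n + c + 3 \<le> 2 * d + e")
  case True
  then have "min (int n) (2 * int d + int e - 3 - int (n + c)) = int n"
    "min (int n - 1) (2 * int d + int e - 3 - int (n + c)) = int n - 1" by auto
  then show ?thesis using True GG_step[of "int d" "int n"] by (simp add: std_width_def gg_def)
next
  case False
  then have "min (int n) (2 * int d + int e - 3 - int (n + c)) = 2 * int d + int e - 3 - int (n + c)"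
    "min (int n - 1) (2 * int d + int e - 3 - int (n + c)) = 2 * int d + int e - 3 - int (n + c)" by auto
  then show ?thesis using False by (simp add: std_width_def)
qed

lemma std_width_in_std: "a + b = n \<Longrightarrow> a < std_width d e n c \<Longrightarrow> ex3 a b c \<in> std d e"
  by (auto simp: std_width_def ex3_in_std gg_def split: if_splits)

lemma min_GG_nat:
  "min (GG d (min (int n) (s - int n))) (GG d (min (int (n + c)) (s - int (n + c)))) =
    GG d (min (int n) (s - int (n + c)))"
  unfolding of_nat_add by (rule min_GG) simp

text \<open>
  For all but finitely many \<open>p\<close>, with \<open>y = x\<^sub>2 - p x\<^sub>1\<close> and \<open>\<delta> = w n c\<close>: modulo \<open>I\<close> and \<open>x\<^sub>3\<^sup>c\<^sup>+\<^sup>1 S\<close>, every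
  element of \<open>x\<^sub>3\<^sup>c S\<^sub>n\<close> is a multiple of \<open>x\<^sub>3\<^sup>c y\<^sup>n\<^sup>+\<^sup>1\<^sup>-\<^sup>\<delta>\<close>. The case distinction on \<open>\<delta> = 0\<close> stands for
  \<open>S\<^sub>-\<^sub>1 = {0}\<close>.
\<close>

lemma generic_complement:
  fixes I :: "(3, 'a::field_char_0) mpol set"
  assumes idI: "is_ideal I" and lef: "lefschetz_elt I (Var 3)"
    and hf: "\<And>t. hilb I t = GG (int d) (min (int t) (2 * int d + int e - 3 - int t))"
  defines "w \<equiv> std_width d e"
  shows "finite {p. \<not> (\<forall>g\<in>forms n. \<exists>u v. \<exists>h. u \<in> I \<and> u \<in> forms (n + c) \<and> v \<in> supp_in (div3 (c + 1) (n + c)) \<and>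
     h \<in> (if w n c = 0 then {0} else forms (w n c - 1)) \<and> w n c \<le> n + 1 \<and>
     Var 3 ^ c * g = u + v + Var 3 ^ c * ((Var 2 - Const p * Var 1) ^ (n + 1 - w n c) * h))}"
proof -
  let ?t = "n + c" and ?s = "2 * int d + int e - 3"
  define V where "V = (I \<inter> forms ?t) + supp_in (div3 (c + 1) ?t)"
  define U where "U = {g \<in> forms n. Var 3 ^ c * g \<in> V}"
  have subV: "mp.subspace V" unfolding V_def
    by (intro mp.subspace_plus subspace_ideal_forms idI subspace_supp_in)
  have finV: "mp.fin_dim V" unfolding V_def
    by (intro mp.fin_dim_plus fin_dim_ideal_forms fin_dim_supp_in finite_div3)
  interpret f: Vector_Spaces.linear scl scl "(*) (Var 3 ^ c) :: (3, 'a) mpol \<Rightarrow> (3, 'a) mpol"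
    by (rule linear_mult_right)
  have subU: "mp.subspace U"
    using subspace_forms[of n] subV by (auto simp: U_def mp.subspace_def f.add f.scale)
  have Un: "U \<subseteq> forms n" by (auto simp: U_def)
  have finU: "mp.fin_dim U" using Un by (rule fin_dim_le_forms)
  have I0: "0 \<in> I \<inter> forms ?t" using mp.subspace_0[OF subspace_ideal_forms[OF idI]] .
  have dimV: "int (mp.dim V) = int (mp.dim (I \<inter> forms ?t)) + GG (int d) (min (int n - 1) (?s - int ?t))"
  proof (cases n)
    case 0
    have "supp_in (div3 (c + 1) ?t) = ({0} :: (3, 'a) mpol set)"
    proof -
      have "div3 (c + 1) ?t = {}"
      proof (rule ccontr)
        assume "div3 (c + 1) ?t \<noteq> {}"
        then obtain m where "m \<in> div3 (c + 1) ?t" by blast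
        then show False using 0 by (cases m rule: ex3_cases) (auto simp: div3_def)
      qed
      then show ?thesis by (auto simp: supp_in_def)
    qed
    then have "V = I \<inter> forms ?t" by (auto simp: V_def set_plus_def)
    then show ?thesis using 0 by (simp add: min_def)
  next
    case (Suc n')
    have "V = mult_space I (Var 3) (c + 1) n'"
      unfolding V_def mult_space_def Var3_power_image using Suc by simp
    then have "int (mp.dim V) = int (mp.dim (I \<inter> forms (n' + (c + 1)))) + min (hilb I n') (hilb I (n' + (c + 1)))"
      using dim_mult_space_lefschetz[OF idI lef] by simp
    also have "min (hilb I n') (hilb I (n' + (c + 1))) = GG (int d) (min (int n') (?s - int (n' + (c + 1))))"
      unfolding hf by (rule min_GG_nat)
    finally show ?thesis using Suc by simp
  qed
  \<comment> \<open>The codimension of \<open>U\<close> in \<open>S\<^sub>n\<close> is the dimension of \<open>mult_space I (Var 3) c n\<close> modulo \<open>V\<close>.\<close>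
  have MS: "V + (*) (Var 3 ^ c) ` forms n = mult_space I (Var 3) c n"
  proof -
    let ?B = "supp_in (div3 (c + 1) ?t) :: (3, 'a) mpol set" and ?F = "(*) (Var 3 ^ c) ` (forms n :: (3, 'a) mpol set)"
    have BF: "?B \<subseteq> ?F" unfolding Var3_power_image by (auto simp: supp_in_def div3_def)
    have F: "mp.subspace ?F" by (rule f.subspace_image[OF subspace_forms])
    have "?B + ?F \<subseteq> ?F"
    proof
      fix z assume "z \<in> ?B + ?F"
      then obtain x y where "x \<in> ?B" "y \<in> ?F" "z = x + y" by (rule set_plus_elim)
      then show "z \<in> ?F" using BF mp.subspace_add[OF F, of x y] by blast
    qed
    moreover have "?F \<subseteq> ?B + ?F"
      using set_plus_mono2[of "{0}" ?B ?F ?F] mp.subspace_0[OF subspace_supp_in, of "div3 (c + 1) ?t"]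
      by (simp add: set_plus_def)
    ultimately have "?B + ?F = ?F" by blast
    then show ?thesis unfolding mult_space_def V_def add.assoc by simp
  qed
  have "int (mp.dim (mult_space I (Var 3) c n)) + int (mp.dim U) = int (mp.dim V) + int (mp.dim (forms n :: (3, 'a) mpol set))"
    using mmp.dim_add_image[OF linear_mult_right subV finV subspace_forms fin_dim_forms, of "Var 3 ^ c" n]
    unfolding MS U_def by linarith
  moreover have "int (mp.dim (mult_space I (Var 3) c n)) =
      int (mp.dim (I \<inter> forms ?t)) + GG (int d) (min (int n) (?s - int ?t))"
    unfolding dim_mult_space_lefschetz[OF idI lef] hf min_GG_nat ..
  ultimately have dimU: "mp.dim U + w n c = mp.dim (forms n :: (3, 'a) mpol set)"
    using std_width[of d e n c] dimV unfolding w_def by linarith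
  have KU: "supp_in (div3 1 n) \<subseteq> U"
  proof
    fix g :: "(3, 'a) mpol" assume g: "g \<in> supp_in (div3 1 n)"
    have "Var 3 ^ c * g \<in> supp_in (div3 (c + 1) ?t)"
    proof (cases n)
      case 0
      have "m \<notin> div3 1 n" for m using 0 by (cases m rule: ex3_cases) (auto simp: div3_def)
      then have "div3 1 n = {}" by blast
      then have "g = 0" using g by (simp add: supp_in_def)
      then show ?thesis using mp.subspace_0[OF subspace_supp_in] by simp
    next
      case (Suc n')
      then obtain h where h: "h \<in> forms n'" "g = Var 3 ^ 1 * h"
        using g Var3_power_image[of 1 n'] by auto
      have "Var 3 ^ (c + 1) * h \<in> (*) (Var 3 ^ (c + 1)) ` forms n'" using h(1) by (rule imageI)
      moreover have "Var 3 ^ (c + 1) * h = Var 3 ^ c * g" by (simp only: h(2) power_add mult.assoc)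
      moreover have "n' + (c + 1) = ?t" using Suc by simp
      ultimately show ?thesis unfolding Var3_power_image by (simp only:)
    qed
    then have "0 + Var 3 ^ c * g \<in> V" unfolding V_def using I0 by (intro set_plus_intro)
    then show "g \<in> U" using g supp_div3_subset by (auto simp: U_def)
  qed
  have "{g \<in> U. dehom g = 0} = supp_in (div3 1 n)" using KU Un dehom_kernel[of n] by blast
  then have dimP: "up.dim (dehom ` U) + w n c = n + 1"
    using mup.dim_image_kernel[OF linear_dehom subU finU] dimU dim_div3[of n, where 'a = 'a] by simp
  then have wn: "w n c \<le> n + 1" by simp
  define r where "r = n + 1 - w n c"
  interpret D: Vector_Spaces.linear scl smult "dehom :: (3, 'a) mpol \<Rightarrow> 'a poly" by (rule linear_dehom)
  define P where "P p g \<longleftrightarrow> (\<exists>u v. \<exists>h. u \<in> I \<and> u \<in> forms ?t \<and> v \<in> supp_in (div3 (c + 1) ?t) \<and>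
     h \<in> (if w n c = 0 then {0} else forms (w n c - 1)) \<and> w n c \<le> n + 1 \<and>
     Var 3 ^ c * g = u + v + Var 3 ^ c * ((Var 2 - Const p * Var 1) ^ (n + 1 - w n c) * h))" for p g
  have fin: "finite {p. \<exists>g\<in>dehom ` U. g \<noteq> 0 \<and> [:- p, 1:] ^ r dvd g}"
    by (intro finite_high_vanishing D.subspace_image subU mup.fin_dim_image[OF linear_dehom finU])
      (use dimP in \<open>simp add: r_def\<close>)
  have main: "P p g"
    if p: "p \<notin> {p. \<exists>g\<in>dehom ` U. g \<noteq> 0 \<and> [:- p, 1:] ^ r dvd g}" and g: "g \<in> forms n" for p g
  proof -
    let ?y = "Var 2 - Const p * Var 1 :: (3, 'a) mpol"
    have "\<exists>u\<in>U. \<exists>h\<in>(if w n c = 0 then {0} else forms (w n c - 1)). g = u + ?y ^ r * h"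
    proof (cases "w n c = 0")
      case True
      then have "U = forms n" using dimU mp.dim_eq_subset[OF fin_dim_forms subU Un] by simp
      then show ?thesis using g True by auto
    next
      case False
      define k where "k = w n c - 1"
      have k: "r + k = n" using False wn by (simp add: r_def k_def)
      have y: "homogeneous 1 ?y" by (intro homogeneous_diff homogeneous_Const_mult homogeneous_Var)
      have yk: "?y ^ r * h \<in> forms n" if "h \<in> forms k" for h
        using mult_power_forms[OF y that, of r] k by (simp add: add.commute)
      have dy: "dehom (?y ^ r * h) = [:- p, 1:] ^ r * dehom h" for h
        by (simp add: rhomD[OF rhom_dehom] rhom_power[OF rhom_dehom] rhom_diff[OF rhom_dehom])
      have "{h \<in> forms k. ?y ^ r * h \<in> U} = supp_in (div3 1 k)"
      proof -
        have "dehom h = 0" if "h \<in> forms k" "?y ^ r * h \<in> U" for h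
        proof -
          have "[:- p, 1:] ^ r * dehom h \<in> dehom ` U" using that(2) dy[of h] by (metis image_eqI)
          moreover have "[:- p, 1:] ^ r dvd [:- p, 1:] ^ r * dehom h" by (rule dvd_triv_left)
          ultimately have "[:- p, 1:] ^ r * dehom h = 0" using p by blast
          then show ?thesis by simp
        qed
        moreover have "?y ^ r * h \<in> U" if "h \<in> forms k" "dehom h = 0" for h
        proof -
          have "?y ^ r * h \<in> {f \<in> forms n. dehom f = 0}" using yk that dy by simp
          then show ?thesis using KU unfolding dehom_kernel by blast
        qed
        ultimately show ?thesis using dehom_kernel[of k] by blast
      qed
      then have "mp.dim (U + (*) (?y ^ r) ` forms k) + mp.dim (supp_in (div3 1 k) :: (3, 'a) mpol set) =
          mp.dim U + mp.dim (forms k :: (3, 'a) mpol set)"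
        using mmp.dim_add_image[OF linear_mult_right subU finU subspace_forms fin_dim_forms, of "?y ^ r" k] by simp
      then have "mp.dim (U + (*) (?y ^ r) ` forms k) = mp.dim (forms n :: (3, 'a) mpol set)"
        using dim_div3[of k, where 'a = 'a] dimU False by (simp add: k_def)
      moreover have "mp.subspace (U + (*) (?y ^ r) ` forms k)"
      proof -
        interpret y: Vector_Spaces.linear scl scl "(*) (?y ^ r)" by (rule linear_mult_right)
        show ?thesis by (intro mp.subspace_plus subU y.subspace_image subspace_forms)
      qed
      moreover have "U + (*) (?y ^ r) ` forms k \<subseteq> forms n"
      proof
        fix z assume "z \<in> U + (*) (?y ^ r) ` forms k"
        then obtain u h where "u \<in> U" "h \<in> forms k" "z = u + ?y ^ r * h" by (auto simp: set_plus_def)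
        then show "z \<in> forms n" using Un yk[of h] mp.subspace_add[OF subspace_forms, of u n "?y ^ r * h"] by blast
      qed
      ultimately have "U + (*) (?y ^ r) ` forms k = forms n"
        by (intro mp.dim_eq_subset[OF fin_dim_forms]) auto
      then have "g \<in> U + (*) (?y ^ r) ` forms k" using g by simp
      then show ?thesis using False by (auto simp: set_plus_def k_def)
    qed
    then obtain u h where uh: "u \<in> U" "h \<in> (if w n c = 0 then {0} else forms (w n c - 1))" "g = u + ?y ^ r * h"
      by blast
    obtain i v where iv: "i \<in> I" "i \<in> forms ?t" "v \<in> supp_in (div3 (c + 1) ?t)" "Var 3 ^ c * u = i + v"
      using uh(1) by (auto simp: U_def V_def set_plus_def)
    have "Var 3 ^ c * g = i + v + Var 3 ^ c * (?y ^ (n + 1 - w n c) * h)"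
      using iv(4) by (simp add: uh(3) r_def distrib_left)
    then show ?thesis unfolding P_def using iv(1-3) uh(2) wn by blast
  qed
  have "{p. \<not> (\<forall>g\<in>forms n. P p g)} \<subseteq> {p. \<exists>g\<in>dehom ` U. g \<noteq> 0 \<and> [:- p, 1:] ^ r dvd g}"
  proof (intro subsetI, rule ccontr)
    fix p assume "p \<in> {p. \<not> (\<forall>g\<in>forms n. P p g)}"
      "p \<notin> {p. \<exists>g\<in>dehom ` U. g \<noteq> 0 \<and> [:- p, 1:] ^ r dvd g}"
    then show False using main[of p] by simp
  qed
  then show ?thesis using fin unfolding P_def by (rule finite_subset)
qed

text \<open>
  The coordinate change that fixes \<open>x\<^sub>1, x\<^sub>3\<close> and sends \<open>x\<^sub>2\<close> to \<open>x\<^sub>2 + p x\<^sub>1\<close>.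
\<close>

definition shear :: "'a::field \<Rightarrow> 'a^3^3" where
  "shear p = (\<chi> i j. if i = j then 1 else if i = 1 \<and> j = 2 then p else 0)"

lemma shear_GL3: "shear p \<in> GL3"
  by (simp add: GL3_def invertible_det_nz det_3 shear_def)

lemma coord_change_shear:
  "coord_change (shear p) (Var 1) = Var 1" "coord_change (shear p) (Var 3) = Var 3"
  "coord_change (shear p) (Var 2) = Var 2 + Const p * Var 1"
  by (simp_all add: coord_change_Var shear_def sum_3)

lemma div3_empty: "t < c \<Longrightarrow> div3 c t = {}"
proof (rule ccontr)
  assume "t < c" "div3 c t \<noteq> {}"
  then obtain m where "m \<in> div3 c t" by blast
  then show False using \<open>t < c\<close> by (cases m rule: ex3_cases) (auto simp: div3_def)
qed

lemma supp_in_empty: "supp_in {} = {0}"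
  by (auto simp: supp_in_def)

lemma coord_change_div3:
  fixes f :: "(3, 'a::field) mpol"
  assumes "coord_change A (Var 3) = (Var 3 :: (3, 'a) mpol)" "f \<in> supp_in (div3 c t)"
  shows "coord_change A f \<in> supp_in (div3 c t)"
proof (cases "c \<le> t")
  case True
  then have t: "t = (t - c) + c" by simp
  have "f \<in> (*) (Var 3 ^ c) ` forms (t - c)" unfolding Var3_power_image using assms(2) t by simp
  then obtain g where g: "g \<in> forms (t - c)" "f = Var 3 ^ c * g" by blast
  have "coord_change A f = Var 3 ^ c * coord_change A g"
    by (simp only: g(2) rhomD(3)[OF rhom_coord_change] rhom_power[OF rhom_coord_change] assms(1))
  then have "coord_change A f \<in> (*) (Var 3 ^ c) ` forms (t - c)"
    using coord_change_forms[OF g(1)] by blast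
  then show ?thesis unfolding Var3_power_image using t by simp
next
  case False
  then show ?thesis using assms(2) div3_empty[of t c] rhom_zero[OF rhom_coord_change]
    by (simp add: supp_in_empty)
qed

text \<open>
  The standard monomials are linearly independent modulo \<open>I\<close>, in every degree.
\<close>

definition std_independent :: "nat \<Rightarrow> nat \<Rightarrow> (3, 'a::field) mpol set \<Rightarrow> bool" where
  "std_independent d e I \<longleftrightarrow> (\<forall>t f. f \<in> I \<longrightarrow> f \<in> forms t \<longrightarrow> Poly_Mapping.keys f \<subseteq> std d e \<longrightarrow> f = 0)"

lemma std_form_zero:
  assumes f: "f \<in> forms t" "Poly_Mapping.keys f \<subseteq> std d e" and "2 * d + e < t"
  shows "f = 0"
proof -
  have "m \<notin> Poly_Mapping.keys f" for m
  proof
    assume m: "m \<in> Poly_Mapping.keys f"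
    then have "expo_deg m = t" "m \<in> std d e" using f by (auto simp: forms_def homogeneous_def)
    then show False using assms(3) by (cases m rule: ex3_cases) (auto simp: ex3_in_std)
  qed
  then have "Poly_Mapping.keys f = {}" by blast
  then show ?thesis by simp
qed

text \<open>
  The parameter \<open>p\<close> of the shear avoids the finitely many exceptions of \<open>generic_complement\<close> for all
  \<open>n, c \<le> 2d + e\<close>; beyond that degree there are no standard monomials.
\<close>

lemma generic_spanning:
  fixes I :: "(3, 'a::field_char_0) mpol set"
  assumes idI: "is_ideal I" and lef: "lefschetz_elt I (Var 3)"
    and hf: "\<And>t. hilb I t = GG (int d) (min (int t) (2 * int d + int e - 3 - int t))"
  obtains A where "A \<in> GL3" "std_independent d e (coord_change A ` I)"
proof -
  let ?w = "std_width d e" and ?T = "2 * d + e"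
  define P where "P p n c g \<longleftrightarrow> (\<exists>u v. \<exists>h. u \<in> I \<and> u \<in> forms (n + c) \<and> v \<in> supp_in (div3 (c + 1) (n + c)) \<and>
     h \<in> (if ?w n c = 0 then {0} else forms (?w n c - 1)) \<and> ?w n c \<le> n + 1 \<and>
     Var 3 ^ c * g = u + v + Var 3 ^ c * ((Var 2 - Const p * Var 1) ^ (n + 1 - ?w n c) * h))"
    for p n c g
  have "finite {p. \<not> (\<forall>g\<in>forms n. P p n c g)}" for n c
    unfolding P_def by (rule generic_complement[OF idI lef hf])
  then have "finite (\<Union>n\<in>{..?T}. \<Union>c\<in>{..?T}. {p. \<not> (\<forall>g\<in>forms n. P p n c g)})" by blast
  then obtain p where p: "p \<notin> (\<Union>n\<in>{..?T}. \<Union>c\<in>{..?T}. {p. \<not> (\<forall>g\<in>forms n. P p n c g)})"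
    using ex_new_if_finite[OF infinite_UNIV_char_0] by blast
  let ?A = "shear p"
  define I2 where "I2 = coord_change ?A ` I"
  have idI2: "is_ideal I2" unfolding I2_def by (rule is_ideal_coord_change[OF shear_GL3 idI])
  have cy: "coord_change ?A (Var 2 - Const p * Var 1) = (Var 2 :: (3, 'a) mpol)"
    by (simp add: rhom_diff[OF rhom_coord_change] rhomD[OF rhom_coord_change] coord_change_shear)
  have dec: "\<exists>u v. \<exists>h. u \<in> I2 \<inter> forms (n + c) \<and> v \<in> supp_in (div3 (c + 1) (n + c)) \<and>
     h \<in> (if ?w n c = 0 then {0} else forms (?w n c - 1)) \<and> ?w n c \<le> n + 1 \<and>
     Var 3 ^ c * g = u + v + Var 3 ^ c * (Var 2 ^ (n + 1 - ?w n c) * h)"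
    if g: "g \<in> forms n" and nc: "n \<le> ?T" "c \<le> ?T" for g :: "(3, 'a) mpol" and n c
  proof -
    obtain B where "B \<in> GL3" "?A ** B = mat 1" "B ** ?A = mat 1"
      and B: "\<And>f :: (3, 'a) mpol. coord_change ?A (coord_change B f) = f"
        "\<And>f :: (3, 'a) mpol. coord_change B (coord_change ?A f) = f"
      by (rule GL3_inverse[OF shear_GL3]) (rule that)
    have "P p n c (coord_change B g)" using p nc coord_change_forms[OF g] by blast
    then obtain u v h where uvh: "u \<in> I" "u \<in> forms (n + c)" "v \<in> supp_in (div3 (c + 1) (n + c))"
      "h \<in> (if ?w n c = 0 then {0} else forms (?w n c - 1))" "?w n c \<le> n + 1"
      and eq: "Var 3 ^ c * coord_change B g =
        u + v + Var 3 ^ c * ((Var 2 - Const p * Var 1) ^ (n + 1 - ?w n c) * h)"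
      unfolding P_def by blast
    have "coord_change ?A (Var 3 ^ c * coord_change B g) =
      coord_change ?A u + coord_change ?A v + Var 3 ^ c * (Var 2 ^ (n + 1 - ?w n c) * coord_change ?A h)"
      unfolding eq by (simp only: rhomD[OF rhom_coord_change] rhom_power[OF rhom_coord_change] cy coord_change_shear)
    then have eq2: "Var 3 ^ c * g =
      coord_change ?A u + coord_change ?A v + Var 3 ^ c * (Var 2 ^ (n + 1 - ?w n c) * coord_change ?A h)"
      by (simp only: rhomD(3)[OF rhom_coord_change] rhom_power[OF rhom_coord_change] coord_change_shear B)
    have "coord_change ?A u \<in> I2 \<inter> forms (n + c)" using uvh(1,2) coord_change_forms by (auto simp: I2_def)
    moreover have "coord_change ?A v \<in> supp_in (div3 (c + 1) (n + c))"
      by (rule coord_change_div3[OF coord_change_shear(2) uvh(3)])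
    moreover have "coord_change ?A h \<in> (if ?w n c = 0 then {0} else forms (?w n c - 1))"
      using uvh(4) coord_change_forms[of h] rhom_zero[OF rhom_coord_change] by (auto split: if_splits)
    ultimately show ?thesis using uvh(5) eq2 by blast
  qed
  have span: "forms t \<subseteq> (I2 \<inter> forms t) + supp_in (std_part d e 0 t)" (is "_ \<subseteq> ?P") if t: "t \<le> ?T" for t
  proof -
    have subP: "mp.subspace ?P"
      by (intro mp.subspace_plus subspace_ideal_forms idI2 subspace_supp_in)
    have I0: "0 \<in> I2 \<inter> forms t" "(0 :: (3, 'a) mpol) \<in> supp_in (std_part d e 0 t)"
      using mp.subspace_0[OF subspace_ideal_forms[OF idI2]] mp.subspace_0[OF subspace_supp_in] by blast+
    have IP: "I2 \<inter> forms t \<subseteq> ?P" using set_plus_intro[OF _ I0(2), of _ "I2 \<inter> forms t"] by auto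
    have SP: "supp_in (std_part d e 0 t) \<subseteq> ?P" using set_plus_intro[OF I0(1)] by fastforce
    \<comment> \<open>Descent on the exponent \<open>t - n\<close> of \<open>x\<^sub>3\<close>: a monomial of \<open>x\<^sub>3\<^sup>c x\<^sub>2\<^sup>n\<^sup>+\<^sup>1\<^sup>-\<^sup>\<delta> S\<^sub>\<delta>\<^sub>-\<^sub>1\<close> is standard or divisible by
      \<open>x\<^sub>3\<^sup>c\<^sup>+\<^sup>1\<close>.\<close>
    have step: "supp_in (div3 (t - n) t) \<subseteq> ?P"
      if n: "n \<le> t" and IH: "supp_in (div3 (t - n + 1) t) \<subseteq> ?P" for n
    proof
      fix f :: "(3, 'a) mpol" assume f: "f \<in> supp_in (div3 (t - n) t)"
      define c where "c = t - n"
      have nc: "n + c = t" using n by (simp add: c_def)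
      have "f \<in> (*) (Var 3 ^ c) ` forms n" unfolding Var3_power_image nc using f by (simp add: c_def)
      then obtain g where g: "g \<in> forms n" "f = Var 3 ^ c * g" by blast
      have "n \<le> ?T" "c \<le> ?T" using t nc by auto
      from dec[OF g(1) this] obtain u v h where
        u: "u \<in> I2 \<inter> forms t" and v: "v \<in> supp_in (div3 (c + 1) t)" and
        h: "h \<in> (if ?w n c = 0 then {0} else forms (?w n c - 1))" "?w n c \<le> n + 1" and
        feq: "f = u + v + Var 3 ^ c * (Var 2 ^ (n + 1 - ?w n c) * h)"
        unfolding nc g(2) by blast
      let ?z = "Var 3 ^ c * Var 2 ^ (n + 1 - ?w n c) :: (3, 'a) mpol"
      have mono: "?z * Monom m \<in> ?P" if m: "expo_deg m = ?w n c - 1" "?w n c \<noteq> 0" for m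
      proof -
        obtain x y k where xyk: "m = ex3 x y k" by (rule ex3_cases)
        let ?m = "ex3 x (n + 1 - ?w n c + y) (c + k)"
        have z: "?z * Monom m = Monom ?m"
          unfolding xyk Var_power Monom_add[symmetric] ex3_def single_add by (simp only: add_ac)
        have deg: "expo_deg ?m = t" using m h(2) nc by (simp add: xyk)
        show ?thesis
        proof (cases "k = 0")
          case True
          have "ex3 x (n + 1 - ?w n c + y) c \<in> std d e"
            by (rule std_width_in_std[where n = n]) (use m h(2) True in \<open>auto simp: xyk\<close>)
          then have "Monom ?m \<in> supp_in (std_part d e 0 t)"
            using deg True by (simp add: supp_in_def std_part_def)
          then show ?thesis using SP z by auto
        next
          case False
          then have "Monom ?m \<in> supp_in (div3 (t - n + 1) t)"
            using deg by (simp add: supp_in_def div3_def c_def)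
          then show ?thesis using IH z by auto
        qed
      qed
      have "?z * h \<in> ?P"
      proof (cases "?w n c = 0")
        case True
        then show ?thesis using h(1) mp.subspace_0[OF subP] by simp
      next
        case False
        have hm: "expo_deg m = ?w n c - 1" if "m \<in> Poly_Mapping.keys h" for m
          using that h(1) False by (simp add: forms_def homogeneous_def)
        have "?z * h = ?z * (\<Sum>m\<in>Poly_Mapping.keys h. Const (Poly_Mapping.lookup h m) * Monom m)"
          by (simp only: mpol_expand[OF finite_keys order_refl, symmetric])
        also have "\<dots> = (\<Sum>m\<in>Poly_Mapping.keys h. scl (Poly_Mapping.lookup h m) (?z * Monom m))"
          by (simp only: sum_distrib_left scl_def mult.left_commute)
        finally have eq: "?z * h =
            (\<Sum>m\<in>Poly_Mapping.keys h. scl (Poly_Mapping.lookup h m) (?z * Monom m))" .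
        show ?thesis unfolding eq
          by (intro mp.subspace_sum[OF subP] mp.subspace_scale[OF subP] mono[OF hm False])
      qed
      moreover have "u \<in> ?P" "v \<in> ?P" using u v IP IH by (auto simp: c_def)
      ultimately have "u + v + ?z * h \<in> ?P" using mp.subspace_add[OF subP] by blast
      then show "f \<in> ?P" by (simp only: feq mult.assoc)
    qed
    have "n \<le> t \<Longrightarrow> supp_in (div3 (t - n) t) \<subseteq> ?P" for n
    proof (induction n)
      case 0
      have "supp_in (div3 (t - 0 + 1) t) \<subseteq> ?P"
        using div3_empty[of t "t - 0 + 1"] mp.subspace_0[OF subP] by (simp add: supp_in_empty)
      then show ?case using step[of 0] by simp
    next
      case (Suc n)
      then have "t - Suc n + 1 = t - n" by simp
      then show ?case using step[of "Suc n"] Suc by simp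
    qed
    from this[of t] have "supp_in (div3 0 t) \<subseteq> ?P" by simp
    moreover have "div3 0 t = {m. expo_deg m = t}" by (auto simp: div3_def)
    ultimately show ?thesis by (simp add: forms_supp)
  qed
  have "f = 0" if f: "f \<in> I2" "f \<in> forms t" "Poly_Mapping.keys f \<subseteq> std d e" for f t
  proof (cases "t \<le> ?T")
    case True
    let ?S = "supp_in (std_part d e 0 t) :: (3, 'a) mpol set"
    have "mp.dim (forms t :: (3, 'a) mpol set) \<le> mp.dim ((I2 \<inter> forms t) + ?S)"
      by (intro mp.dim_mono_fin[OF _ span[OF True]] mp.fin_dim_plus fin_dim_ideal_forms
          fin_dim_supp_in finite_std_part)
    moreover have "mp.dim ((I2 \<inter> forms t) + ?S) + mp.dim {w \<in> ?S. w \<in> I2 \<inter> forms t} =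
        mp.dim (I2 \<inter> forms t) + mp.dim ?S"
      using mmp.dim_add_image[OF linear_ident subspace_ideal_forms[OF idI2] fin_dim_ideal_forms
          subspace_supp_in fin_dim_supp_in[OF finite_std_part]]
      by (simp only: image_ident)
    moreover have "int (mp.dim (forms t :: (3, 'a) mpol set)) = int (mp.dim (I2 \<inter> forms t)) + int (mp.dim ?S)"
      using hf[of t] card_std_part[of d e 0 t] hilb_coord_change[OF shear_GL3 idI, of p t]
      by (simp add: dim_supp_in[OF finite_std_part] I2_def hilb_def)
    ultimately have "mp.dim {w \<in> ?S. w \<in> I2 \<inter> forms t} = 0" by linarith
    then have "{w \<in> ?S. w \<in> I2 \<inter> forms t} \<subseteq> {0}"
      by (intro mp.dim_eq_zero_fin fin_dim_le_forms[of _ t]) auto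
    moreover have "f \<in> ?S" using f(2,3) by (auto simp: supp_in_def std_part_def forms_def homogeneous_def)
    ultimately show ?thesis using f(1,2) by blast
  next
    case False
    then show ?thesis using std_form_zero[OF f(2,3)] by simp
  qed
  then show thesis using that[OF shear_GL3, of p] by (auto simp: std_independent_def I2_def)
qed


lemma linear_form_expand:
  fixes l :: "(3, 'a::field) mpol"
  assumes "homogeneous 1 l"
  shows "l = (\<Sum>i\<in>UNIV. Const (Poly_Mapping.lookup l (Poly_Mapping.single i 1)) * Var i)"
proof -
  let ?s = "\<lambda>i :: 3. Poly_Mapping.single i (1::nat)"
  have "Poly_Mapping.keys l \<subseteq> range ?s"
  proof
    fix m assume "m \<in> Poly_Mapping.keys l"
    then have "expo_deg m = 1" using assms by (auto simp: homogeneous_def)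
    then obtain a b c where m: "m = ex3 a b c" and abc: "a + b + c = 1"
      by (cases m rule: ex3_cases) auto
    consider "a = 1 \<and> b = 0 \<and> c = 0" | "a = 0 \<and> b = 1 \<and> c = 0" | "a = 0 \<and> b = 0 \<and> c = 1"
      using abc by linarith
    then have "m = ?s 1 \<or> m = ?s 2 \<or> m = ?s 3" by cases (auto simp: m ex3_def)
    then show "m \<in> range ?s" by blast
  qed
  then have "l = (\<Sum>m\<in>range ?s. Const (Poly_Mapping.lookup l m) * Monom m)"
    by (intro mpol_expand) auto
  also have "\<dots> = (\<Sum>i\<in>UNIV. Const (Poly_Mapping.lookup l (?s i)) * Monom (?s i))"
    by (subst sum.reindex) (auto simp: inj_def dest!: arg_cong[of _ _ Poly_Mapping.keys])
  finally show ?thesis by (simp only: Var_def)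
qed

text \<open>
  Two of the unit vectors complete a nonzero vector to a basis.
\<close>

lemma GL3_with_third_column:
  fixes c :: "3 \<Rightarrow> 'a::field"
  assumes "c k \<noteq> 0"
  obtains P where "P \<in> GL3" "\<And>i. P $ i $ 3 = c i"
proof -
  have "\<exists>P :: 'a^3^3. det P \<noteq> 0 \<and> (\<forall>i. P $ i $ 3 = c i)"
  proof (cases "c 3 = 0")
    case False
    let ?P = "\<chi> i j. if j = 3 then c i else if i = j then 1 else 0"
    have "det ?P \<noteq> 0" using False by (simp add: det_3)
    then show ?thesis by (intro exI[of _ ?P]) simp
  next
    case c3: True
    show ?thesis
    proof (cases "c 2 = 0")
      case False
      let ?P = "\<chi> i j. if j = 3 then c i else if i = j \<and> i = 1 \<or> i = 3 \<and> j = 2 then 1 else 0"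
      have "det ?P \<noteq> 0" using False c3 by (simp add: det_3)
      then show ?thesis by (intro exI[of _ ?P]) simp
    next
      case True
      then have "c 1 \<noteq> 0" using assms c3 exhaust_3[of k] by auto
      let ?P = "\<chi> i j. if j = 3 then c i else if i = 3 \<and> j = 1 \<or> i = 2 \<and> j = 2 then 1 else 0"
      have "det ?P \<noteq> 0" using \<open>c 1 \<noteq> 0\<close> True c3 by (simp add: det_3)
      then show ?thesis by (intro exI[of _ ?P]) simp
    qed
  qed
  then show thesis using that by (auto simp: GL3_def invertible_det_nz)
qed

text \<open>
  The Lefschetz form is nonzero because \<open>S/I\<close> is nonzero in degrees \<open>0\<close> and \<open>1\<close>; hence some
  coordinate change takes it to \<open>x\<^sub>3\<close>.
\<close>

lemma SLP_good_coordinates: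
  fixes I :: "(3, 'a::field_char_0) mpol set"
  assumes idI: "is_ideal I" and slp: "SLP I" and de: "2 \<le> d" "2 * d \<le> e + 1"
    and hf: "\<And>t. hilb I t = GG (int d) (min (int t) (2 * int d + int e - 3 - int t))"
  obtains A where "A \<in> GL3" "std_independent d e (coord_change A ` I)"
proof -
  obtain l where lef: "lefschetz_elt I l" using SLP_lefschetz_elt[OF slp idI] .
  then have l1: "homogeneous 1 l" by (simp add: lefschetz_elt_def)
  have "l \<noteq> 0"
  proof
    assume l: "l = 0"
    have "mult_space I l 1 0 = I \<inter> forms (0 + 1)"
      using mp.subspace_0[OF subspace_forms, of 0] by (auto simp: mult_space_def l set_plus_def image_def)
    then have "min (hilb I 0) (hilb I (0 + 1)) = 0"
      using dim_mult_space_lefschetz[OF idI lef, of 1 0] by simp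
    have "1 \<le> GG (int d) k" if "0 \<le> k" for k
      using GG_mono[OF that, of "int d"] GG_step[of "int d" 0] de by (simp add: gg_def)
    moreover have "0 \<le> min (int t) (2 * int d + int e - 3 - int t)" if "t \<le> 1" for t
      using de that by linarith
    ultimately have "1 \<le> hilb I t" if "t \<le> 1" for t
      unfolding hf using that by blast
    from this[of 0] this[of "0 + 1"] have "0 < min (hilb I 0) (hilb I (0 + 1))" by simp
    then show False using \<open>min (hilb I 0) (hilb I (0 + 1)) = 0\<close> by linarith
  qed
  have "\<exists>k. Poly_Mapping.lookup l (Poly_Mapping.single k 1) \<noteq> 0"
  proof (rule ccontr)
    assume "\<not> ?thesis"
    then have "(\<Sum>i\<in>UNIV. Const (Poly_Mapping.lookup l (Poly_Mapping.single i 1)) * Var i) = (0 :: (3, 'a) mpol)"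
      by (intro sum.neutral) simp
    then show False using linear_form_expand[OF l1] \<open>l \<noteq> 0\<close> by simp
  qed
  then obtain k where "Poly_Mapping.lookup l (Poly_Mapping.single k 1) \<noteq> 0" ..
  then obtain P where P: "P \<in> GL3" "\<And>i. P $ i $ 3 = Poly_Mapping.lookup l (Poly_Mapping.single i 1)"
    by (rule GL3_with_third_column[where c = "\<lambda>i. Poly_Mapping.lookup l (Poly_Mapping.single i 1)"]) (rule that)
  have Pl: "coord_change P (Var 3) = l"
    unfolding coord_change_Var P(2) by (rule linear_form_expand[OF l1, symmetric])
  obtain A where A: "A \<in> GL3" and "P ** A = mat 1" "A ** P = mat 1"
    "\<And>f :: (3, 'a) mpol. coord_change P (coord_change A f) = f"
    and AP: "\<And>f :: (3, 'a) mpol. coord_change A (coord_change P f) = f"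
    by (rule GL3_inverse[OF P(1)]) (rule that)
  have "lefschetz_elt (coord_change A ` I) (Var 3)"
    using lefschetz_elt_coord_change[OF A lef] AP[of "Var 3"] by (simp add: Pl)
  then obtain A' where A': "A' \<in> GL3" "std_independent d e (coord_change A' ` coord_change A ` I)"
    by (rule generic_spanning[OF is_ideal_coord_change[OF A idI]])
      (use hilb_coord_change[OF A idI] hf in simp, rule that)
  have "coord_change A' ` coord_change A ` I = coord_change (A' ** A) ` I"
    by (simp add: image_image coord_change_comp)
  then show thesis using that[OF GL3_mult[OF A'(1) A]] A'(2) by simp
qed

section \<open>Zariski open sets of matrices\<close>

text \<open>
  Evaluation of a polynomial in the nine matrix entries.
\<close>

definition ev_mat :: "'a::field^3^3 \<Rightarrow> (3 \<times> 3, 'a) mpol \<Rightarrow> 'a" where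
  "ev_mat A = subst_mpol id (\<lambda>(i, j). A $ i $ j)"

lemma rhom_ev_mat: "rhom (ev_mat A)"
  unfolding ev_mat_def by (rule rhom_subst_mpol[OF rhom_id(1)])

lemma ev_mat_simps [simp]: "ev_mat A (Const c) = c" "ev_mat A (Var (i, j)) = A $ i $ j"
  by (simp_all add: ev_mat_def subst_mpol_Const[OF rhom_id(1)] subst_mpol_Var[OF rhom_id(1)])

text \<open>The image of a polynomial under the change of coordinates with indeterminate entries.\<close>

definition generic_image :: "(3, 'a::field) mpol \<Rightarrow> (3, (3 \<times> 3, 'a) mpol) mpol" where
  "generic_image = subst_mpol (\<lambda>c. Const (Const c)) (\<lambda>j. \<Sum>i\<in>UNIV. Const (Var (i, j)) * Var i)"

lemma lookup_coord_change:
  "Poly_Mapping.lookup (coord_change A f) m = ev_mat A (Poly_Mapping.lookup (generic_image f) m)"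
proof -
  define S where "S = subst_mpol (\<lambda>q. Const (ev_mat A q) :: (3, 'a) mpol) Var"
  have h1: "rhom (\<lambda>q. Const (ev_mat A q) :: (3, 'a) mpol)" by (rule rhom_comp[OF rhom_Const rhom_ev_mat])
  have h2: "rhom (\<lambda>c :: 'a. Const (Const c) :: (3, (3 \<times> 3, 'a) mpol) mpol)" by (rule rhom_comp[OF rhom_Const rhom_Const])
  have S: "rhom S" unfolding S_def by (rule rhom_subst_mpol[OF h1])
  have G: "rhom (generic_image :: (3, 'a) mpol \<Rightarrow> _)" unfolding generic_image_def by (rule rhom_subst_mpol[OF h2])
  have SG: "S (generic_image f) = coord_change A f"
  proof (rule rhom_mpol_eqI[OF rhom_comp[OF S G] rhom_coord_change])
    show "S (generic_image (Const c)) = coord_change A (Const c)" for c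
      by (simp add: generic_image_def subst_mpol_Const[OF h2] S_def subst_mpol_Const[OF h1])
    show "S (generic_image (Var j)) = coord_change A (Var j)" for j
      unfolding generic_image_def subst_mpol_Var[OF h2] coord_change_Var rhom_sum[OF S] rhomD(3)[OF S]
      by (simp add: S_def subst_mpol_Const[OF h1] subst_mpol_Var[OF h1])
  qed
  have "Poly_Mapping.lookup (S F) m = ev_mat A (Poly_Mapping.lookup F m)" for F
  proof -
    have SF: "S F = (\<Sum>n\<in>Poly_Mapping.keys F. Const (ev_mat A (Poly_Mapping.lookup F n)) * Monom n)"
      unfolding S_def by (simp add: subst_mpol_superset[OF h1 finite_keys order_refl] Monom_eq_mon)
    have "Poly_Mapping.lookup (S F) m =
        (\<Sum>n\<in>Poly_Mapping.keys F. if n = m then ev_mat A (Poly_Mapping.lookup F m) else 0)"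
      unfolding SF lookup_sum by (rule sum.cong) (auto simp: lookup_Monom)
    then show ?thesis by (simp add: not_in_keys_iff_lookup_eq_zero rhom_zero[OF rhom_ev_mat])
  qed
  then show ?thesis using SG by metis
qed

text \<open>
  Linear independence of a finite family of vectors whose coordinates are specializations of ring
  elements is an open condition on the specialization; the element \<open>p\<close> comes from Gaussian
  elimination without division.
\<close>

lemma independence_open:
  fixes v :: "'i \<Rightarrow> 'm \<Rightarrow> 'r::comm_ring_1" and ev0 :: "'r \<Rightarrow> 'a::field"
  assumes "finite X" "rhom ev0"
    and "\<And>c. (\<And>m. (\<Sum>i\<in>X. c i * ev0 (v i m)) = 0) \<Longrightarrow> \<forall>i\<in>X. c i = 0"
  shows "\<exists>p. ev0 p \<noteq> 0 \<and> (\<forall>ev :: 'r \<Rightarrow> 'a. rhom ev \<longrightarrow> ev p \<noteq> 0 \<longrightarrow>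
    (\<forall>c. (\<forall>m. (\<Sum>i\<in>X. c i * ev (v i m)) = 0) \<longrightarrow> (\<forall>i\<in>X. c i = 0)))"
  using assms(1,3)
proof (induction X arbitrary: v rule: finite_induct)
  case empty
  show ?case using rhomD(1)[OF assms(2)] by (intro exI[of _ 1]) simp
next
  case (insert x X)
  have "\<exists>m. ev0 (v x m) \<noteq> 0"
  proof (rule ccontr)
    assume "\<not> ?thesis"
    then have z: "ev0 (v x m) = 0" for m by blast
    have "(\<Sum>i\<in>insert x X. (if i = x then 1 else 0) * ev0 (v i m)) = 0" for m
      by (intro sum.neutral) (simp add: z)
    then have "\<forall>i\<in>insert x X. (if i = x then 1 else 0) = (0 :: 'a)" by (rule insert.prems)
    then show False by simp
  qed
  then obtain m0 where m0: "ev0 (v x m0) \<noteq> 0" ..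
  define v' where "v' i m = v x m0 * v i m - v i m0 * v x m" for i m
  have ev': "(\<Sum>i\<in>X. c i * ev (v' i m)) =
      ev (v x m0) * (\<Sum>i\<in>X. c i * ev (v i m)) - (\<Sum>i\<in>X. c i * ev (v i m0)) * ev (v x m)"
    if "rhom ev" for ev :: "'r \<Rightarrow> 'a" and c m
  proof -
    have e: "ev (v' i m) = ev (v x m0) * ev (v i m) - ev (v i m0) * ev (v x m)" for i
      unfolding v'_def by (simp only: rhomD(3)[OF that] rhom_diff[OF that])
    have "c i * (a * y - z * b) = a * (c i * y) - c i * z * b" for i and a b y z :: 'a
      by (simp add: algebra_simps)
    then show ?thesis by (simp only: e sum_subtractf sum_distrib_left sum_distrib_right)
  qed
  have "\<forall>i\<in>X. c i = 0" if c: "\<And>m. (\<Sum>i\<in>X. c i * ev0 (v' i m)) = 0" for c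
  proof -
    define c' where "c' i = (if i = x then - (\<Sum>i\<in>X. c i * ev0 (v i m0)) else ev0 (v x m0) * c i)" for i
    have "(\<Sum>i\<in>insert x X. c' i * ev0 (v i m)) = 0" for m
    proof -
      have "(\<Sum>i\<in>X. c' i * ev0 (v i m)) = ev0 (v x m0) * (\<Sum>i\<in>X. c i * ev0 (v i m))"
        unfolding sum_distrib_left using insert.hyps(2) by (intro sum.cong) (auto simp: c'_def)
      moreover have "c' x * ev0 (v x m) = - ((\<Sum>i\<in>X. c i * ev0 (v i m0)) * ev0 (v x m))"
        by (simp add: c'_def)
      ultimately show ?thesis using c[of m] ev'[OF assms(2), of c m] insert.hyps by simp
    qed
    then have c'0: "\<forall>i\<in>insert x X. c' i = 0" by (rule insert.prems)
    show ?thesis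
    proof
      fix i assume i: "i \<in> X"
      then have "c' i = 0" "i \<noteq> x" using c'0 insert.hyps(2) by auto
      then show "c i = 0" using m0 by (simp add: c'_def)
    qed
  qed
  from insert.IH[OF this] obtain p where p0: "ev0 p \<noteq> 0" and
    p: "\<And>(ev :: 'r \<Rightarrow> 'a) c. rhom ev \<Longrightarrow> ev p \<noteq> 0 \<Longrightarrow> \<forall>m. (\<Sum>i\<in>X. c i * ev (v' i m)) = 0 \<Longrightarrow> \<forall>i\<in>X. c i = 0"
    by blast
  show ?case
  proof (intro exI[of _ "p * v x m0"] conjI allI impI)
    show "ev0 (p * v x m0) \<noteq> 0" using p0 m0 by (simp add: rhomD[OF assms(2)])
    fix ev :: "'r \<Rightarrow> 'a" and c
    assume ev: "rhom ev" "ev (p * v x m0) \<noteq> 0" and c: "\<forall>m. (\<Sum>i\<in>insert x X. c i * ev (v i m)) = 0"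
    have ne: "ev p \<noteq> 0" "ev (v x m0) \<noteq> 0" using ev(2) by (auto simp: rhomD[OF ev(1)])
    have cx: "(\<Sum>i\<in>X. c i * ev (v i m)) = - (c x * ev (v x m))" for m
      using c insert.hyps by (simp add: eq_neg_iff_add_eq_0 add.commute)
    have "\<forall>m. (\<Sum>i\<in>X. c i * ev (v' i m)) = 0"
      unfolding ev'[OF ev(1)] cx by (simp add: mult_ac)
    then have cX: "\<forall>i\<in>X. c i = 0" by (rule p[OF ev(1) ne(1)])
    then have "(\<Sum>i\<in>X. c i * ev (v i m0)) = 0" by (intro sum.neutral) simp
    then have "c x = 0" using cx[of m0] ne(2) by simp
    then show "\<forall>i\<in>insert x X. c i = 0" using cX by blast
  qed
qed

text \<open>
  In degree \<open>t\<close>, independence of the standard monomials modulo \<open>\<alpha>I\<close> follows from independence of these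
  monomials together with the images under \<open>\<alpha>\<close> of a basis of \<open>I\<^sub>t\<close>, whose coefficients are
  polynomials in the entries of \<open>\<alpha>\<close>. Finitely many degrees matter.
\<close>

lemma std_independent_open:
  fixes I :: "(3, 'a::field) mpol set"
  assumes A0: "A0 \<in> GL3" and idI: "is_ideal I" and ind: "std_independent d e (coord_change A0 ` I)"
  obtains p where "ev_mat A0 p \<noteq> 0"
    "\<And>A. A \<in> GL3 \<Longrightarrow> ev_mat A p \<noteq> 0 \<Longrightarrow> std_independent d e (coord_change A ` I)"
proof -
  have "\<exists>p. ev_mat A0 p \<noteq> 0 \<and> (\<forall>A\<in>GL3. ev_mat A p \<noteq> 0 \<longrightarrow>
      (\<forall>f. f \<in> coord_change A ` I \<longrightarrow> f \<in> forms t \<longrightarrow> Poly_Mapping.keys f \<subseteq> std d e \<longrightarrow> f = 0))" for t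
  proof -
    obtain F where F: "finite F" "F \<subseteq> I \<inter> forms t" "mp.independent F" "I \<inter> forms t \<subseteq> mp.span F"
      "card F = mp.dim (I \<inter> forms t)"
      by (rule mp.fin_dim_basis[OF fin_dim_ideal_forms]) (rule that)
    let ?M = "std_part d e 0 t"
    define v where "v i = (case i of Inl f \<Rightarrow> Poly_Mapping.lookup (generic_image f)
      | Inr m \<Rightarrow> (\<lambda>n. if m = n then 1 else 0))" for i :: "(3, 'a) mpol + 3 expo"
    have comb: "(\<Sum>i\<in>F <+> ?M. c i * ev_mat A (v i n)) = Poly_Mapping.lookup
        (coord_change A (\<Sum>f\<in>F. scl (c (Inl f)) f) + (\<Sum>m\<in>?M. scl (c (Inr m)) (Monom m))) n" for c A n
    proof -
      have "coord_change A (\<Sum>f\<in>F. scl (c (Inl f)) f) = (\<Sum>f\<in>F. scl (c (Inl f)) (coord_change A f))"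
        by (simp add: rhom_sum[OF rhom_coord_change] rhomD(3)[OF rhom_coord_change] scl_def)
      then show ?thesis
        using F(1) finite_std_part[of d e 0 t]
        by (simp add: sum.Plus v_def lookup_add lookup_sum lookup_coord_change lookup_Monom
            rhomD(1)[OF rhom_ev_mat] rhom_zero[OF rhom_ev_mat] if_distrib[of "ev_mat A"] cong: if_cong)
    qed
    have supp: "(\<Sum>m\<in>?M. scl (c m) (Monom m)) \<in> (supp_in ?M :: (3, 'a) mpol set)" for c
      by (intro mp.subspace_sum[OF subspace_supp_in] mp.subspace_scale[OF subspace_supp_in])
        (simp add: supp_in_def)
    have std_zero: "c m = 0" if "(\<Sum>m\<in>?M. scl (c m) (Monom m)) = (0 :: (3, 'a) mpol)" "m \<in> ?M" for c m
    proof -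
      have "Poly_Mapping.lookup (\<Sum>m\<in>?M. scl (c m) (Monom m)) m = (\<Sum>n\<in>?M. if n = m then c m else 0)"
        unfolding lookup_sum by (rule sum.cong) (auto simp: lookup_Monom)
      then show ?thesis using that finite_std_part[of d e 0 t] by simp
    qed
    have A0ind: "\<forall>i\<in>F <+> ?M. c i = 0" if c: "\<And>n. (\<Sum>i\<in>F <+> ?M. c i * ev_mat A0 (v i n)) = 0" for c
    proof -
      let ?f = "\<Sum>f\<in>F. scl (c (Inl f)) f" and ?g = "\<Sum>m\<in>?M. scl (c (Inr m)) (Monom m) :: (3, 'a) mpol"
      have sum0: "coord_change A0 ?f + ?g = 0"
        by (rule poly_mapping_eqI) (use c comb in simp)
      have fI: "?f \<in> I \<inter> forms t"
        using subspace_ideal_forms[OF idI] F(2) by (intro mp.subspace_sum mp.subspace_scale) auto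
      have "coord_change A0 ?f = - ?g" using sum0 by (simp add: eq_neg_iff_add_eq_0)
      moreover have "Poly_Mapping.keys (- ?g) \<subseteq> std d e"
        using supp[of "\<lambda>m. c (Inr m)"] by (auto simp: supp_in_def std_part_def in_keys_iff)
      ultimately have "Poly_Mapping.keys (coord_change A0 ?f) \<subseteq> std d e" by simp
      then have z: "coord_change A0 ?f = 0"
        using ind fI coord_change_forms unfolding std_independent_def by blast
      then have "?f = 0"
        using coord_change_inj[OF A0, of ?f 0] by (simp add: rhom_zero[OF rhom_coord_change])
      then have "c (Inl f) = 0" if "f \<in> F" for f
        using mp.independentD[OF F(3,1) order_refl _ that, of "\<lambda>f. c (Inl f)"] by simp
      moreover have "c (Inr m) = 0" if "m \<in> ?M" for m
        using std_zero[of "\<lambda>m. c (Inr m)" m] sum0 z that by simp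
      ultimately show ?thesis by auto
    qed
    have "finite (F <+> ?M)" using F(1) finite_std_part by simp
    note ex = independence_open[where v = v, OF this rhom_ev_mat[of A0] A0ind]
    from ex obtain p where p_ex: "ev_mat A0 p \<noteq> 0 \<and> (\<forall>ev :: (3 \<times> 3, 'a) mpol \<Rightarrow> 'a. rhom ev \<longrightarrow> ev p \<noteq> 0 \<longrightarrow>
        (\<forall>c. (\<forall>n. (\<Sum>i\<in>F <+> ?M. c i * ev (v i n)) = 0) \<longrightarrow> (\<forall>i\<in>F <+> ?M. c i = 0)))" ..
    then have p0: "ev_mat A0 p \<noteq> 0" and
      p: "\<And>(ev :: (3 \<times> 3, 'a) mpol \<Rightarrow> 'a) c. rhom ev \<Longrightarrow> ev p \<noteq> 0 \<Longrightarrow> \<forall>n. (\<Sum>i\<in>F <+> ?M. c i * ev (v i n)) = 0 \<Longrightarrow> \<forall>i\<in>F <+> ?M. c i = 0"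
      by blast+
    have "f = 0" if A: "A \<in> GL3" "ev_mat A p \<noteq> 0" and f: "f \<in> coord_change A ` I" "f \<in> forms t"
      "Poly_Mapping.keys f \<subseteq> std d e" for A f
    proof -
      obtain g where g: "g \<in> I \<inter> forms t" "f = coord_change A g"
        using coord_change_image_forms[OF A(1), of I t] f by blast
      then obtain u where u: "g = (\<Sum>h\<in>F. scl (u h) h)"
        using F(4) mp.span_finite[OF F(1)] by blast
      have fM: "Poly_Mapping.keys f \<subseteq> ?M"
        using f(2,3) by (auto simp: std_part_def forms_def homogeneous_def)
      have fexp: "f = (\<Sum>m\<in>?M. Const (Poly_Mapping.lookup f m) * Monom m)"
        by (rule mpol_expand[OF finite_std_part fM])
      define c where "c i = (case i of Inl h \<Rightarrow> u h | Inr m \<Rightarrow> - Poly_Mapping.lookup f m)"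
        for i :: "(3, 'a) mpol + 3 expo"
      have "(\<Sum>m\<in>?M. scl (c (Inr m)) (Monom m)) =
          - (\<Sum>m\<in>?M. Const (Poly_Mapping.lookup f m) * Monom m)"
        by (simp add: c_def scl_def rhom_uminus[OF rhom_Const] sum_negf)
      also have "\<dots> = - f" by (rule arg_cong[OF fexp[symmetric]])
      finally have "(\<Sum>m\<in>?M. scl (c (Inr m)) (Monom m)) = - f" .
      moreover have "coord_change A (\<Sum>h\<in>F. scl (c (Inl h)) h) = f" by (simp add: c_def u[symmetric] g(2))
      ultimately have "\<forall>n. (\<Sum>i\<in>F <+> ?M. c i * ev_mat A (v i n)) = 0" unfolding comb by simp
      from p[OF rhom_ev_mat A(2) this] have "Poly_Mapping.lookup f m = 0" if "m \<in> ?M" for m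
        using that by (force simp: c_def)
      then show "f = 0" by (subst fexp) simp
    qed
    then show ?thesis using p0 by blast
  qed
  then have "\<forall>t. \<exists>p. ev_mat A0 p \<noteq> 0 \<and> (\<forall>A\<in>GL3. ev_mat A p \<noteq> 0 \<longrightarrow>
      (\<forall>f. f \<in> coord_change A ` I \<longrightarrow> f \<in> forms t \<longrightarrow> Poly_Mapping.keys f \<subseteq> std d e \<longrightarrow> f = 0))" ..
  from choice[OF this] obtain p where p: "\<forall>t. ev_mat A0 (p t) \<noteq> 0 \<and> (\<forall>A\<in>GL3. ev_mat A (p t) \<noteq> 0 \<longrightarrow>
      (\<forall>f. f \<in> coord_change A ` I \<longrightarrow> f \<in> forms t \<longrightarrow> Poly_Mapping.keys f \<subseteq> std d e \<longrightarrow> f = 0))" ..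
  let ?q = "\<Prod>t\<le>2 * d + e. p t"
  have "ev_mat A0 ?q \<noteq> 0" using p by (simp add: rhom_prod[OF rhom_ev_mat])
  moreover have "std_independent d e (coord_change A ` I)" if A: "A \<in> GL3" "ev_mat A ?q \<noteq> 0" for A
    unfolding std_independent_def
  proof (intro allI impI)
    fix t f assume f: "f \<in> coord_change A ` I" "f \<in> forms t" "Poly_Mapping.keys f \<subseteq> std d e"
    show "f = 0"
    proof (cases "t \<le> 2 * d + e")
      case True
      then have "ev_mat A (p t) \<noteq> 0" using A(2) by (simp add: rhom_prod[OF rhom_ev_mat])
      then show ?thesis using p A(1) f by blast
    next
      case False
      then show ?thesis using std_form_zero[OF f(2,3)] by simp
    qed
  qed
  ultimately show thesis using that by blast
qed

text \<open>
  On the line through a point of \<open>U\<close> and a point of \<open>V\<close>, the polynomials defining \<open>U\<close> and \<open>V\<close> and the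
  determinant restrict to nonzero univariate polynomials.
\<close>

lemma zariski_open_GL3_meet:
  fixes U V :: "('a::field_char_0^3^3) set"
  assumes "zariski_open_GL3 U" "zariski_open_GL3 V" "U \<noteq> {}" "V \<noteq> {}"
  shows "U \<inter> V \<noteq> {}"
proof -
  have opn: "\<exists>A\<in>GL3. \<exists>p. ev_mat A p \<noteq> 0 \<and> (\<forall>B\<in>GL3. ev_mat B p \<noteq> 0 \<longrightarrow> B \<in> W)"
    if "zariski_open_GL3 W" "W \<noteq> {}" for W :: "('a^3^3) set"
    using that by (fastforce simp: zariski_open_GL3_def ev_mat_def)
  obtain A p where A: "A \<in> GL3" "ev_mat A p \<noteq> 0" and p: "\<And>C. C \<in> GL3 \<Longrightarrow> ev_mat C p \<noteq> 0 \<Longrightarrow> C \<in> U"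
    using opn[OF assms(1,3)] by blast
  obtain B q where B: "B \<in> GL3" "ev_mat B q \<noteq> 0" and q: "\<And>C. C \<in> GL3 \<Longrightarrow> ev_mat C q \<noteq> 0 \<Longrightarrow> C \<in> V"
    using opn[OF assms(2,4)] by blast
  define L where "L s = (\<chi> i j. A $ i $ j + s * (B $ i $ j - A $ i $ j))" for s
  define lin where "lin = subst_mpol (\<lambda>c. [:c:]) (\<lambda>(i, j). [:A $ i $ j, B $ i $ j - A $ i $ j:])"
  have lin: "rhom lin" unfolding lin_def by (rule rhom_subst_mpol[OF rhom_const_poly])
  have ev: "ev_mat (L s) r = poly (lin r) s" for s r
  proof (rule rhom_mpol_eqI[OF rhom_ev_mat])
    show "rhom (\<lambda>r. poly (lin r) s)" by (simp add: rhom_def rhomD[OF lin])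
    show "ev_mat (L s) (Var ij) = poly (lin (Var ij)) s" for ij
      by (cases ij) (simp add: lin_def subst_mpol_Var[OF rhom_const_poly] L_def)
  qed (simp add: lin_def subst_mpol_Const[OF rhom_const_poly])
  define D :: "(3 \<times> 3, 'a) mpol" where "D = det (\<chi> i j. Var (i, j))"
  have D: "ev_mat C D = det C" for C
    by (simp add: D_def det_3 rhomD[OF rhom_ev_mat] rhom_diff[OF rhom_ev_mat])
  have L01: "L 0 = A" "L 1 = B" by (simp_all add: L_def vec_eq_iff)
  have "poly (lin p) 0 \<noteq> 0" "poly (lin q) 1 \<noteq> 0" "poly (lin D) 0 \<noteq> 0"
    using A B by (simp_all add: ev[symmetric] L01 D GL3_def invertible_det_nz)
  then have "lin p * lin q * lin D \<noteq> 0" by auto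
  then have "finite {s. poly (lin p * lin q * lin D) s = 0}" by (rule poly_roots_finite)
  then obtain s where "poly (lin p * lin q * lin D) s \<noteq> 0"
    using ex_new_if_finite[OF infinite_UNIV_char_0] by blast
  then have "ev_mat (L s) p \<noteq> 0" "ev_mat (L s) q \<noteq> 0" "ev_mat (L s) D \<noteq> 0" by (simp_all add: ev)
  then have "L s \<in> U \<inter> V" using p q by (simp add: D GL3_def invertible_det_nz)
  then show ?thesis by blast
qed

text \<open>
  The description in the definition of \<^const>\<open>gin\<close> determines the ideal uniquely.
\<close>

lemma gin_eqI:
  fixes I :: "(3, 'a::field_char_0) mpol set"
  assumes "zariski_open_GL3 U" "U \<noteq> {}" "\<And>A. A \<in> U \<Longrightarrow> initial_ideal (coord_change A ` I) = J"
  shows "gin I = J"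
  unfolding gin_def
proof (rule the_equality)
  show "\<exists>U. zariski_open_GL3 U \<and> U \<noteq> {} \<and> (\<forall>A\<in>U. initial_ideal (coord_change A ` I) = J)"
    using assms by blast
next
  fix J' assume "\<exists>U. zariski_open_GL3 U \<and> U \<noteq> {} \<and> (\<forall>A\<in>U. initial_ideal (coord_change A ` I) = J')"
  then obtain V where V: "zariski_open_GL3 V" "V \<noteq> {}" "\<And>A. A \<in> V \<Longrightarrow> initial_ideal (coord_change A ` I) = J'"
    by blast
  obtain A where "A \<in> U" "A \<in> V" using zariski_open_GL3_meet[OF assms(1) V(1) assms(2) V(2)] by blast
  then show "J' = J" using assms(3)[of A] V(3)[of A] by simp
qed

section \<open>The generic initial ideal\<close>

theorem proposition2p2p3:
  fixes d d\<^sub>3 :: nat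
    and f\<^sub>1 f\<^sub>2 f\<^sub>3 :: "(3, 'a::field_char_0) mpol"
    and I J :: "(3, 'a) mpol set"
  assumes "2 \<le> d" and "d < d\<^sub>3" and "2 * d \<le> d\<^sub>3 + 1"
    and "homogeneous d f\<^sub>1" and "homogeneous d f\<^sub>2" and "homogeneous d\<^sub>3 f\<^sub>3"
    and "regular_sequence [f\<^sub>1, f\<^sub>2, f\<^sub>3]"
    and "I = gen_ideal {f\<^sub>1, f\<^sub>2, f\<^sub>3}"
    and "J = gin I"
    and "SLP I"
  shows "J = gen_ideal
    ({Var 1 ^ d} \<union> {Var 1 ^ (d - j - 1) * Var 2 ^ (2 * j + 1) | j. j \<le> d - 1}
     \<union> {Var 2 ^ (2 * d - 2 * j - 2) * Var 3 ^ (d\<^sub>3 + 2 * j + 2 - 2 * d) * u | j u.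
          j \<le> d - 2 \<and> u \<in> monomials12 j}
     \<union> {Var 3 ^ (d\<^sub>3 + 2 * j - 2) * u | j u. 1 \<le> j \<and> j \<le> d \<and> u \<in> monomials12 (d - j)})"
proof -
  have idI: "is_ideal I" unfolding assms(8) by (rule is_ideal_gen_ideal)
  have hid: "hideal I" unfolding assms(8) by (rule hideal_three[OF assms(4-6)])
  have hf: "hilb I t = GG (int d) (min (int t) (2 * int d + int d\<^sub>3 - 3 - int t))" for t
    unfolding assms(8) using assms(1) by (intro hilb_complete_intersection assms) simp
  obtain A0 where A0: "A0 \<in> GL3" "std_independent d d\<^sub>3 (coord_change A0 ` I)"
    by (rule SLP_good_coordinates[OF idI assms(10,1,3) hf]) (rule that)
  obtain p where p: "ev_mat A0 p \<noteq> 0"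
    "\<And>A. A \<in> GL3 \<Longrightarrow> ev_mat A p \<noteq> 0 \<Longrightarrow> std_independent d d\<^sub>3 (coord_change A ` I)"
    by (rule std_independent_open[OF A0(1) idI A0(2)]) (rule that)
  let ?U = "{A \<in> GL3. ev_mat A p \<noteq> 0}"
  have "gin I = gen_ideal {Monom m | m. m \<notin> std d d\<^sub>3}"
  proof (rule gin_eqI)
    show "zariski_open_GL3 ?U"
      unfolding zariski_open_GL3_def ev_mat_def by (intro exI[of _ "{p}"]) simp
    show "?U \<noteq> {}" using A0(1) p(1) by blast
    fix A assume "A \<in> ?U"
    then have A: "A \<in> GL3" and ind: "std_independent d d\<^sub>3 (coord_change A ` I)" using p(2) by auto
    show "initial_ideal (coord_change A ` I) = gen_ideal {Monom m | m. m \<notin> std d d\<^sub>3}"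
    proof (rule initial_ideal_eq_std)
      show hidA: "hideal (coord_change A ` I)" by (rule hideal_coord_change[OF A hid])
      show "hilb (coord_change A ` I) t = GG (int d) (min (int t) (2 * int d + int d\<^sub>3 - 3 - int t))" for t
        unfolding hilb_coord_change[OF A idI] by (rule hf)
      fix f assume f: "f \<in> coord_change A ` I" "Poly_Mapping.keys f \<subseteq> std d d\<^sub>3"
      have "hcomp t f = 0" for t
      proof -
        have "Poly_Mapping.keys (hcomp t f) \<subseteq> std d d\<^sub>3"
          using f(2) by (auto simp: in_keys_iff lookup_hcomp split: if_splits)
        moreover have "hcomp t f \<in> coord_change A ` I" using hidA f(1) unfolding hideal_def by blast
        moreover have "hcomp t f \<in> forms t" by (simp add: forms_def)
        ultimately show ?thesis using ind unfolding std_independent_def by blast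
      qed
      then show "f = 0" using sum_hcomp[of f] by simp
    qed
  qed
  then show ?thesis unfolding assms(9) using gen_ideal_nonstandard[OF assms(1,3)] by simp
qed

end
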